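(* Let $T$ be a complete first order theory with infinite models, and let $\lambda \geq |T|$ be a cardinal such that $T$ is stable in $\lambda$. Let $\mu_1, \mu_2$ be regular infinite cardinals with $\mu_1 < \kappa_r(T)$ and $\mu_1 < \mu_2 < \lambda^+$. Then a $(\lambda, \mu_1)$-limit model of $T$ and a $(\lambda, \mu_2)$-limit model of $T$ are not isomorphic.
   Context: $|T|$ denotes $|\mathrm{L}(T)| + \aleph_0$. $T$ is stable in $\lambda$ if for every set $A$ of size $\leq \lambda$ there are at most $\lambda$ complete 1-types over $A$. For models $M, N \models T$ with $\|M\| = \|N\|$, $N$ is universal over $M$ if $M \preccurlyeq N$ and for every $M' \models T$ with $M \preccurlyeq M'$ and $\|M'\| = \|N\|$ there is an elementary embedding $f : M' \to N$ fixing $M$ pointwise. For a limit ordinal $\delta < \lambda^+$, a $(\lambda, \delta)$-limit model is a model $N$ for which there is an increasing continuous chain $\langle M_\alpha : \alpha \leq \delta\rangle$ of models of $T$, each of cardinality $\lambda$, with $M_\delta = N$ and $M_{\alpha+1}$ universal over $M_\alpha$ for all $\alpha < \delta$. $\kappa(T)$ is the least cardinal $\kappa$ such that for every $\subseteq$-increasing sequence of sets $\langle A_i : i \leq \kappa\rangle$ and every complete type $p$ over $\bigcup_{i<\kappa} A_i$ there is $i<\kappa$ such that $p$ does not fork over $A_i$ ($\kappa(T)=\infty$ if no such $\kappa$ exists). $\kappa_r(T)$ is the least regular cardinal $\geq \kappa(T)$, or $\infty$ if $\kappa(T) = \infty$. *)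

theory Defs
  imports Main
begin

unbundle cardinal_syntax

text \<open>
  One sufficiently large type \<open>'a\<close> plays the role of the set-theoretic universe: structures have a
  subset of \<open>'a\<close> as their universe, and quantification over models, sets of parameters and
  elementary extensions is quantification inside \<open>'a\<close>. Cardinals and ordinals are well-orders in
  \<open>'a rel\<close>, compared by \<open>\<le>o\<close>, \<open><o\<close>, \<open>=o\<close>. The definitions have their usual meaning as long as
  \<open>'a\<close> has more elements than the cardinals considered; that is a hypothesis of the theorem and
  costs no generality, since \<open>'a\<close> is an arbitrary type.
\<close>

section \<open>First-order logic\<close>

record ('f, 'r) lang =
  funs :: "'f set"
  rels :: "'r set"
  farity :: "'f \<Rightarrow> nat"
  rarity :: "'r \<Rightarrow> nat"

datatype 'f tm = Var nat | Fun 'f "'f tm list"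

datatype ('f, 'r) fm =
    Eq "'f tm" "'f tm"
  | Rel 'r "'f tm list"
  | Neg "('f, 'r) fm"
  | And "('f, 'r) fm" "('f, 'r) fm"
  | Ex nat "('f, 'r) fm"

fun tm_in :: "('f, 'r) lang \<Rightarrow> 'f tm \<Rightarrow> bool" where
  "tm_in L (Var v) \<longleftrightarrow> True"
| "tm_in L (Fun f ts) \<longleftrightarrow>
     f \<in> funs L \<and> length ts = farity L f \<and> (\<forall>t\<in>set ts. tm_in L t)"

primrec fm_in :: "('f, 'r) lang \<Rightarrow> ('f, 'r) fm \<Rightarrow> bool" where
  "fm_in L (Eq s t) \<longleftrightarrow> tm_in L s \<and> tm_in L t"
| "fm_in L (Rel r ts) \<longleftrightarrow> r \<in> rels L \<and> length ts = rarity L r \<and> (\<forall>t\<in>set ts. tm_in L t)"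
| "fm_in L (Neg p) \<longleftrightarrow> fm_in L p"
| "fm_in L (And p q) \<longleftrightarrow> fm_in L p \<and> fm_in L q"
| "fm_in L (Ex v p) \<longleftrightarrow> fm_in L p"

fun tm_vars :: "'f tm \<Rightarrow> nat set" where
  "tm_vars (Var v) = {v}"
| "tm_vars (Fun f ts) = (\<Union>t\<in>set ts. tm_vars t)"

primrec fv :: "('f, 'r) fm \<Rightarrow> nat set" where
  "fv (Eq s t) = tm_vars s \<union> tm_vars t"
| "fv (Rel r ts) = (\<Union>t\<in>set ts. tm_vars t)"
| "fv (Neg p) = fv p"
| "fv (And p q) = fv p \<union> fv q"
| "fv (Ex v p) = fv p - {v}"

definition sentences :: "('f, 'r) lang \<Rightarrow> ('f, 'r) fm set" where
  "sentences L = {\<phi>. fm_in L \<phi> \<and> fv \<phi> = {}}"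

record ('f, 'r, 'a) struct =
  univ :: "'a set"
  fint :: "'f \<Rightarrow> 'a list \<Rightarrow> 'a"
  rint :: "'r \<Rightarrow> 'a list \<Rightarrow> bool"

definition is_struct :: "('f, 'r) lang \<Rightarrow> ('f, 'r, 'a) struct \<Rightarrow> bool" where
  "is_struct L M \<longleftrightarrow> univ M \<noteq> {} \<and>
     (\<forall>f\<in>funs L. \<forall>xs\<in>lists (univ M). length xs = farity L f \<longrightarrow> fint M f xs \<in> univ M)"

primrec eval_tm :: "('f, 'r, 'a) struct \<Rightarrow> (nat \<Rightarrow> 'a) \<Rightarrow> 'f tm \<Rightarrow> 'a" where
  "eval_tm M e (Var v) = e v"
| "eval_tm M e (Fun f ts) = fint M f (map (eval_tm M e) ts)"

primrec sat :: "('f, 'r, 'a) struct \<Rightarrow> (nat \<Rightarrow> 'a) \<Rightarrow> ('f, 'r) fm \<Rightarrow> bool" where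
  "sat M e (Eq s t) \<longleftrightarrow> eval_tm M e s = eval_tm M e t"
| "sat M e (Rel r ts) \<longleftrightarrow> rint M r (map (eval_tm M e) ts)"
| "sat M e (Neg p) \<longleftrightarrow> \<not> sat M e p"
| "sat M e (And p q) \<longleftrightarrow> sat M e p \<and> sat M e q"
| "sat M e (Ex v p) \<longleftrightarrow> (\<exists>x\<in>univ M. sat M (e(v := x)) p)"

definition holds :: "('f, 'r, 'a) struct \<Rightarrow> ('f, 'r) fm \<Rightarrow> bool" where
  "holds M \<phi> \<longleftrightarrow> (\<forall>e. range e \<subseteq> univ M \<longrightarrow> sat M e \<phi>)"

definition is_model ::
  "('f, 'r) lang \<Rightarrow> ('f, 'r) fm set \<Rightarrow> ('f, 'r, 'a) struct \<Rightarrow> bool" where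
  "is_model L T M \<longleftrightarrow> is_struct L M \<and> (\<forall>\<phi>\<in>T. holds M \<phi>)"

definition entails ::
  "'a itself \<Rightarrow> ('f, 'r) lang \<Rightarrow> ('f, 'r) fm set \<Rightarrow> ('f, 'r) fm \<Rightarrow> bool" where
  "entails _ L T \<phi> \<longleftrightarrow> (\<forall>M :: ('f, 'r, 'a) struct. is_model L T M \<longrightarrow> holds M \<phi>)"

definition complete_theory ::
  "'a itself \<Rightarrow> ('f, 'r) lang \<Rightarrow> ('f, 'r) fm set \<Rightarrow> bool" where
  "complete_theory U L T \<longleftrightarrow> T \<subseteq> sentences L \<and>
     (\<exists>M :: ('f, 'r, 'a) struct. is_model L T M) \<and>
     (\<forall>\<phi>\<in>sentences L. entails U L T \<phi> \<or> entails U L T (Neg \<phi>))"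

definition has_infinite_model ::
  "'a itself \<Rightarrow> ('f, 'r) lang \<Rightarrow> ('f, 'r) fm set \<Rightarrow> bool" where
  "has_infinite_model _ L T \<longleftrightarrow>
     (\<exists>M :: ('f, 'r, 'a) struct. is_model L T M \<and> infinite (univ M))"

text \<open>\<open>|T| = |L(T)| + \<aleph>\<^sub>0\<close>, where \<open>L = L(T)\<close>.\<close>

abbreviation theory_card :: "('f, 'r) lang \<Rightarrow> (('f + 'r) + nat) rel" where
  "theory_card L \<equiv> ( |funs L| +c |rels L| ) +c natLeq"

definition isomorphic ::
  "('f, 'r) lang \<Rightarrow> ('f, 'r, 'a) struct \<Rightarrow> ('f, 'r, 'a) struct \<Rightarrow> bool" where
  "isomorphic L M N \<longleftrightarrow> (\<exists>h. bij_betw h (univ M) (univ N) \<and>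
     (\<forall>f\<in>funs L. \<forall>xs\<in>lists (univ M). length xs = farity L f \<longrightarrow>
        h (fint M f xs) = fint N f (map h xs)) \<and>
     (\<forall>r\<in>rels L. \<forall>xs\<in>lists (univ M). length xs = rarity L r \<longrightarrow>
        (rint M r xs \<longleftrightarrow> rint N r (map h xs))))"

definition elem_embedding ::
  "('f, 'r) lang \<Rightarrow> ('f, 'r, 'a) struct \<Rightarrow> ('f, 'r, 'a) struct \<Rightarrow> ('a \<Rightarrow> 'a) \<Rightarrow> bool" where
  "elem_embedding L M N h \<longleftrightarrow> h ` univ M \<subseteq> univ N \<and>
     (\<forall>\<phi> e. fm_in L \<phi> \<and> range e \<subseteq> univ M \<longrightarrow> (sat M e \<phi> \<longleftrightarrow> sat N (h \<circ> e) \<phi>))"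

definition elem_sub ::
  "('f, 'r) lang \<Rightarrow> ('f, 'r, 'a) struct \<Rightarrow> ('f, 'r, 'a) struct \<Rightarrow> bool" where
  "elem_sub L M N \<longleftrightarrow> univ M \<subseteq> univ N \<and>
     (\<forall>\<phi> e. fm_in L \<phi> \<and> range e \<subseteq> univ M \<longrightarrow> (sat M e \<phi> \<longleftrightarrow> sat N e \<phi>))"

section \<open>Types and stability\<close>

text \<open>
  An \<open>L(A)\<close>-formula \<open>\<phi>(x\<^sub>0,\<dots>,x\<^sub>n\<^sub>-\<^sub>1,b)\<close> is represented by the pair \<open>(\<phi>, b)\<close> of an \<open>L\<close>-formula and a
  tuple \<open>b\<close> from \<open>A\<close>; the variables \<open>0, \<dots>, n - 1\<close> of \<open>\<phi>\<close> stand for \<open>x\<close> and the variables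
  \<open>n, \<dots>, n + length b - 1\<close> for \<open>b\<close>.
\<close>

definition pfmls :: "('f, 'r) lang \<Rightarrow> nat \<Rightarrow> 'a set \<Rightarrow> (('f, 'r) fm \<times> 'a list) set" where
  "pfmls L n A = {(\<phi>, b). fm_in L \<phi> \<and> b \<in> lists A \<and> fv \<phi> \<subseteq> {..<n + length b}}"

definition psat ::
  "('f, 'r, 'a) struct \<Rightarrow> 'a list \<Rightarrow> ('f, 'r) fm \<times> 'a list \<Rightarrow> bool" where
  "psat M x = (\<lambda>(\<phi>, b). sat M (\<lambda>i. (x @ b) ! i) \<phi>)"

definition tuples :: "('f, 'r, 'a) struct \<Rightarrow> nat \<Rightarrow> 'a list set" where
  "tuples M n = {x \<in> lists (univ M). length x = n}"

text \<open>Complete \<open>n\<close>-types over \<open>A \<subseteq> univ M\<close>, consistent with the theory of \<open>M\<close> with names for \<open>A\<close>.\<close>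

definition complete_type ::
  "('f, 'r) lang \<Rightarrow> ('f, 'r, 'a) struct \<Rightarrow> nat \<Rightarrow> 'a set \<Rightarrow> (('f, 'r) fm \<times> 'a list) set \<Rightarrow> bool"
where
  "complete_type L M n A p \<longleftrightarrow> p \<subseteq> pfmls L n A \<and>
     (\<forall>q. finite q \<and> q \<subseteq> p \<longrightarrow> (\<exists>x\<in>tuples M n. \<forall>\<psi>\<in>q. psat M x \<psi>)) \<and>
     (\<forall>(\<phi>, b)\<in>pfmls L n A. (\<phi>, b) \<in> p \<or> (Neg \<phi>, b) \<in> p)"

definition stable_in :: "('f, 'r) lang \<Rightarrow> ('f, 'r) fm set \<Rightarrow> 'a rel \<Rightarrow> bool" where
  "stable_in L T l \<longleftrightarrow>
     (\<forall>(M :: ('f, 'r, 'a) struct) A. is_model L T M \<and> A \<subseteq> univ M \<and> |A| \<le>o l \<longrightarrow>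
        |{p. complete_type L M 1 A p}| \<le>o l)"

section \<open>Forking\<close>

definition tp ::
  "('f, 'r) lang \<Rightarrow> ('f, 'r, 'a) struct \<Rightarrow> 'a set \<Rightarrow> 'a list \<Rightarrow> (('f, 'r) fm \<times> 'a list) set" where
  "tp L N A b = {\<psi> \<in> pfmls L (length b) A. psat N b \<psi>}"

text \<open>
  \<open>\<phi>(x,b)\<close> divides over \<open>A\<close>, with witnessing sequence in \<open>N\<close>: there are \<open>b\<^sub>i\<close>, \<open>i < \<omega>\<close>, with
  \<open>tp(b\<^sub>i/A) = tp(b/A)\<close> and a \<open>k\<close> such that \<open>\<langle>\<phi>(x,b\<^sub>i) : i < \<omega>\<rangle>\<close> is \<open>k\<close>-inconsistent. As usual,
  \<open>k\<close>-inconsistency refers to the indexed family, not to the set of formulas.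
\<close>

definition divides ::
  "('f, 'r) lang \<Rightarrow> ('f, 'r, 'a) struct \<Rightarrow> nat \<Rightarrow> ('f, 'r) fm \<times> 'a list \<Rightarrow> 'a set \<Rightarrow> bool" where
  "divides L N n = (\<lambda>(\<phi>, b) A.
     \<exists>(k :: nat) (bs :: nat \<Rightarrow> 'a list).
       (\<forall>i. bs i \<in> tuples N (length b) \<and> tp L N A (bs i) = tp L N A b) \<and>
       (\<forall>I. finite I \<and> card I = k \<longrightarrow> \<not> (\<exists>x\<in>tuples N n. \<forall>i\<in>I. psat N x (\<phi>, bs i))))"

text \<open>
  \<open>p\<close> forks over \<open>A\<close>: it implies a finite disjunction of formulas each of which divides over \<open>A\<close>.
  The elementary extension \<open>N\<close> (rather than a fixed monster model) supplies the parameters of the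
  dividing formulas and the witnessing sequences. By compactness, only a finite part \<open>q\<close> of \<open>p\<close> is
  needed.
\<close>

definition forks ::
  "('f, 'r) lang \<Rightarrow> ('f, 'r, 'a) struct \<Rightarrow> nat \<Rightarrow> (('f, 'r) fm \<times> 'a list) set \<Rightarrow> 'a set \<Rightarrow> bool"
where
  "forks L M n p A \<longleftrightarrow> (\<exists>N. is_struct L N \<and> elem_sub L M N \<and>
     (\<exists>D q. finite D \<and> D \<subseteq> pfmls L n (univ N) \<and> (\<forall>\<psi>\<in>D. divides L N n \<psi> A) \<and>
            finite q \<and> q \<subseteq> p \<and>
            (\<forall>x\<in>tuples N n. (\<forall>\<psi>\<in>q. psat N x \<psi>) \<longrightarrow> (\<exists>\<psi>\<in>D. psat N x \<psi>))))"

text \<open>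
  The defining property of \<open>\<kappa>(T)\<close>. Elements of \<open>Field k\<close> represent the ordinals \<open>i < \<kappa>\<close>; the last set
  \<open>A\<^sub>\<kappa>\<close> of a sequence \<open>\<langle>A\<^sub>i : i \<le> \<kappa>\<rangle>\<close> plays no role and is left out. All sets live in a model
  \<open>M\<close> smaller than \<open>'a\<close>, which guarantees that \<open>'a\<close> has room for the elementary extensions used in
  \<open>forks\<close> (the usual convention that all sets are small relative to the monster model).
\<close>

definition kappa_prop :: "('f, 'r) lang \<Rightarrow> ('f, 'r) fm set \<Rightarrow> 'a rel \<Rightarrow> bool" where
  "kappa_prop L T k \<longleftrightarrow>
     (\<forall>(M :: ('f, 'r, 'a) struct) (A :: 'a \<Rightarrow> 'a set) n p.
        is_model L T M \<and> |univ M| <o |UNIV :: 'a set| \<and>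
        (\<forall>i\<in>Field k. A i \<subseteq> univ M) \<and> relChain k A \<and>
        complete_type L M n (\<Union>i\<in>Field k. A i) p \<longrightarrow>
        (\<exists>i\<in>Field k. \<not> forks L M n p (A i)))"

text \<open>
  \<open>\<kappa>(T) = k\<close>. Only infinite cardinals are considered: in a sequence of finite length the last set
  is the union, so finite cardinals say nothing about \<open>T\<close> (a stable \<open>T\<close> would always have
  \<open>\<kappa>(T) = 1\<close>).
\<close>

definition is_kappa :: "('f, 'r) lang \<Rightarrow> ('f, 'r) fm set \<Rightarrow> 'a rel \<Rightarrow> bool" where
  "is_kappa L T k \<longleftrightarrow> Cinfinite k \<and> kappa_prop L T k \<and>
     (\<forall>k' :: 'a rel. Cinfinite k' \<and> kappa_prop L T k' \<longrightarrow> k \<le>o k')"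

definition is_kappa_r :: "('f, 'r) lang \<Rightarrow> ('f, 'r) fm set \<Rightarrow> 'a rel \<Rightarrow> bool" where
  "is_kappa_r L T kr \<longleftrightarrow> (\<exists>k :: 'a rel. is_kappa L T k \<and>
     Cinfinite kr \<and> regularCard kr \<and> k \<le>o kr \<and>
     (\<forall>k' :: 'a rel. Cinfinite k' \<and> regularCard k' \<and> k \<le>o k' \<longrightarrow> kr \<le>o k'))"

text \<open>\<open>\<mu> < \<kappa>\<^sub>r(T)\<close>; vacuously true if \<open>\<kappa>\<^sub>r(T) = \<infinity>\<close>.\<close>

definition less_kappa_r :: "('f, 'r) lang \<Rightarrow> ('f, 'r) fm set \<Rightarrow> 'a rel \<Rightarrow> bool" where
  "less_kappa_r L T m \<longleftrightarrow> (\<forall>kr :: 'a rel. is_kappa_r L T kr \<longrightarrow> m <o kr)"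

section \<open>Limit models\<close>

definition universal_over ::
  "('f, 'r) lang \<Rightarrow> ('f, 'r) fm set \<Rightarrow> ('f, 'r, 'a) struct \<Rightarrow> ('f, 'r, 'a) struct \<Rightarrow> bool" where
  "universal_over L T N M \<longleftrightarrow>
     is_model L T M \<and> is_model L T N \<and> |univ M| =o |univ N| \<and> elem_sub L M N \<and>
     (\<forall>M'. is_model L T M' \<and> elem_sub L M M' \<and> |univ M'| =o |univ N| \<longrightarrow>
        (\<exists>h. elem_embedding L M' N h \<and> (\<forall>x\<in>univ M. h x = x)))"

definition limit_ordinal :: "'a rel \<Rightarrow> bool" where
  "limit_ordinal d \<longleftrightarrow> Well_order d \<and> Field d \<noteq> {} \<and> (\<forall>i\<in>Field d. \<exists>j. i \<in> underS d j)"

definition succ_pos :: "'a rel \<Rightarrow> 'a \<Rightarrow> 'a \<Rightarrow> bool" where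
  "succ_pos d i j \<longleftrightarrow> i \<in> Field d \<and> j \<in> Field d \<and> underS d j = under d i"

definition limit_pos :: "'a rel \<Rightarrow> 'a \<Rightarrow> bool" where
  "limit_pos d j \<longleftrightarrow> j \<in> Field d \<and> underS d j \<noteq> {} \<and> (\<nexists>i. succ_pos d i j)"

text \<open>
  \<open>N\<close> is an \<open>(l, d)\<close>-limit model. Elements of \<open>Field d\<close> represent the ordinals \<open>\<alpha> < \<delta>\<close>, and \<open>N\<close>
  itself is the last member \<open>M\<^sub>\<delta>\<close> of the chain: the conditions on \<open>N\<close> are those that being an
  increasing continuous chain of models of cardinality \<open>l\<close> imposes at the index \<open>\<delta>\<close>.
\<close>

definition limit_model ::
  "('f, 'r) lang \<Rightarrow> ('f, 'r) fm set \<Rightarrow> 'a rel \<Rightarrow> 'a rel \<Rightarrow> ('f, 'r, 'a) struct \<Rightarrow> bool" where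
  "limit_model L T l d N \<longleftrightarrow> limit_ordinal d \<and> d <o cardSuc l \<and>
     (\<exists>M :: 'a \<Rightarrow> ('f, 'r, 'a) struct.
        (\<forall>i\<in>Field d. is_model L T (M i) \<and> |univ (M i)| =o l) \<and>
        (\<forall>i j. i \<in> underS d j \<longrightarrow> elem_sub L (M i) (M j)) \<and>
        (\<forall>j. limit_pos d j \<longrightarrow> univ (M j) = (\<Union>i\<in>underS d j. univ (M i))) \<and>
        (\<forall>i j. succ_pos d i j \<longrightarrow> universal_over L T (M j) (M i)) \<and>
        is_model L T N \<and> |univ N| =o l \<and>
        (\<forall>i\<in>Field d. elem_sub L (M i) N) \<and>
        univ N = (\<Union>i\<in>Field d. univ (M i)))"

end

theory Submission
  imports Defs
begin

text \<open>
  As \<open>\<mu>\<^sub>1 < \<kappa>\<^sub>r(T)\<close> is regular, \<open>\<mu>\<^sub>1 < \<kappa>(T)\<close>; so there is a type \<open>p\<close> over \<open>\<Union>\<^sub>i A\<^sub>i\<close> (\<open>i < \<mu>\<^sub>1\<close>) that forks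
  over every \<open>A\<^sub>i\<close>, witnessed by finite parts \<open>q\<^sub>i\<close> whose parameters may be assumed to lie in \<open>A\<^sub>j\<close> for
  all \<open>j > i\<close>. Along a chain \<open>\<langle>M\<^sub>i\<rangle>\<close> witnessing that \<open>N\<^sub>1\<close> is \<open>(\<lambda>, \<mu>\<^sub>1)\<close>-limit, copy the parameters by a
  partial elementary map \<open>f\<close> so that no tuple of \<open>M\<^sub>i\<close> satisfies \<open>f(q\<^sub>i)\<close>. The union of the \<open>f(q\<^sub>i)\<close> is
  then a type over at most \<open>\<mu>\<^sub>1\<close> parameters omitted by \<open>N\<^sub>1\<close>, whereas a \<open>(\<lambda>, \<mu>\<^sub>2)\<close>-limit model with
  \<open>\<mu>\<^sub>2 > \<mu>\<^sub>1\<close> regular realizes all such types.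

  The copying step only needs that, in a stable theory, a consistent formula over \<open>A\<close> does not imply a
  finite disjunction of formulas that divide over \<open>A\<close>. If it did, a rank defined by \<open>\<psi>\<close>-instances, for
  the finitely many formulas \<open>\<psi>\<close> involved, would be infinite on it: the rank is definable over \<open>A\<close>, so
  one of the dividing instances and with it all its \<open>A\<close>-conjugates cut out sets of full rank, and their
  \<open>k\<close>-inconsistency raises the rank by one. Infinite rank yields binary trees of all finite heights and
  thus more than \<open>\<lambda>\<close> types over \<open>\<lambda>\<close> parameters.
\<close>

section \<open>Definable predicates\<close>

text \<open>The copying step meets the statement on dividing as follows. Let \<open>B\<close> be the
  set of parameters treated before stage i, and suppose that the parameters of q_i cannot be copied
  so as to avoid finitely many tuples x_1, ..., x_m of M_i. Then (x_1, ..., x_m) satisfies a formula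
  over f(B): whenever the copied parameters satisfy a certain finite part of their type, some x_j
  satisfies the copy of q_i. Since f is elementary, the corresponding formula over \<open>B\<close>
  is consistent; since the true parameters are admissible, each of its solutions has a component
  satisfying q_i and hence one of the dividing formulas. These divide over A_i and so over the
  smaller set \<open>B\<close>. This is why the rank is taken on families of tuples.

  Two constraints shape the rest. Stability is assumed in the single cardinal \<lambda>, so the tree
  must have more than \<lambda> branches but only \<lambda> nodes. And there is no monster model:
  each extension is an ultrapower, cut down by Loewenheim-Skolem and moved back into
  \<open>'a\<close>.\<close>

lemma finite_tm_vars [simp]: "finite (tm_vars t)"
  by (induction t) auto

lemma finite_fv [simp]: "finite (fv \<phi>)"
  by (induction \<phi>) auto

lemma eval_tm_cong: "(\<And>v. v \<in> tm_vars t \<Longrightarrow> e v = e' v) \<Longrightarrow> eval_tm M e t = eval_tm M e' t"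
proof (induction t)
  case (Fun f ts)
  then have "map (eval_tm M e) ts = map (eval_tm M e') ts" by (intro map_cong) auto
  then show ?case by (simp only: eval_tm.simps)
qed simp

lemma map_eval_tm_cong:
  "(\<And>v. v \<in> (\<Union>t\<in>set ts. tm_vars t) \<Longrightarrow> e v = e' v) \<Longrightarrow> map (eval_tm M e) ts = map (eval_tm M e') ts"
  by (intro map_cong eval_tm_cong) auto

lemma sat_cong: "(\<And>v. v \<in> fv \<phi> \<Longrightarrow> e v = e' v) \<Longrightarrow> sat M e \<phi> = sat M e' \<phi>"
proof (induction \<phi> arbitrary: e e')
  case (Eq s t)
  have "eval_tm M e s = eval_tm M e' s"
    by (rule eval_tm_cong) (simp add: Eq)
  moreover have "eval_tm M e t = eval_tm M e' t"
    by (rule eval_tm_cong) (simp add: Eq)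
  ultimately show ?case by simp
next
  case (Rel r ts)
  have "map (eval_tm M e) ts = map (eval_tm M e') ts"
    by (rule map_eval_tm_cong) (use Rel in simp)
  then show ?case by (simp only: sat.simps)
next
  case (Neg \<phi>)
  have "sat M e \<phi> = sat M e' \<phi>" by (rule Neg.IH) (simp add: Neg.prems)
  then show ?case by simp
next
  case (And \<phi> \<psi>)
  have "sat M e \<phi> = sat M e' \<phi>"
    by (rule And.IH(1)) (simp add: And.prems)
  moreover have "sat M e \<psi> = sat M e' \<psi>"
    by (rule And.IH(2)) (simp add: And.prems)
  ultimately show ?case by simp
next
  case (Ex v \<phi>)
  have "sat M (e(v := x)) \<phi> = sat M (e'(v := x)) \<phi>" for x
    using Ex.prems by (intro Ex.IH) auto
  then show ?case by simp
qed

lemma eval_tm_in_univ: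
  "is_struct L M \<Longrightarrow> tm_in L t \<Longrightarrow> (\<And>v. v \<in> tm_vars t \<Longrightarrow> e v \<in> univ M) \<Longrightarrow> eval_tm M e t \<in> univ M"
proof (induction t)
  case (Fun f ts)
  then have "\<forall>t\<in>set ts. eval_tm M e t \<in> univ M" by auto
  then have "map (eval_tm M e) ts \<in> lists (univ M)" by auto
  then show ?case using Fun unfolding is_struct_def by auto
qed simp

section \<open>Renaming variables and quantifying over sets of variables\<close>

primrec map_tm_vars :: "(nat \<Rightarrow> nat) \<Rightarrow> 'f tm \<Rightarrow> 'f tm" where
  "map_tm_vars \<sigma> (Var v) = Var (\<sigma> v)"
| "map_tm_vars \<sigma> (Fun f ts) = Fun f (map (map_tm_vars \<sigma>) ts)"

lemma map_tm_vars [simp]: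
  "tm_in L t \<Longrightarrow> tm_in L (map_tm_vars \<sigma> t)"
  "tm_vars (map_tm_vars \<sigma> t) = \<sigma> ` tm_vars t"
  "eval_tm M e (map_tm_vars \<sigma> t) = eval_tm M (e \<circ> \<sigma>) t"
proof (induction t)
  case (Fun f ts)
  {
    case 3
    have "map (eval_tm M e) (map (map_tm_vars \<sigma>) ts) = map (eval_tm M (e \<circ> \<sigma>)) ts"
      using Fun by (simp add: comp_def)
    then show ?case by (simp only: eval_tm.simps map_tm_vars.simps)
  }
qed (auto simp: image_UN)

text \<open>Capture is avoided by moving the bound variable to some \<open>w\<close> outside the
  image of the other free variables. Stating only existence keeps the choice of fresh variables out
  of all later arguments. \<open>\<sigma>\<close> may identify variables; \<open>dfn_ex\<close>
  makes use of this.\<close>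

lemma fm_rename:
  "\<exists>\<phi>'. (fm_in L \<phi> \<longrightarrow> fm_in L \<phi>') \<and> fv \<phi>' = \<sigma> ` fv \<phi> \<and>
     (\<forall>(M :: ('f, 'r, 'a) struct) e. sat M e \<phi>' = sat M (e \<circ> \<sigma>) \<phi>)"
proof (induction \<phi> arbitrary: \<sigma>)
  case (Eq s t)
  show ?case by (rule exI[of _ "Eq (map_tm_vars \<sigma> s) (map_tm_vars \<sigma> t)"]) (simp add: image_Un comp_def)
next
  case (Rel r ts)
  have "map (eval_tm M e) (map (map_tm_vars \<sigma>) ts) = map (eval_tm M (e \<circ> \<sigma>)) ts"
    for M :: "('f, 'r, 'a) struct" and e by (simp add: comp_def)
  then have "sat M e (Rel r (map (map_tm_vars \<sigma>) ts)) = sat M (e \<circ> \<sigma>) (Rel r ts)"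
    for M :: "('f, 'r, 'a) struct" and e by (simp only: sat.simps)
  then show ?case by (intro exI[of _ "Rel r (map (map_tm_vars \<sigma>) ts)"]) (simp add: image_UN comp_def)
next
  case (Neg p)
  obtain p' where "(fm_in L p \<longrightarrow> fm_in L p')" "fv p' = \<sigma> ` fv p"
     "\<And>(M :: ('f, 'r, 'a) struct) e. sat M e p' = sat M (e \<circ> \<sigma>) p" using Neg[of \<sigma>] by blast
  then show ?case by (intro exI[of _ "Neg p'"]) (simp add: comp_def)
next
  case (And p q)
  obtain p' where "(fm_in L p \<longrightarrow> fm_in L p')" "fv p' = \<sigma> ` fv p"
     "\<And>(M :: ('f, 'r, 'a) struct) e. sat M e p' = sat M (e \<circ> \<sigma>) p" using And(1)[of \<sigma>] by blast
  moreover obtain q' where "(fm_in L q \<longrightarrow> fm_in L q')" "fv q' = \<sigma> ` fv q"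
     "\<And>(M :: ('f, 'r, 'a) struct) e. sat M e q' = sat M (e \<circ> \<sigma>) q" using And(2)[of \<sigma>] by blast
  ultimately show ?case by (intro exI[of _ "And p' q'"]) (simp add: image_Un comp_def)
next
  case (Ex v p)
  obtain w where w: "w \<notin> \<sigma> ` (fv p - {v})"
    using ex_new_if_finite[of "\<sigma> ` (fv p - {v})"] by auto
  obtain p' where p': "(fm_in L p \<longrightarrow> fm_in L p')" "fv p' = (\<sigma>(v := w)) ` fv p"
     "\<And>(M :: ('f, 'r, 'a) struct) e. sat M e p' = sat M (e \<circ> \<sigma>(v := w)) p" using Ex[of "\<sigma>(v := w)"] by blast
  have "sat M (e(w := x) \<circ> \<sigma>(v := w)) p = sat M ((e \<circ> \<sigma>)(v := x)) p" for M :: "('f, 'r, 'a) struct" and e x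
  proof (rule sat_cong)
    fix u assume "u \<in> fv p"
    then show "(e(w := x) \<circ> \<sigma>(v := w)) u = ((e \<circ> \<sigma>)(v := x)) u"
      using w by (cases "u = v") auto
  qed
  moreover have "(\<sigma>(v := w)) ` fv p - {w} = \<sigma> ` (fv p - {v})"
  proof (intro equalityI subsetI)
    fix y assume y: "y \<in> (\<sigma>(v := w)) ` fv p - {w}"
    then have "y \<in> (\<sigma>(v := w)) ` fv p" by simp
    then obtain u where u: "y = (\<sigma>(v := w)) u" "u \<in> fv p" by (rule imageE)
    have "u \<noteq> v"
    proof
      assume "u = v"
      then have "y = w" using u(1) by simp
      with y show False by simp
    qed
    then show "y \<in> \<sigma> ` (fv p - {v})" using u by simp
  next
    fix y assume "y \<in> \<sigma> ` (fv p - {v})"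
    then obtain u where u: "y = \<sigma> u" "u \<in> fv p - {v}" by (rule imageE)
    then have "y = (\<sigma>(v := w)) u" by simp
    moreover have "y \<noteq> w" using w u by (metis imageI)
    ultimately show "y \<in> (\<sigma>(v := w)) ` fv p - {w}" using u(2) by (simp add: image_eqI)
  qed
  ultimately show ?case by (intro exI[of _ "Ex w p'"]) (simp add: p' comp_def)
qed

text \<open>The set \<open>Y\<close> may be infinite, such as a whole block of variables; since a
  formula mentions only finitely many variables, this is still first-order quantification.\<close>

definition ex_on :: "('f, 'r, 'a) struct \<Rightarrow> 'v set \<Rightarrow> (('v \<Rightarrow> 'a) \<Rightarrow> bool) \<Rightarrow> ('v \<Rightarrow> 'a) \<Rightarrow> bool" where
  "ex_on M Y P e \<longleftrightarrow> (\<exists>e'. range e' \<subseteq> univ M \<and> (\<forall>v. v \<notin> Y \<longrightarrow> e' v = e v) \<and> P e')"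

lemma fm_ex_finite:
  assumes "finite Y"
  shows "\<exists>\<phi>'. (fm_in L \<phi> \<longrightarrow> fm_in L \<phi>') \<and> fv \<phi>' = fv \<phi> - Y \<and>
    (\<forall>(M :: ('f, 'r, 'a) struct) e. range e \<subseteq> univ M \<longrightarrow> sat M e \<phi>' = ex_on M Y (\<lambda>e. sat M e \<phi>) e)"
  using assms
proof (induction Y)
  case empty
  have "ex_on M {} (\<lambda>e. sat M e \<phi>) e = sat M e \<phi>" if "range e \<subseteq> univ M" for M :: "('f, 'r, 'a) struct" and e
  proof -
    have "e' = e" if "\<forall>v. e' v = e v" for e' using that by auto
    then show ?thesis using that unfolding ex_on_def by auto
  qed
  then show ?case by (intro exI[of _ \<phi>]) auto
next
  case (insert y Y)
  then obtain \<phi>' where p: "(fm_in L \<phi> \<longrightarrow> fm_in L \<phi>')" "fv \<phi>' = fv \<phi> - Y"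
    "\<And>(M :: ('f, 'r, 'a) struct) e. range e \<subseteq> univ M \<Longrightarrow> sat M e \<phi>' = ex_on M Y (\<lambda>e. sat M e \<phi>) e" by blast
  have "sat M e (Ex y \<phi>') = ex_on M (insert y Y) (\<lambda>e. sat M e \<phi>) e" (is "?l = ?r") if e: "range e \<subseteq> univ M" for M :: "('f, 'r, 'a) struct" and e
  proof
    assume ?l
    then obtain x where x: "x \<in> univ M" "sat M (e(y := x)) \<phi>'" by auto
    then have "ex_on M Y (\<lambda>e. sat M e \<phi>) (e(y := x))" using p(3)[of "e(y:=x)" M] e by auto
    then show ?r unfolding ex_on_def by (metis fun_upd_other insertCI)
  next
    assume ?r
    then obtain e' where e': "range e' \<subseteq> univ M" "\<And>v. v \<notin> insert y Y \<Longrightarrow> e' v = e v" "sat M e' \<phi>"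
      unfolding ex_on_def by auto
    have "ex_on M Y (\<lambda>e. sat M e \<phi>) (e(y := e' y))"
      unfolding ex_on_def by (rule exI[of _ e']) (use e' in auto)
    then have "sat M (e(y := e' y)) \<phi>'" using p(3)[of "e(y:=e' y)" M] e e'(1) by auto
    then show ?l using e'(1) by auto
  qed
  then show ?case by (intro exI[of _ "Ex y \<phi>'"]) (use p in auto)
qed

text \<open>Predicates on assignments of an arbitrary set of variables that are uniformly first-order
  definable, so that formulas need not be written down.\<close>

definition dfn_by ::
  "('f, 'r) lang \<Rightarrow> 'v set \<Rightarrow> (('f, 'r, 'a) struct \<Rightarrow> ('v \<Rightarrow> 'a) \<Rightarrow> bool) \<Rightarrow> ('f, 'r) fm \<Rightarrow> (nat \<Rightarrow> 'v) \<Rightarrow> bool"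
where
  "dfn_by L W R \<phi> \<sigma> \<longleftrightarrow> fm_in L \<phi> \<and> \<sigma> ` fv \<phi> \<subseteq> W \<and>
     (\<forall>M e. is_struct L M \<and> range e \<subseteq> univ M \<longrightarrow> (R M e \<longleftrightarrow> sat M (e \<circ> \<sigma>) \<phi>))"

definition dfn :: "('f, 'r) lang \<Rightarrow> 'v set \<Rightarrow> (('f, 'r, 'a) struct \<Rightarrow> ('v \<Rightarrow> 'a) \<Rightarrow> bool) \<Rightarrow> bool" where
  "dfn L W R \<longleftrightarrow> (\<exists>\<phi> \<sigma>. dfn_by L W R \<phi> \<sigma>)"

lemma dfn_byI:
  assumes "fm_in L \<phi>" "\<sigma> ` fv \<phi> \<subseteq> W"
    "\<And>M e. is_struct L M \<Longrightarrow> range e \<subseteq> univ M \<Longrightarrow> R M e = sat M (e \<circ> \<sigma>) \<phi>"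
  shows "dfn_by L W R \<phi> \<sigma>"
  unfolding dfn_by_def using assms by simp

lemma dfn_byD:
  assumes "dfn_by L W R \<phi> \<sigma>"
  shows "fm_in L \<phi>" "\<sigma> ` fv \<phi> \<subseteq> W"
    "is_struct L M \<Longrightarrow> range e \<subseteq> univ M \<Longrightarrow> R M e = sat M (e \<circ> \<sigma>) \<phi>"
  using assms unfolding dfn_by_def by simp_all

lemma dfnI: "dfn_by L W R \<phi> \<sigma> \<Longrightarrow> dfn L W R"
  unfolding dfn_def by (intro exI)

lemma dfnE:
  assumes "dfn L W R" obtains \<phi> \<sigma> where "dfn_by L W R \<phi> \<sigma>"
  using assms unfolding dfn_def by (elim exE)

lemma dfn_base: "fm_in L \<phi> \<Longrightarrow> \<sigma> ` fv \<phi> \<subseteq> W \<Longrightarrow> dfn L W (\<lambda>M e. sat M (e \<circ> \<sigma>) \<phi>)"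
  by (rule dfnI[of L W _ \<phi> \<sigma>], rule dfn_byI) (simp_all add: comp_def)

lemma dfn_mono:
  assumes "dfn L W R" "W \<subseteq> W'" shows "dfn L W' R"
  using assms(1)
proof (rule dfnE)
  fix \<phi> \<sigma> assume "dfn_by L W R \<phi> \<sigma>"
  then have "dfn_by L W' R \<phi> \<sigma>" using assms(2) by (intro dfn_byI) (auto dest: dfn_byD)
  then show ?thesis by (rule dfnI)
qed

lemma dfn_cong:
  assumes "dfn L W R" "\<And>M e. is_struct L M \<Longrightarrow> range e \<subseteq> univ M \<Longrightarrow> R' M e = R M e"
  shows "dfn L W R'"
  using assms(1)
proof (rule dfnE)
  fix \<phi> \<sigma> assume d: "dfn_by L W R \<phi> \<sigma>"
  have "dfn_by L W R' \<phi> \<sigma>"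
    by (intro dfn_byI dfn_byD(1,2)[OF d]) (simp only: assms(2) dfn_byD(3)[OF d])
  then show ?thesis by (rule dfnI)
qed

lemma dfn_not:
  assumes "dfn L W R" shows "dfn L W (\<lambda>M e. \<not> R M e)"
  using assms(1)
proof (rule dfnE)
  fix \<phi> \<sigma> assume d: "dfn_by L W R \<phi> \<sigma>"
  have "dfn_by L W (\<lambda>M e. \<not> R M e) (Neg \<phi>) \<sigma>"
    using dfn_byD(1,2)[OF d] by (intro dfn_byI) (simp_all add: dfn_byD(3)[OF d])
  then show ?thesis by (rule dfnI)
qed

text \<open>The two formulas come with different assignments of their variables. Moving one to the
  even and the other to the odd variables lets a single assignment \<open>\<rho>\<close> serve
  both.\<close>

lemma dfn_and:
  fixes L :: "('f, 'r) lang" and R R' :: "('f, 'r, 'a) struct \<Rightarrow> ('v \<Rightarrow> 'a) \<Rightarrow> bool"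
  assumes "dfn L W R" "dfn L W R'" shows "dfn L W (\<lambda>M e. R M e \<and> R' M e)"
proof -
  obtain \<phi> \<sigma> where "dfn_by L W R \<phi> \<sigma>" using assms(1) by (rule dfnE)
  note 1 = dfn_byD[OF this]
  obtain \<psi> \<tau> where "dfn_by L W R' \<psi> \<tau>" using assms(2) by (rule dfnE)
  note 2 = dfn_byD[OF this]
  obtain \<phi>' where 3: "fm_in L \<phi>'" "fv \<phi>' = (\<lambda>n. 2*n) ` fv \<phi>"
     "\<And>(M :: ('f, 'r, 'a) struct) e. sat M e \<phi>' = sat M (e \<circ> (\<lambda>n. 2*n)) \<phi>" using fm_rename[of L \<phi>] 1(1) by blast
  obtain \<psi>' where 4: "fm_in L \<psi>'" "fv \<psi>' = (\<lambda>n. 2*n+1) ` fv \<psi>"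
     "\<And>(M :: ('f, 'r, 'a) struct) e. sat M e \<psi>' = sat M (e \<circ> (\<lambda>n. 2*n+1)) \<psi>" using fm_rename[of L \<psi>] 2(1) by blast
  define \<rho> where "\<rho> n = (if even n then \<sigma> (n div 2) else \<tau> (n div 2))" for n :: nat
  have [simp]: "\<rho> \<circ> (\<lambda>n. 2*n) = \<sigma>" "\<rho> \<circ> (\<lambda>n. 2*n+1) = \<tau>" "\<rho> \<circ> (\<lambda>n. Suc (2*n)) = \<tau>" by (auto simp: \<rho>_def)
  have "sat M (e \<circ> \<rho>) (And \<phi>' \<psi>') = (sat M (e \<circ> \<sigma>) \<phi> \<and> sat M (e \<circ> \<tau>) \<psi>)" for M :: "('f, 'r, 'a) struct" and e
    unfolding sat.simps 3(3) 4(3) o_assoc[symmetric] by simp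
  moreover have "\<rho> ` fv (And \<phi>' \<psi>') \<subseteq> W"
    using 1(2) 2(2) by (auto simp: 3(2) 4(2) \<rho>_def)
  ultimately have "dfn_by L W (\<lambda>M e. R M e \<and> R' M e) (And \<phi>' \<psi>') \<rho>"
    using 3(1) 4(1) by (intro dfn_byI) (simp_all add: 1(3) 2(3))
  then show ?thesis by (rule dfnI)
qed

lemma dfn_or:
  assumes "dfn L W R" "dfn L W R'" shows "dfn L W (\<lambda>M e. R M e \<or> R' M e)"
  by (rule dfn_cong[OF dfn_not[OF dfn_and[OF dfn_not[OF assms(1)] dfn_not[OF assms(2)]]]]) auto

lemma dfn_imp:
  assumes "dfn L W R" "dfn L W R'" shows "dfn L W (\<lambda>M e. R M e \<longrightarrow> R' M e)"
  by (rule dfn_cong[OF dfn_or[OF dfn_not[OF assms(1)] assms(2)]]) auto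

lemma dfn_True:
  fixes L :: "('f, 'r) lang"
  shows "dfn L W (\<lambda>(M :: ('f, 'r, 'a) struct) e. True)"
proof -
  \<comment> \<open>A sentence is chosen because \<open>W\<close> may be empty; it is true because
    universes are nonempty.\<close>
  have "fm_in L (Ex 0 (Eq (Var 0) (Var 0)))" by simp
  moreover have "(True \<longleftrightarrow> sat M (e \<circ> (\<lambda>_. undefined)) (Ex 0 (Eq (Var 0) (Var 0))))" if "is_struct L M" for M :: "('f, 'r, 'a) struct" and e
    using that by (auto simp: is_struct_def)
  ultimately have "dfn_by L W (\<lambda>(M :: ('f, 'r, 'a) struct) e. True) (Ex 0 (Eq (Var 0) (Var 0))) (\<lambda>_. undefined)"
    by (intro dfn_byI) simp_all
  then show ?thesis by (rule dfnI)
qed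

lemma dfn_ball: "finite I \<Longrightarrow> (\<And>i. i \<in> I \<Longrightarrow> dfn L W (R i)) \<Longrightarrow> dfn L W (\<lambda>M e. \<forall>i\<in>I. R i M e)"
proof (induction I rule: finite_induct)
  case empty
  show ?case by (rule dfn_cong[OF dfn_True]) simp
next
  case (insert i I)
  show ?case by (rule dfn_cong[OF dfn_and[of L W "R i" "\<lambda>M e. \<forall>i\<in>I. R i M e"]]) (use insert in auto)
qed

lemma dfn_bex:
  assumes "finite I" "\<And>i. i \<in> I \<Longrightarrow> dfn L W (R i)" shows "dfn L W (\<lambda>M e. \<exists>i\<in>I. R i M e)"
  by (rule dfn_cong[OF dfn_not[OF dfn_ball[of I L W "\<lambda>i M e. \<not> R i M e"]]]) (use assms dfn_not in auto)

text \<open>\<open>\<sigma>\<close> need not be injective, so several variables of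
  \<open>\<phi>\<close> may stand for the same member of \<open>Y\<close>. Renaming by
  \<open>\<rho>\<close>, which picks the least variable with the same value under
  \<open>\<sigma>\<close>, merges them before they are bound.\<close>

lemma dfn_ex:
  fixes L :: "('f, 'r) lang" and R :: "('f, 'r, 'a) struct \<Rightarrow> ('v \<Rightarrow> 'a) \<Rightarrow> bool"
  assumes "dfn L W R" shows "dfn L (W - Y) (\<lambda>M e. ex_on M Y (R M) e)"
proof -
  obtain \<phi> \<sigma> where "dfn_by L W R \<phi> \<sigma>" using assms(1) by (rule dfnE)
  note 1 = dfn_byD[OF this]
  define \<rho> where "\<rho> n = (LEAST m. \<sigma> m = \<sigma> n)" for n
  have \<rho>: "\<sigma> (\<rho> n) = \<sigma> n" for n unfolding \<rho>_def by (rule LeastI) simp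
  have \<rho>2: "\<rho> n = \<rho> m" if "\<sigma> n = \<sigma> m" for n m unfolding \<rho>_def using that by simp
  obtain \<phi>1 where 2: "fm_in L \<phi>1" "fv \<phi>1 = \<rho> ` fv \<phi>"
     "\<And>(M :: ('f, 'r, 'a) struct) e. sat M e \<phi>1 = sat M (e \<circ> \<rho>) \<phi>" using fm_rename[of L \<phi>] 1(1) by blast
  define Z where "Z = {v \<in> fv \<phi>1. \<sigma> v \<in> Y}"
  obtain \<phi>2 where 3: "fm_in L \<phi>2" "fv \<phi>2 = fv \<phi>1 - Z"
    "\<And>(M :: ('f, 'r, 'a) struct) e. range e \<subseteq> univ M \<Longrightarrow> sat M e \<phi>2 = ex_on M Z (\<lambda>e. sat M e \<phi>1) e"
    using fm_ex_finite[of Z L \<phi>1] 2(1) unfolding Z_def by auto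
  have "ex_on M Y (R M) e = sat M (e \<circ> \<sigma>) \<phi>2" if M: "is_struct L M" and e: "range e \<subseteq> univ M" for M e
  proof -
    have "sat M (e \<circ> \<sigma>) \<phi>2 = ex_on M Z (\<lambda>e. sat M e \<phi>1) (e \<circ> \<sigma>)" using e by (intro 3) auto
    also have "\<dots> = ex_on M Y (R M) e"
    proof
      assume "ex_on M Z (\<lambda>e. sat M e \<phi>1) (e \<circ> \<sigma>)"
      then obtain d where d: "range d \<subseteq> univ M" "\<And>v. v \<notin> Z \<Longrightarrow> d v = e (\<sigma> v)" "sat M d \<phi>1"
        unfolding ex_on_def by auto
      define e' where "e' y = (if y \<in> \<sigma> ` Z then d (SOME v. v \<in> Z \<and> \<sigma> v = y) else e y)" for y
      have e'd: "e' (\<sigma> v) = d v" if v: "v \<in> fv \<phi>1" for v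
      proof (cases "v \<in> Z")
        case True
        have s: "(SOME w. w \<in> Z \<and> \<sigma> w = \<sigma> v) \<in> Z \<and> \<sigma> (SOME w. w \<in> Z \<and> \<sigma> w = \<sigma> v) = \<sigma> v"
          by (rule someI[of _ v]) (use True in auto)
        let ?w = "SOME w. w \<in> Z \<and> \<sigma> w = \<sigma> v"
        have "?w \<in> fv \<phi>1" using s by (simp add: Z_def)
        then obtain a b where "?w = \<rho> a" "v = \<rho> b" using v 2(2) by blast
        then have "?w = v" using s \<rho> \<rho>2 by metis
        then show ?thesis using True by (auto simp: e'_def)
      next
        case False
        then have "\<sigma> v \<notin> \<sigma> ` Z" using v by (auto simp: Z_def)
        then show ?thesis using False d(2) by (simp add: e'_def)
      qed
      have r: "range e' \<subseteq> univ M" using d(1) e by (auto simp: e'_def)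
      have "sat M (e' \<circ> \<sigma>) \<phi> = sat M (e' \<circ> \<sigma>) \<phi>1" unfolding 2(3) using \<rho> by (simp add: o_def)
      also have "\<dots> = sat M d \<phi>1" by (rule sat_cong) (use e'd in auto)
      finally have "R M e'" using 1(3)[of M e'] M r d by auto
      moreover have "e' y = e y" if "y \<notin> Y" for y using that by (auto simp: e'_def Z_def)
      ultimately show "ex_on M Y (R M) e" unfolding ex_on_def using r by blast
    next
      assume "ex_on M Y (R M) e"
      then obtain e' where e': "range e' \<subseteq> univ M" "\<And>v. v \<notin> Y \<Longrightarrow> e' v = e v" "R M e'"
        unfolding ex_on_def by auto
      have "sat M (e' \<circ> \<sigma>) \<phi>" using 1(3)[of M e'] M e' by auto
      then have s: "sat M (e' \<circ> \<sigma>) \<phi>1" unfolding 2(3) using \<rho> by (simp add: o_def)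
      define d where "d v = (if v \<in> Z then e' (\<sigma> v) else e (\<sigma> v))" for v
      have "sat M d \<phi>1 = sat M (e' \<circ> \<sigma>) \<phi>1"
        by (rule sat_cong) (use e'(2) in \<open>auto simp: d_def Z_def\<close>)
      then show "ex_on M Z (\<lambda>e. sat M e \<phi>1) (e \<circ> \<sigma>)" unfolding ex_on_def
        using s e'(1) e by (intro exI[of _ d]) (auto simp: d_def)
    qed
    finally show ?thesis by simp
  qed
  moreover have "\<sigma> ` fv \<phi>2 \<subseteq> W - Y"
    using 1(2) \<rho> by (auto simp: 3(2) Z_def 2(2))
  ultimately have "dfn_by L (W - Y) (\<lambda>M e. ex_on M Y (R M) e) \<phi>2 \<sigma>"
    using 3(1) by (intro dfn_byI) simp_all
  then show ?thesis by (rule dfnI)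
qed

definition all_on :: "('f, 'r, 'a) struct \<Rightarrow> 'v set \<Rightarrow> (('v \<Rightarrow> 'a) \<Rightarrow> bool) \<Rightarrow> ('v \<Rightarrow> 'a) \<Rightarrow> bool" where
  "all_on M Y P e \<longleftrightarrow> (\<forall>e'. range e' \<subseteq> univ M \<and> (\<forall>v. v \<notin> Y \<longrightarrow> e' v = e v) \<longrightarrow> P e')"

lemma dfn_all:
  assumes "dfn L W R" shows "dfn L (W - Y) (\<lambda>M e. all_on M Y (R M) e)"
proof (rule dfn_cong[OF dfn_not[OF dfn_ex[OF dfn_not[OF assms], of Y]]])
  show "all_on M Y (R M) e = (\<not> ex_on M Y (\<lambda>e. \<not> R M e) e)" for M e
    unfolding all_on_def ex_on_def by blast
qed

section \<open>Ultrapowers and compactness\<close>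

definition ultra :: "'i set set \<Rightarrow> bool" where
  "ultra U \<longleftrightarrow> UNIV \<in> U \<and> {} \<notin> U \<and> (\<forall>A B. A \<in> U \<and> A \<subseteq> B \<longrightarrow> B \<in> U) \<and>
     (\<forall>A B. A \<in> U \<and> B \<in> U \<longrightarrow> A \<inter> B \<in> U) \<and> (\<forall>A. A \<in> U \<or> - A \<in> U)"

lemma ultra_mono: "ultra U \<Longrightarrow> A \<in> U \<Longrightarrow> A \<subseteq> B \<Longrightarrow> B \<in> U"
  unfolding ultra_def by blast

lemma ultra_Int: "ultra U \<Longrightarrow> A \<inter> B \<in> U \<longleftrightarrow> A \<in> U \<and> B \<in> U"
  unfolding ultra_def by (meson Int_lower1 Int_lower2)

lemma ultra_Compl: "ultra U \<Longrightarrow> - A \<in> U \<longleftrightarrow> A \<notin> U"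
  unfolding ultra_def by (metis Compl_disjoint)

lemma ultra_INT:
  assumes "ultra U" "finite I" "\<And>i. i \<in> I \<Longrightarrow> A i \<in> U"
  shows "(\<Inter>i\<in>I. A i) \<in> U"
  using assms(2,3)
proof (induction I rule: finite_induct)
  case empty
  then show ?case using assms(1) by (simp add: ultra_def)
next
  case (insert x F)
  then show ?case using assms(1) by (simp add: ultra_Int)
qed

definition fip :: "'i set set \<Rightarrow> bool" where
  "fip G \<longleftrightarrow> (\<forall>G0. finite G0 \<and> G0 \<subseteq> G \<longrightarrow> \<Inter>G0 \<noteq> {})"

text \<open>By Zorn there is a maximal family \<open>U\<close> with the finite intersection
  property. Maximality puts into \<open>U\<close> every set that meets all finite intersections of
  members (\<open>mem\<close>), and the ultrafilter properties follow from this.\<close>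

lemma ex_ultra:
  assumes "fip F"
  shows "\<exists>U. ultra U \<and> F \<subseteq> U"
proof -
  have "\<exists>G\<in>{G. F \<subseteq> G \<and> fip G}. \<forall>X\<in>{G. F \<subseteq> G \<and> fip G}. G \<subseteq> X \<longrightarrow> X = G"
  proof (rule subset_Zorn_nonempty)
    show "{G. F \<subseteq> G \<and> fip G} \<noteq> {}" using assms by auto
  next
    fix C assume C: "C \<noteq> {}" "subset.chain {G. F \<subseteq> G \<and> fip G} C"
    have CA: "C \<subseteq> {G. F \<subseteq> G \<and> fip G}" using C(2) by (simp add: subset_chain_def)
    have "\<Inter>G0 \<noteq> {}" if G0: "finite G0" "G0 \<subseteq> \<Union>C" for G0
    proof -
      obtain G where G: "G \<in> C" "G0 \<subseteq> G"
        using finite_subset_Union_chain[OF G0 C] by blast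
      have "fip G" using CA G(1) by auto
      then show ?thesis using G0(1) G(2) by (simp add: fip_def)
    qed
    moreover have "F \<subseteq> \<Union>C" using C(1) CA by auto
    ultimately show "\<Union>C \<in> {G. F \<subseteq> G \<and> fip G}" unfolding fip_def by blast
  qed
  then obtain U where U0: "U \<in> {G. F \<subseteq> G \<and> fip G}"
    "\<forall>X\<in>{G. F \<subseteq> G \<and> fip G}. U \<subseteq> X \<longrightarrow> X = U" by (rule bexE)
  have U: "F \<subseteq> U" "fip U" using U0(1) by simp_all
  have max: "X = U" if "F \<subseteq> X" "fip X" "U \<subseteq> X" for X
    using U0(2) that by simp
  have mem: "A \<in> U" if A: "\<And>G0. finite G0 \<Longrightarrow> G0 \<subseteq> U \<Longrightarrow> \<Inter>G0 \<inter> A \<noteq> {}" for A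
  proof -
    have "fip (insert A U)" unfolding fip_def
    proof (intro allI impI)
      fix G0 assume G0: "finite G0 \<and> G0 \<subseteq> insert A U"
      then have "\<Inter>(G0 - {A}) \<inter> A \<noteq> {}" by (intro A) auto
      then show "\<Inter>G0 \<noteq> {}" by blast
    qed
    then show ?thesis using max[of "insert A U"] U(1) by (metis insertI1 subset_insertI subset_trans)
  qed
  have fipU: "\<Inter>G0 \<noteq> {}" if "finite G0" "G0 \<subseteq> U" for G0 using U(2) that unfolding fip_def by blast
  have "ultra U" unfolding ultra_def
  proof (intro conjI allI impI)
    show "UNIV \<in> U" using fipU by (intro mem) auto
    show "{} \<notin> U" using fipU[of "{{}}"] by auto
  next
    fix A B assume AB: "A \<in> U \<and> A \<subseteq> B"
    show "B \<in> U"
    proof (rule mem)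
      fix G0 assume "finite G0" "G0 \<subseteq> U"
      then have "\<Inter>(insert A G0) \<noteq> {}" using AB by (intro fipU) auto
      then show "\<Inter>G0 \<inter> B \<noteq> {}" using AB by blast
    qed
  next
    fix A B assume AB: "A \<in> U \<and> B \<in> U"
    show "A \<inter> B \<in> U"
    proof (rule mem)
      fix G0 assume "finite G0" "G0 \<subseteq> U"
      then have "\<Inter>(insert A (insert B G0)) \<noteq> {}" using AB by (intro fipU) auto
      then show "\<Inter>G0 \<inter> (A \<inter> B) \<noteq> {}" by blast
    qed
  next
    fix A
    show "A \<in> U \<or> - A \<in> U"
    proof (rule ccontr)
      assume n: "\<not> (A \<in> U \<or> - A \<in> U)"
      then obtain G1 where G1: "finite G1" "G1 \<subseteq> U" "\<Inter>G1 \<inter> A = {}" using mem[of A] by blast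
      obtain G2 where G2: "finite G2" "G2 \<subseteq> U" "\<Inter>G2 \<inter> (- A) = {}" using n mem[of "- A"] by blast
      have "\<Inter>(G1 \<union> G2) \<noteq> {}" using G1 G2 by (intro fipU) auto
      then show False using G1(3) G2(3) by blast
    qed
  qed
  then show ?thesis using U(1) by blast
qed

text \<open>Picks one function from each class modulo \<open>U\<close>, so that the ultrapower lives
  on functions and no quotient type is formed. The representative of a function into
  \<open>univ N\<close> may leave \<open>univ N\<close>, but only on a set outside the
  ultrafilter.\<close>

definition rep :: "'i set set \<Rightarrow> ('i \<Rightarrow> 'a) \<Rightarrow> 'i \<Rightarrow> 'a" where
  "rep U F = (SOME G. {i. G i = F i} \<in> U)"

definition upow :: "'i set set \<Rightarrow> ('f, 'r, 'a) struct \<Rightarrow> ('f, 'r, 'i \<Rightarrow> 'a) struct" where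
  "upow U N = \<lparr>univ = rep U ` {F. range F \<subseteq> univ N},
     fint = (\<lambda>f Fs. rep U (\<lambda>i. fint N f (map (\<lambda>F. F i) Fs))),
     rint = (\<lambda>r Fs. {i. rint N r (map (\<lambda>F. F i) Fs)} \<in> U)\<rparr>"

lemma rep_ae: "ultra U \<Longrightarrow> {i. rep U F i = F i} \<in> U"
  unfolding rep_def by (rule someI[of "\<lambda>G. {i. G i = F i} \<in> U" F]) (simp add: ultra_def)

lemma rep_cong:
  assumes U: "ultra U" and FG: "{i. F i = G i} \<in> U"
  shows "rep U F = rep U G"
proof -
  have "{i. H i = F i} \<in> U \<longleftrightarrow> {i. H i = G i} \<in> U" for H
  proof
    assume "{i. H i = F i} \<in> U"
    then have "{i. H i = F i} \<inter> {i. F i = G i} \<in> U" using U FG by (simp add: ultra_Int)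
    then show "{i. H i = G i} \<in> U" by (rule ultra_mono[OF U]) auto
  next
    assume "{i. H i = G i} \<in> U"
    then have "{i. H i = G i} \<inter> {i. F i = G i} \<in> U" using U FG by (simp add: ultra_Int)
    then show "{i. H i = F i} \<in> U" by (rule ultra_mono[OF U]) auto
  qed
  then show ?thesis unfolding rep_def by simp
qed

lemma rep_eq_iff: "ultra U \<Longrightarrow> rep U F = rep U G \<longleftrightarrow> {i. F i = G i} \<in> U"
proof
  assume U: "ultra U" and "rep U F = rep U G"
  then have "{i. rep U F i = F i} \<inter> {i. rep U F i = G i} \<in> U"
    using rep_ae[OF U, of F] rep_ae[OF U, of G] by (simp add: ultra_Int)
  then show "{i. F i = G i} \<in> U" by (rule ultra_mono[OF U]) auto
qed (rule rep_cong)

lemma map_rep_ae: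
  assumes U: "ultra U"
  shows "{i. map (\<lambda>t. rep U (H t) i) ts = map (\<lambda>t. H t i) ts} \<in> U"
proof -
  have "(\<Inter>t\<in>set ts. {i. rep U (H t) i = H t i}) \<in> U"
    by (rule ultra_INT[OF U]) (simp_all add: rep_ae[OF U])
  then show ?thesis by (rule ultra_mono[OF U]) auto
qed

lemma eval_upow:
  assumes U: "ultra U"
  shows "eval_tm (upow U N) (\<lambda>v. rep U (E v)) t = rep U (\<lambda>i. eval_tm N (\<lambda>v. E v i) t)"
proof (induction t)
  case (Fun f ts)
  have "map (eval_tm (upow U N) (\<lambda>v. rep U (E v))) ts = map (\<lambda>t. rep U (\<lambda>i. eval_tm N (\<lambda>v. E v i) t)) ts"
    using Fun by simp
  then have "eval_tm (upow U N) (\<lambda>v. rep U (E v)) (Fun f ts) =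
      rep U (\<lambda>i. fint N f (map (\<lambda>t. rep U (\<lambda>i. eval_tm N (\<lambda>v. E v i) t) i) ts))"
    by (simp only: eval_tm.simps) (simp add: upow_def comp_def)
  also have "\<dots> = rep U (\<lambda>i. eval_tm N (\<lambda>v. E v i) (Fun f ts))"
  proof (rule rep_cong[OF U])
    show "{i. fint N f (map (\<lambda>t. rep U (\<lambda>i. eval_tm N (\<lambda>v. E v i) t) i) ts) = eval_tm N (\<lambda>v. E v i) (Fun f ts)} \<in> U"
      by (rule ultra_mono[OF U map_rep_ae[OF U, of "\<lambda>t i. eval_tm N (\<lambda>v. E v i) t" ts]])
        (simp only: eval_tm.simps Collect_mono_iff, simp del: map_eq_conv)
  qed
  finally show ?case .
qed simp

lemma Los:
  assumes U: "ultra U" and E: "\<And>v. range (E v) \<subseteq> univ N"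
  shows "sat (upow U N) (\<lambda>v. rep U (E v)) \<phi> \<longleftrightarrow> {i. sat N (\<lambda>v. E v i) \<phi>} \<in> U"
  using E
proof (induction \<phi> arbitrary: E)
  case (Eq s t)
  show ?case by (simp add: eval_upow[OF U] rep_eq_iff[OF U])
next
  case (Rel r ts)
  let ?H = "\<lambda>t i. eval_tm N (\<lambda>v. E v i) t"
  have "map (eval_tm (upow U N) (\<lambda>v. rep U (E v))) ts = map (\<lambda>t. rep U (?H t)) ts"
    by (simp add: eval_upow[OF U])
  then have "sat (upow U N) (\<lambda>v. rep U (E v)) (Rel r ts) \<longleftrightarrow>
      {i. rint N r (map (\<lambda>t. rep U (?H t) i) ts)} \<in> U"
    by (simp only: sat.simps) (simp add: upow_def comp_def)
  also have "\<dots> \<longleftrightarrow> {i. rint N r (map (\<lambda>t. ?H t i) ts)} \<in> U" (is "?A \<in> U \<longleftrightarrow> ?B \<in> U")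
  proof
    assume "?A \<in> U"
    then have "?A \<inter> {i. map (\<lambda>t. rep U (?H t) i) ts = map (\<lambda>t. ?H t i) ts} \<in> U"
      using map_rep_ae[OF U, of ?H ts] by (simp add: ultra_Int[OF U])
    then show "?B \<in> U" by (rule ultra_mono[OF U]) (auto simp del: map_eq_conv)
  next
    assume "?B \<in> U"
    then have "?B \<inter> {i. map (\<lambda>t. rep U (?H t) i) ts = map (\<lambda>t. ?H t i) ts} \<in> U"
      using map_rep_ae[OF U, of ?H ts] by (simp add: ultra_Int[OF U])
    then show "?A \<in> U" by (rule ultra_mono[OF U]) (auto simp del: map_eq_conv)
  qed
  finally show ?case by simp
next
  case (Neg p)
  have "sat (upow U N) (\<lambda>v. rep U (E v)) p \<longleftrightarrow> {i. sat N (\<lambda>v. E v i) p} \<in> U"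
    by (rule Neg.IH) (rule Neg.prems)
  moreover have "{i. sat N (\<lambda>v. E v i) (Neg p)} = - {i. sat N (\<lambda>v. E v i) p}" by auto
  ultimately show ?case by (simp only: sat.simps ultra_Compl[OF U])
next
  case (And p q)
  have "sat (upow U N) (\<lambda>v. rep U (E v)) p \<longleftrightarrow> {i. sat N (\<lambda>v. E v i) p} \<in> U"
    by (rule And.IH) (rule And.prems)
  moreover have "sat (upow U N) (\<lambda>v. rep U (E v)) q \<longleftrightarrow> {i. sat N (\<lambda>v. E v i) q} \<in> U"
    by (rule And.IH) (rule And.prems)
  moreover have "{i. sat N (\<lambda>v. E v i) (And p q)} = {i. sat N (\<lambda>v. E v i) p} \<inter> {i. sat N (\<lambda>v. E v i) q}" by auto
  ultimately show ?case by (simp only: sat.simps ultra_Int[OF U])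
next
  case (Ex x p)
  have upd: "(\<lambda>v. rep U (E v))(x := rep U F) = (\<lambda>v. rep U ((E(x := F)) v))" for F by auto
  have upd2: "(\<lambda>v. (E(x := F)) v i) = (\<lambda>v. E v i)(x := F i)" for F i by auto
  have IH: "sat (upow U N) ((\<lambda>v. rep U (E v))(x := rep U F)) p \<longleftrightarrow> {i. sat N ((\<lambda>v. E v i)(x := F i)) p} \<in> U"
    if "range F \<subseteq> univ N" for F
    unfolding upd upd2[symmetric] by (rule Ex.IH) (use Ex.prems that in auto)
  have "sat (upow U N) (\<lambda>v. rep U (E v)) (Ex x p) \<longleftrightarrow>
      (\<exists>F. range F \<subseteq> univ N \<and> {i. sat N ((\<lambda>v. E v i)(x := F i)) p} \<in> U)"
    using IH by (auto simp: upow_def)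
  also have "\<dots> \<longleftrightarrow> {i. sat N (\<lambda>v. E v i) (Ex x p)} \<in> U" (is "?l \<longleftrightarrow> ?r")
  proof
    assume ?l
    then obtain F where F: "range F \<subseteq> univ N" "{i. sat N ((\<lambda>v. E v i)(x := F i)) p} \<in> U" by blast
    show ?r by (rule ultra_mono[OF U F(2)]) (use F(1) in auto)
  next
    assume r: ?r
    \<comment> \<open>Witnesses are chosen index by index; where there is none, \<open>E x i\<close>
      keeps the value inside \<open>univ N\<close>.\<close>
    define F where "F i = (if sat N (\<lambda>v. E v i) (Ex x p) then SOME a. a \<in> univ N \<and> sat N ((\<lambda>v. E v i)(x := a)) p else E x i)" for i
    have F: "F i \<in> univ N \<and> sat N ((\<lambda>v. E v i)(x := F i)) p" if "sat N (\<lambda>v. E v i) (Ex x p)" for i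
    proof -
      have "\<exists>a. a \<in> univ N \<and> sat N ((\<lambda>v. E v i)(x := a)) p" using that by auto
      from someI_ex[OF this] show ?thesis using that by (simp add: F_def)
    qed
    have "F i \<in> univ N" for i
    proof (cases "sat N (\<lambda>v. E v i) (Ex x p)")
      case True
      then show ?thesis using F by blast
    next
      case False
      then have "F i = E x i" by (simp only: F_def if_False)
      then show ?thesis using Ex.prems[of x] by auto
    qed
    then have "range F \<subseteq> univ N" by auto
    moreover have "{i. sat N ((\<lambda>v. E v i)(x := F i)) p} \<in> U"
      by (rule ultra_mono[OF U r]) (use F in blast)
    ultimately show ?l by blast
  qed
  finally show ?case .
qed

lemma is_struct_upow:
  assumes U: "ultra U" and N: "is_struct L N"
  shows "is_struct L (upow U N)"
proof -
  have ne: "univ (upow U N) \<noteq> {}" using N by (auto simp: is_struct_def upow_def)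
  have "fint (upow U N) f xs \<in> univ (upow U N)"
    if f: "f \<in> funs L" "xs \<in> lists (univ (upow U N))" "length xs = farity L f" for f xs
  proof -
    have "\<forall>x\<in>set xs. \<exists>F. range F \<subseteq> univ N \<and> x = rep U F"
      using f(2) by (fastforce simp: upow_def)
    from bchoice[OF this] obtain G where G: "\<And>x. x \<in> set xs \<Longrightarrow> range (G x) \<subseteq> univ N \<and> x = rep U (G x)"
      by blast
    have "fint (upow U N) f xs = rep U (\<lambda>i. fint N f (map (\<lambda>F. F i) xs))" by (simp add: upow_def)
    also have "\<dots> = rep U (\<lambda>i. fint N f (map (\<lambda>x. G x i) xs))"
    proof (rule rep_cong[OF U])
      show "{i. fint N f (map (\<lambda>F. F i) xs) = fint N f (map (\<lambda>x. G x i) xs)} \<in> U"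
      proof (rule ultra_mono[OF U map_rep_ae[OF U, of G xs]], rule subsetI)
        fix i assume i: "i \<in> {i. map (\<lambda>x. rep U (G x) i) xs = map (\<lambda>x. G x i) xs}"
        have "map (\<lambda>F. F i) xs = map (\<lambda>x. rep U (G x) i) xs"
          by (rule map_cong[OF refl]) (metis G)
        then show "i \<in> {i. fint N f (map (\<lambda>F. F i) xs) = fint N f (map (\<lambda>x. G x i) xs)}"
          using i by (simp del: map_eq_conv)
      qed
    qed
    also have "\<dots> \<in> univ (upow U N)"
    proof -
      have "fint N f (map (\<lambda>x. G x i) xs) \<in> univ N" for i
      proof -
        have "G x i \<in> univ N" if "x \<in> set xs" for x using G[OF that] by blast
        then have "map (\<lambda>x. G x i) xs \<in> lists (univ N)" by auto
        then show ?thesis using N f unfolding is_struct_def by auto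
      qed
      then show ?thesis by (auto simp: upow_def)
    qed
    finally show ?thesis .
  qed
  then show ?thesis using ne unfolding is_struct_def by blast
qed

text \<open>The index set consists of sets of constraints, and the ultrafilter contains, for each
  \<open>\<gamma>\<close> in \<open>\<Gamma>\<close>, the set of all finite parts of
  \<open>\<Gamma>\<close> that contain \<open>\<gamma>\<close>. As \<open>H i\<close> solves the
  finite part \<open>i\<close>, the class of \<open>\<lambda>i. H i v\<close> is a value for the
  unknown \<open>v\<close> that solves all constraints by the theorem of Los.\<close>

lemma compactness:
  fixes N :: "('f, 'r, 'a) struct" and \<Gamma> :: "(('f, 'r) fm \<times> (nat \<Rightarrow> 'v)) set"
  assumes N: "is_struct L N"
    and sat: "\<And>\<Gamma>0. finite \<Gamma>0 \<Longrightarrow> \<Gamma>0 \<subseteq> \<Gamma> \<Longrightarrow>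
       \<exists>h. range h \<subseteq> univ N \<and> (\<forall>(\<phi>, \<sigma>)\<in>\<Gamma>0. sat N (h \<circ> \<sigma>) \<phi>)"
  shows "\<exists>(K :: ('f, 'r, (('f, 'r) fm \<times> (nat \<Rightarrow> 'v)) set \<Rightarrow> 'a) struct) h.
     is_struct L K \<and> range h \<subseteq> univ K \<and> (\<forall>(\<phi>, \<sigma>)\<in>\<Gamma>. sat K (h \<circ> \<sigma>) \<phi>) \<and>
     (\<forall>\<phi> e e'. fv \<phi> = {} \<longrightarrow> sat K e \<phi> = sat N e' \<phi>)"
proof -
  define B where "B \<gamma> = {i. finite i \<and> i \<subseteq> \<Gamma> \<and> \<gamma> \<in> i}" for \<gamma> :: "('f, 'r) fm \<times> (nat \<Rightarrow> 'v)"
  have "fip (B ` \<Gamma>)" unfolding fip_def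
  proof (intro allI impI)
    fix G0 assume "finite G0 \<and> G0 \<subseteq> B ` \<Gamma>"
    then obtain C where C: "finite C" "C \<subseteq> \<Gamma>" "G0 = B ` C" by (metis finite_subset_image)
    then have "C \<in> \<Inter>G0" by (auto simp: B_def)
    then show "\<Inter>G0 \<noteq> {}" by blast
  qed
  then obtain U where U: "ultra U" "B ` \<Gamma> \<subseteq> U" using ex_ultra by blast
  have "\<forall>i. \<exists>h. range h \<subseteq> univ N \<and> (finite i \<and> i \<subseteq> \<Gamma> \<longrightarrow> (\<forall>(\<phi>, \<sigma>)\<in>i. sat N (h \<circ> \<sigma>) \<phi>))"
  proof
    fix i show "\<exists>h. range h \<subseteq> univ N \<and> (finite i \<and> i \<subseteq> \<Gamma> \<longrightarrow> (\<forall>(\<phi>, \<sigma>)\<in>i. sat N (h \<circ> \<sigma>) \<phi>))"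
      using sat[of i] sat[of "{}"] by (cases "finite i \<and> i \<subseteq> \<Gamma>") auto
  qed
  from choice[OF this] obtain H where H0: "\<And>i. range (H i) \<subseteq> univ N \<and> (finite i \<and> i \<subseteq> \<Gamma> \<longrightarrow> (\<forall>(\<phi>, \<sigma>)\<in>i. sat N (H i \<circ> \<sigma>) \<phi>))"
    by blast
  have H1: "range (H i) \<subseteq> univ N" for i using H0[of i] by simp
  have H2: "sat N (H i \<circ> \<sigma>) \<phi>" if "finite i" "i \<subseteq> \<Gamma>" "(\<phi>, \<sigma>) \<in> i" for i \<phi> \<sigma>
    using H0[of i] that by auto
  define h where "h v = rep U (\<lambda>i. H i v)" for v
  have "range h \<subseteq> univ (upow U N)" using H1 by (auto simp: h_def upow_def)
  moreover have "sat (upow U N) (h \<circ> \<sigma>) \<phi>" if "(\<phi>, \<sigma>) \<in> \<Gamma>" for \<phi> \<sigma>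
  proof -
    have "sat (upow U N) (\<lambda>v. rep U (\<lambda>i. H i (\<sigma> v))) \<phi> \<longleftrightarrow> {i. sat N (\<lambda>v. H i (\<sigma> v)) \<phi>} \<in> U"
      by (rule Los[OF U(1)]) (use H1 in auto)
    moreover have "{i. sat N (\<lambda>v. H i (\<sigma> v)) \<phi>} \<in> U"
    proof (rule ultra_mono[OF U(1)])
      show "B (\<phi>, \<sigma>) \<in> U" using U(2) that by auto
      show "B (\<phi>, \<sigma>) \<subseteq> {i. sat N (\<lambda>v. H i (\<sigma> v)) \<phi>}" using H2 unfolding B_def comp_def by blast
    qed
    ultimately show ?thesis by (simp add: h_def comp_def)
  qed
  moreover have "sat (upow U N) e \<phi> = sat N e' \<phi>" if "fv \<phi> = {}" for \<phi> e e'
  proof -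
    obtain a where a: "a \<in> univ N" using N unfolding is_struct_def by blast
    have "sat (upow U N) e \<phi> = sat (upow U N) (\<lambda>v. rep U (\<lambda>i. a)) \<phi>" by (rule sat_cong) (simp add: that)
    also have "\<dots> \<longleftrightarrow> {i. sat N (\<lambda>v. a) \<phi>} \<in> U" by (rule Los[OF U(1)]) (use a in auto)
    also have "\<dots> \<longleftrightarrow> sat N (\<lambda>v. a) \<phi>" using U(1) by (cases "sat N (\<lambda>v. a) \<phi>") (auto simp: ultra_def)
    also have "\<dots> = sat N e' \<phi>" by (rule sat_cong) (simp add: that)
    finally show ?thesis .
  qed
  ultimately show ?thesis using is_struct_upow[OF U(1) N]
    by (intro exI[of _ "upow U N"] exI[of _ h]) blast
qed

section \<open>Small elementary substructures and copies inside a given type\<close>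

lemma card_Un_le:
  "infinite Z \<Longrightarrow> |A| \<le>o |Z| \<Longrightarrow> |B| \<le>o |Z| \<Longrightarrow> |A \<union> B| \<le>o |Z|"
  by (rule card_of_Un_ordLeq_infinite_Field) (simp_all add: Field_card_of card_of_card_order_on)

lemma card_Times_le:
  "infinite Z \<Longrightarrow> |A| \<le>o |Z| \<Longrightarrow> |B| \<le>o |Z| \<Longrightarrow> |A \<times> B| \<le>o |Z|"
  by (rule card_of_Times_ordLeq_infinite_Field) (simp_all add: Field_card_of card_of_card_order_on)

lemma card_image_le: "|A| \<le>o |Z| \<Longrightarrow> |f ` A| \<le>o |Z|"
  by (rule ordLeq_transitive[OF card_of_image])

lemma card_subset_le: "A \<subseteq> B \<Longrightarrow> |B| \<le>o r \<Longrightarrow> |A| \<le>o r"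
  by (rule ordLeq_transitive[OF card_of_mono1])

lemma card_UN_nat_le:
  fixes A :: "nat \<Rightarrow> 'b set"
  assumes "infinite Z" "\<And>n. |A n| \<le>o |Z|" shows "|\<Union>n. A n| \<le>o |Z|"
  by (rule card_of_UNION_ordLeq_infinite) (use assms infinite_iff_card_of_nat in auto)

lemma card_finite_le: "infinite Z \<Longrightarrow> finite A \<Longrightarrow> |A| \<le>o |Z|"
  by (rule ordLess_imp_ordLeq, rule finite_ordLess_infinite)
    (simp_all add: Field_card_of card_of_well_order_on)

lemma card_lists_le:
  assumes Z: "infinite Z" and A: "|A| \<le>o |Z|" shows "|lists A| \<le>o |Z|"
proof -
  have "|{xs \<in> lists A. length xs = n}| \<le>o |Z|" for n
  proof (induction n)
    case 0
    have "{xs \<in> lists A. length xs = 0} = {[]}" by auto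
    then show ?case using Z by (simp add: card_finite_le)
  next
    case (Suc n)
    have "{xs \<in> lists A. length xs = Suc n} \<subseteq> (\<lambda>(x, xs). x # xs) ` (A \<times> {xs \<in> lists A. length xs = n})"
    proof
      fix xs assume "xs \<in> {xs \<in> lists A. length xs = Suc n}"
      then obtain y ys where "xs = y # ys" "y \<in> A" "ys \<in> {xs \<in> lists A. length xs = n}"
        by (cases xs) auto
      then show "xs \<in> (\<lambda>(x, xs). x # xs) ` (A \<times> {xs \<in> lists A. length xs = n})"
        by (intro image_eqI[of _ _ "(y, ys)"]) auto
    qed
    then show ?case
      by (rule card_subset_le) (intro card_image_le card_Times_le Z A Suc)
  qed
  then have "|\<Union>n. {xs \<in> lists A. length xs = n}| \<le>o |Z|" by (rule card_UN_nat_le[OF Z])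
  then show ?thesis by (rule card_subset_le[rotated]) auto
qed

text \<open>\<open>Z\<close> stands for a cardinal of size at least |T|. As a set of arbitrary type
  it can be the field of \<lambda> as well as that of its successor, which lives in another
  type.\<close>

definition big :: "('f, 'r) lang \<Rightarrow> 'z set \<Rightarrow> bool" where
  "big L Z \<longleftrightarrow> infinite Z \<and> |funs L| \<le>o |Z| \<and> |rels L| \<le>o |Z|"

lemma card_tms:
  fixes Z :: "'z set"
  assumes "big L Z" shows "|{t. tm_in L t}| \<le>o |Z|"
proof -
  have Z: "infinite Z" and F: "|funs L| \<le>o |Z|" using assms by (auto simp: big_def)
  have nat: "|UNIV :: nat set| \<le>o |Z|" using Z infinite_iff_card_of_nat by auto
  have "|{t. tm_in L t \<and> size t < s}| \<le>o |Z|" for s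
  proof (induction s)
    case 0
    show ?case using Z by (simp add: card_finite_le)
  next
    case (Suc s)
    let ?T = "{t. tm_in L t \<and> size t < s}"
    have "{t. tm_in L t \<and> size t < Suc s} \<subseteq> range Var \<union> (\<lambda>(f, ts). Fun f ts) ` (funs L \<times> lists ?T)"
    proof
      fix t assume t: "t \<in> {t. tm_in L t \<and> size t < Suc s}"
      show "t \<in> range Var \<union> (\<lambda>(f, ts). Fun f ts) ` (funs L \<times> lists ?T)"
      proof (cases t)
        case (Fun f ts)
        have "size u < s" if "u \<in> set ts" for u
        proof -
          have "size u \<le> size_list size ts" using that by (intro size_list_estimation') auto
          then show ?thesis using t Fun by simp
        qed
        then have "(f, ts) \<in> funs L \<times> lists ?T" using t Fun by auto
        then show ?thesis using Fun by (intro UnI2 image_eqI[of _ _ "(f, ts)"]) simp_all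
      qed simp
    qed
    then show ?case
      by (rule card_subset_le) (intro card_Un_le card_image_le card_Times_le card_lists_le Z F nat Suc)
  qed
  then have "|\<Union>s. {t. tm_in L t \<and> size t < s}| \<le>o |Z|" by (rule card_UN_nat_le[OF Z])
  then show ?thesis by (rule card_subset_le[rotated]) auto
qed

lemma card_fms:
  fixes Z :: "'z set"
  assumes L: "big L Z" shows "|{\<phi>. fm_in L \<phi>}| \<le>o |Z|"
proof -
  have Z: "infinite Z" and R: "|rels L| \<le>o |Z|" using L by (auto simp: big_def)
  have nat: "|UNIV :: nat set| \<le>o |Z|" using Z infinite_iff_card_of_nat by auto
  let ?t = "{t. tm_in L t}"
  have T: "|?t| \<le>o |Z|" by (rule card_tms[OF L])
  have "|{\<phi>. fm_in L \<phi> \<and> size \<phi> < s}| \<le>o |Z|" for s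
  proof (induction s)
    case 0
    show ?case using Z by (simp add: card_finite_le)
  next
    case (Suc s)
    let ?F = "{\<phi>. fm_in L \<phi> \<and> size \<phi> < s}"
    let ?X = "(\<lambda>(s, t). Eq s t) ` (?t \<times> ?t) \<union> ((\<lambda>(r, ts). Rel r ts) ` (rels L \<times> lists ?t) \<union>
       (Neg ` ?F \<union> ((\<lambda>(p, q). And p q) ` (?F \<times> ?F) \<union> (\<lambda>(v, p). Ex v p) ` (UNIV \<times> ?F))))"
    have "{\<phi>. fm_in L \<phi> \<and> size \<phi> < Suc s} \<subseteq> ?X"
    proof
      fix p assume p: "p \<in> {\<phi>. fm_in L \<phi> \<and> size \<phi> < Suc s}"
      show "p \<in> ?X" using p by (cases p) (auto simp: image_iff)
    qed
    then show ?case
      by (rule card_subset_le) (intro card_Un_le card_image_le card_Times_le card_lists_le Z R T nat Suc)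
  qed
  then have "|\<Union>s. {\<phi>. fm_in L \<phi> \<and> size \<phi> < s}| \<le>o |Z|" by (rule card_UN_nat_le[OF Z])
  then show ?thesis by (rule card_subset_le[rotated]) auto
qed

section \<open>The downward Loewenheim-Skolem theorem\<close>

lemma eval_tm_univ_update: "eval_tm (K\<lparr>univ := H\<rparr>) e t = eval_tm K e t"
proof (induction t)
  case (Fun f ts)
  then have "map (eval_tm (K\<lparr>univ := H\<rparr>) e) ts = map (eval_tm K e) ts" by simp
  then show ?case by (simp del: map_eq_conv)
qed simp

lemma Tarski_Vaught:
  assumes "\<And>\<phi> v e. fm_in L \<phi> \<Longrightarrow> range e \<subseteq> H \<Longrightarrow> \<exists>x\<in>univ K. sat K (e(v := x)) \<phi> \<Longrightarrow> \<exists>x\<in>H. sat K (e(v := x)) \<phi>"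
    and H: "H \<subseteq> univ K" and "fm_in L \<phi>" "range e \<subseteq> H"
  shows "sat (K\<lparr>univ := H\<rparr>) e \<phi> = sat K e \<phi>"
  using assms(3,4)
proof (induction \<phi> arbitrary: e)
  case (Rel r ts)
  have "map (eval_tm (K\<lparr>univ := H\<rparr>) e) ts = map (eval_tm K e) ts" by (simp add: eval_tm_univ_update)
  then show ?case by (simp del: map_eq_conv)
next
  case (Ex v \<phi>)
  have IH: "sat (K\<lparr>univ := H\<rparr>) (e(v := x)) \<phi> = sat K (e(v := x)) \<phi>" if "x \<in> H" for x
    by (rule Ex.IH) (use Ex.prems that in auto)
  show ?case using assms(1)[of \<phi> e v] Ex.prems IH H by auto
qed (auto simp: eval_tm_univ_update)

text \<open>The universe is a Skolem hull: \<open>w\<close> chooses witnesses with parameters from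
  lists over the set reached so far, and \<omega> rounds suffice because a list has finitely many
  entries. \<open>asg\<close> pads a list by the fixed element \<open>a\<close>.\<close>

lemma Loewenheim_Skolem:
  fixes K :: "('f, 'r, 'b) struct" and Z :: "'z set"
  assumes K: "is_struct L K" and L: "big L Z" and S: "S \<subseteq> univ K" "|S| \<le>o |Z|"
  shows "\<exists>K0. is_struct L K0 \<and> elem_sub L K0 K \<and> S \<subseteq> univ K0 \<and> |univ K0| \<le>o |Z|"
proof -
  have Z: "infinite Z" using L by (auto simp: big_def)
  have nat: "|UNIV :: nat set| \<le>o |Z|" using Z infinite_iff_card_of_nat by auto
  obtain a where a: "a \<in> univ K" using K by (auto simp: is_struct_def)
  define asg where "asg xs n = (if n < length xs then xs ! n else a)" for xs n
  define w where "w = (\<lambda>(\<phi>, v, xs). if \<exists>x\<in>univ K. sat K ((asg xs)(v := x)) \<phi>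
     then SOME x. x \<in> univ K \<and> sat K ((asg xs)(v := x)) \<phi> else a)"
  have w_in: "w (\<phi>, v, xs) \<in> univ K" for \<phi> v xs
  proof (cases "\<exists>x\<in>univ K. sat K ((asg xs)(v := x)) \<phi>")
    case True
    then have "\<exists>x. x \<in> univ K \<and> sat K ((asg xs)(v := x)) \<phi>" by blast
    from someI_ex[OF this] show ?thesis using True by (simp add: w_def)
  next
    case False
    then show ?thesis using a by (simp add: w_def)
  qed
  have w_sat: "sat K ((asg xs)(v := w (\<phi>, v, xs))) \<phi>" if "\<exists>x\<in>univ K. sat K ((asg xs)(v := x)) \<phi>" for \<phi> v xs
  proof -
    have "\<exists>x. x \<in> univ K \<and> sat K ((asg xs)(v := x)) \<phi>" using that by blast
    from someI_ex[OF this] show ?thesis using that by (simp add: w_def)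
  qed
  define G where "G A = A \<union> w ` ({\<phi>. fm_in L \<phi>} \<times> (UNIV \<times> lists A))" for A
  define Hn where "Hn n = (G ^^ n) (insert a S)" for n
  define H where "H = (\<Union>n. Hn n)"
  have Hn_Suc: "Hn (Suc n) = G (Hn n)" for n by (simp add: Hn_def)
  have HnK: "Hn n \<subseteq> univ K" for n
  proof (induction n)
    case 0
    show ?case using a S by (simp add: Hn_def)
  next
    case (Suc n)
    then show ?case using w_in by (auto simp: Hn_Suc G_def)
  qed
  then have HK: "H \<subseteq> univ K" by (auto simp: H_def)
  have mono: "Hn n \<subseteq> Hn m" if "n \<le> m" for n m
    using that by (induction rule: dec_induct) (auto simp: Hn_Suc G_def)
  have "|Hn n| \<le>o |Z|" for n
  proof (induction n)
    case 0
    have "|{a} \<union> S| \<le>o |Z|" by (intro card_Un_le S card_finite_le Z) simp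
    then show ?case by (simp add: Hn_def)
  next
    case (Suc n)
    then show ?case unfolding Hn_Suc G_def
      by (intro card_Un_le card_image_le card_Times_le card_lists_le card_fms L Z nat)
  qed
  then have Hc: "|H| \<le>o |Z|" unfolding H_def by (rule card_UN_nat_le[OF Z])
  have aH: "a \<in> H" unfolding H_def by (rule UN_I[of 0]) (simp_all add: Hn_def)
  have closed: "w (\<phi>, v, xs) \<in> H" if "fm_in L \<phi>" "set xs \<subseteq> H" for \<phi> v xs
  proof -
    have "\<exists>n. set xs \<subseteq> Hn n" using that(2)
    proof (induction xs)
      case (Cons x xs)
      then obtain n m where "set xs \<subseteq> Hn n" "x \<in> Hn m" by (auto simp: H_def)
      then have "set (x # xs) \<subseteq> Hn (max n m)" using mono[of n "max n m"] mono[of m "max n m"] by auto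
      then show ?case by blast
    qed simp
    then obtain n where n: "set xs \<subseteq> Hn n" by blast
    have "(\<phi>, v, xs) \<in> {\<phi>. fm_in L \<phi>} \<times> (UNIV \<times> lists (Hn n))" using n that(1) by auto
    then have "w (\<phi>, v, xs) \<in> Hn (Suc n)" unfolding Hn_Suc G_def by blast
    then show ?thesis unfolding H_def by blast
  qed
  have TV: "\<exists>x\<in>H. sat K (e(v := x)) \<phi>"
    if "fm_in L \<phi>" "range e \<subseteq> H" "\<exists>x\<in>univ K. sat K (e(v := x)) \<phi>" for \<phi> v e
  proof -
    obtain m where m: "\<And>u. u \<in> fv \<phi> \<Longrightarrow> u < m" using finite_nat_set_iff_bounded[of "fv \<phi>"] by auto
    define xs where "xs = map e [0..<m]"
    have eq: "sat K (e(v := x)) \<phi> = sat K ((asg xs)(v := x)) \<phi>" for x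
      by (rule sat_cong) (simp add: m asg_def xs_def)
    have "w (\<phi>, v, xs) \<in> H" by (rule closed) (use that in \<open>auto simp: xs_def\<close>)
    moreover have "sat K (e(v := w (\<phi>, v, xs))) \<phi>" unfolding eq
      by (rule w_sat) (use that(3) in \<open>simp add: eq\<close>)
    ultimately show ?thesis by blast
  qed
  have el: "elem_sub L (K\<lparr>univ := H\<rparr>) K"
    unfolding elem_sub_def using Tarski_Vaught[OF TV HK] HK by auto
  have "is_struct L (K\<lparr>univ := H\<rparr>)"
  proof -
    \<comment> \<open>Closure under functions is the Tarski-Vaught property for the formula
      \<open>Eq (Var n) t\<close>, where \<open>t\<close> applies \<open>f\<close> to the variables
      below \<open>n\<close>.\<close>
    have "fint K f xs \<in> H" if f: "f \<in> funs L" "xs \<in> lists H" "length xs = farity L f" for f xs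
    proof -
      define n where "n = length xs"
      define t where "t = Fun f (map Var [0..<n])"
      define e where "e i = (if i < n then xs ! i else a)" for i
      have ev: "eval_tm K (e(n := x)) t = fint K f xs" for x
      proof -
        have "map (eval_tm K (e(n := x))) (map Var [0..<n]) = xs"
          by (rule nth_equalityI) (simp_all add: n_def e_def)
        then show ?thesis by (simp only: t_def eval_tm.simps)
      qed
      have "fm_in L (Eq (Var n) t)" using f by (auto simp: t_def n_def)
      moreover have "range e \<subseteq> H" using f(2) aH by (auto simp: e_def n_def)
      moreover have "xs \<in> lists (univ K)" using f(2) HK by auto
      then have "fint K f xs \<in> univ K" using K f unfolding is_struct_def by blast
      then have "\<exists>x\<in>univ K. sat K (e(n := x)) (Eq (Var n) t)" by (simp add: ev)
      ultimately obtain x where "x \<in> H" "sat K (e(n := x)) (Eq (Var n) t)" using TV by blast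
      then show ?thesis by (simp add: ev)
    qed
    then show ?thesis using aH unfolding is_struct_def by auto
  qed
  moreover have "S \<subseteq> H" unfolding H_def using mono by (auto simp: Hn_def intro: UN_I[of 0])
  ultimately show ?thesis using el Hc by (intro exI[of _ "K\<lparr>univ := H\<rparr>"]) auto
qed

text \<open>Ultrapowers and their substructures live in function types; pushing them forward along
  an injection moves them back into \<open>'a\<close>.\<close>

definition transport :: "('b \<Rightarrow> 'a) \<Rightarrow> ('f, 'r, 'b) struct \<Rightarrow> ('f, 'r, 'a) struct" where
  "transport h K = \<lparr>univ = h ` univ K,
     fint = (\<lambda>f ys. h (fint K f (map (inv_into (univ K) h) ys))),
     rint = (\<lambda>r ys. rint K r (map (inv_into (univ K) h) ys))\<rparr>"

lemma map_inv_into: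
  "inj_on h A \<Longrightarrow> set xs \<subseteq> A \<Longrightarrow> map (inv_into A h) (map h xs) = xs"
  by (induction xs) auto

lemma eval_transport:
  assumes K: "is_struct L K" and h: "inj_on h (univ K)" and e: "range e \<subseteq> univ K"
  shows "tm_in L t \<Longrightarrow> eval_tm (transport h K) (h \<circ> e) t = h (eval_tm K e t)"
proof (induction t)
  case (Fun f ts)
  have "map (eval_tm (transport h K) (h \<circ> e)) ts = map h (map (eval_tm K e) ts)"
    using Fun by (simp add: comp_def)
  moreover have "set (map (eval_tm K e) ts) \<subseteq> univ K"
    using Fun.prems e by (auto intro!: eval_tm_in_univ[OF K])
  ultimately show ?case
    by (simp only: eval_tm.simps) (simp add: transport_def map_inv_into[OF h] del: map_map)
qed simp

lemma sat_transport:
  assumes K: "is_struct L K" and h: "inj_on h (univ K)"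
  shows "range e \<subseteq> univ K \<Longrightarrow> fm_in L \<phi> \<Longrightarrow> sat (transport h K) (h \<circ> e) \<phi> = sat K e \<phi>"
proof (induction \<phi> arbitrary: e)
  case (Eq s t)
  have "eval_tm K e s \<in> univ K" "eval_tm K e t \<in> univ K"
    using Eq by (auto intro!: eval_tm_in_univ[OF K])
  then show ?case using Eq by (simp add: eval_transport[OF K h] inj_on_eq_iff[OF h] del: o_apply)
next
  case (Rel r ts)
  have "map (eval_tm (transport h K) (h \<circ> e)) ts = map h (map (eval_tm K e) ts)"
    using Rel by (simp add: eval_transport[OF K h])
  moreover have "set (map (eval_tm K e) ts) \<subseteq> univ K"
    using Rel by (auto intro!: eval_tm_in_univ[OF K])
  ultimately show ?case
    by (simp only: sat.simps) (simp add: transport_def map_inv_into[OF h] del: map_map)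
next
  case (Ex v \<phi>)
  have upd: "(h \<circ> e)(v := h x) = h \<circ> e(v := x)" for x by auto
  have IH: "sat (transport h K) (h \<circ> e(v := x)) \<phi> = sat K (e(v := x)) \<phi>" if "x \<in> univ K" for x
    by (rule Ex.IH) (use Ex.prems that in auto)
  have "univ (transport h K) = h ` univ K" by (simp add: transport_def)
  then have "sat (transport h K) (h \<circ> e) (Ex v \<phi>) \<longleftrightarrow> (\<exists>x\<in>univ K. sat (transport h K) ((h \<circ> e)(v := h x)) \<phi>)"
    by (simp only: sat.simps) blast
  then show ?case unfolding upd using IH by (simp only: sat.simps) blast
qed auto

lemma is_struct_transport:
  assumes K: "is_struct L K" and h: "inj_on h (univ K)"
  shows "is_struct L (transport h K)"
proof -
  have "fint (transport h K) f ys \<in> h ` univ K"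
    if f: "f \<in> funs L" "ys \<in> lists (h ` univ K)" "length ys = farity L f" for f ys
  proof -
    have "inv_into (univ K) h y \<in> univ K" if "y \<in> set ys" for y
      by (rule inv_into_into) (use f(2) that in auto)
    then have "map (inv_into (univ K) h) ys \<in> lists (univ K)" by auto
    then show ?thesis using K f unfolding is_struct_def transport_def by auto
  qed
  then show ?thesis using K unfolding is_struct_def by (auto simp: transport_def)
qed

section \<open>Realizing types in small models\<close>

lemma assignment_into:
  assumes "univ M \<noteq> {}" "\<And>v. v \<in> fv \<phi> \<Longrightarrow> e v \<in> univ M"
  shows "\<exists>e'. range e' \<subseteq> univ M \<and> (\<forall>v\<in>fv \<phi>. e' v = e v)"
proof -
  obtain a where "a \<in> univ M" using assms(1) by blast
  then have "range (\<lambda>v. if v \<in> fv \<phi> then e v else a) \<subseteq> univ M" using assms(2) by auto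
  then show ?thesis by (intro exI[of _ "\<lambda>v. if v \<in> fv \<phi> then e v else a"]) simp
qed

lemma elem_subD:
  assumes "elem_sub L M N" "univ M \<noteq> {}" "fm_in L \<phi>" "\<And>v. v \<in> fv \<phi> \<Longrightarrow> e v \<in> univ M"
  shows "sat M e \<phi> = sat N e \<phi>"
proof -
  have "\<exists>e'. range e' \<subseteq> univ M \<and> (\<forall>v\<in>fv \<phi>. e' v = e v)"
    by (rule assignment_into) (use assms(2,4) in simp_all)
  then obtain e' where e': "range e' \<subseteq> univ M" "\<forall>v\<in>fv \<phi>. e' v = e v" by (elim exE conjE)
  have "sat M e \<phi> = sat M e' \<phi>" by (rule sat_cong) (simp add: e')
  also have "\<dots> = sat N e' \<phi>" using assms(1,3) e'(1) unfolding elem_sub_def by blast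
  also have "\<dots> = sat N e \<phi>" by (rule sat_cong) (simp add: e')
  finally show ?thesis .
qed

lemma elem_embeddingD:
  assumes "elem_embedding L M N h" "univ M \<noteq> {}" "fm_in L \<phi>" "\<And>v. v \<in> fv \<phi> \<Longrightarrow> e v \<in> univ M"
  shows "sat M e \<phi> = sat N (h \<circ> e) \<phi>"
proof -
  have "\<exists>e'. range e' \<subseteq> univ M \<and> (\<forall>v\<in>fv \<phi>. e' v = e v)"
    by (rule assignment_into) (use assms(2,4) in simp_all)
  then obtain e' where e': "range e' \<subseteq> univ M" "\<forall>v\<in>fv \<phi>. e' v = e v" by (elim exE conjE)
  have "sat M e \<phi> = sat M e' \<phi>" by (rule sat_cong) (simp add: e')
  also have "\<dots> = sat N (h \<circ> e') \<phi>" using assms(1,3) e'(1) unfolding elem_embedding_def by blast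
  also have "\<dots> = sat N (h \<circ> e) \<phi>" by (rule sat_cong) (simp add: e')
  finally show ?thesis .
qed

lemma sat_transport':
  assumes K: "is_struct L K" and h: "inj_on h (univ K)" and "fm_in L \<phi>" "\<And>v. v \<in> fv \<phi> \<Longrightarrow> e v \<in> univ K"
  shows "sat (transport h K) (h \<circ> e) \<phi> = sat K e \<phi>"
proof -
  have "univ K \<noteq> {}" using K by (simp add: is_struct_def)
  then have "\<exists>e'. range e' \<subseteq> univ K \<and> (\<forall>v\<in>fv \<phi>. e' v = e v)"
    by (rule assignment_into) (use assms(4) in simp_all)
  then obtain e' where e': "range e' \<subseteq> univ K" "\<forall>v\<in>fv \<phi>. e' v = e v" by (elim exE conjE)
  have "sat (transport h K) (h \<circ> e) \<phi> = sat (transport h K) (h \<circ> e') \<phi>" by (rule sat_cong) (simp add: e')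
  also have "\<dots> = sat K e' \<phi>" by (rule sat_transport[OF K h e'(1) assms(3)])
  also have "\<dots> = sat K e \<phi>" by (rule sat_cong) (simp add: e')
  finally show ?thesis .
qed

lemma compactness_small:
  fixes N :: "('f, 'r, 'a) struct" and \<Gamma> :: "(('f, 'r) fm \<times> (nat \<Rightarrow> 'v)) set" and Z :: "'z set"
  assumes N: "is_struct L N" and L: "big L Z" and V: "|V| \<le>o |Z|"
    and \<Gamma>: "\<And>\<phi> \<sigma>. (\<phi>, \<sigma>) \<in> \<Gamma> \<Longrightarrow> fm_in L \<phi> \<and> \<sigma> ` fv \<phi> \<subseteq> V"
    and sat: "\<And>\<Gamma>0. finite \<Gamma>0 \<Longrightarrow> \<Gamma>0 \<subseteq> \<Gamma> \<Longrightarrow>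
       \<exists>h. range h \<subseteq> univ N \<and> (\<forall>(\<phi>, \<sigma>)\<in>\<Gamma>0. sat N (h \<circ> \<sigma>) \<phi>)"
  shows "\<exists>(K :: ('f, 'r, (('f, 'r) fm \<times> (nat \<Rightarrow> 'v)) set \<Rightarrow> 'a) struct) h.
     is_struct L K \<and> |univ K| \<le>o |Z| \<and> h ` V \<subseteq> univ K \<and> (\<forall>(\<phi>, \<sigma>)\<in>\<Gamma>. sat K (h \<circ> \<sigma>) \<phi>) \<and>
     (\<forall>\<phi> e e'. fm_in L \<phi> \<and> fv \<phi> = {} \<longrightarrow> sat K e \<phi> = sat N e' \<phi>)"
proof -
  obtain K :: "('f, 'r, (('f, 'r) fm \<times> (nat \<Rightarrow> 'v)) set \<Rightarrow> 'a) struct" and h where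
    K: "is_struct L K \<and> range h \<subseteq> univ K \<and> (\<forall>(\<phi>, \<sigma>)\<in>\<Gamma>. sat K (h \<circ> \<sigma>) \<phi>) \<and>
     (\<forall>\<phi> e e'. fv \<phi> = {} \<longrightarrow> sat K e \<phi> = sat N e' \<phi>)"
    using compactness[OF N sat] by metis
  have "\<exists>K0. is_struct L K0 \<and> elem_sub L K0 K \<and> h ` V \<subseteq> univ K0 \<and> |univ K0| \<le>o |Z|"
    by (rule Loewenheim_Skolem[OF _ L]) (use K in \<open>auto intro: card_image_le V\<close>)
  then obtain K0 where K0: "is_struct L K0" "elem_sub L K0 K" "h ` V \<subseteq> univ K0" "|univ K0| \<le>o |Z|"
    by (elim exE conjE)
  have ne: "univ K0 \<noteq> {}" using K0(1) by (simp add: is_struct_def)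
  have "sat K0 (h \<circ> \<sigma>) \<phi>" if "(\<phi>, \<sigma>) \<in> \<Gamma>" for \<phi> \<sigma>
  proof -
    have "sat K0 (h \<circ> \<sigma>) \<phi> = sat K (h \<circ> \<sigma>) \<phi>"
      by (rule elem_subD[OF K0(2) ne]) (use \<Gamma>[OF that] K0(3) in auto)
    then show ?thesis using K that by auto
  qed
  moreover have "sat K0 e \<phi> = sat N e' \<phi>" if "fm_in L \<phi>" "fv \<phi> = {}" for \<phi> e e'
  proof -
    have "sat K0 e \<phi> = sat K e \<phi>" by (rule elem_subD[OF K0(2) ne]) (use that in auto)
    then show ?thesis using K that(2) by simp
  qed
  ultimately show ?thesis using K0 by (intro exI[of _ K0] exI[of _ h]) auto
qed

lemma holds_sentence:
  assumes "is_struct L M" "fv \<phi> = {}" shows "holds M \<phi> = sat M e \<phi>"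
proof -
  obtain a where "a \<in> univ M" using assms(1) by (auto simp: is_struct_def)
  then have "range (\<lambda>_. a) \<subseteq> univ M" by auto
  moreover have "sat M e' \<phi> = sat M e \<phi>" for e' by (rule sat_cong) (simp add: assms(2))
  ultimately show ?thesis unfolding holds_def by blast
qed

lemma is_model_elem_equiv:
  assumes "is_model L T N" "is_struct L K" "T \<subseteq> sentences L"
    "\<And>\<phi> e e'. fm_in L \<phi> \<Longrightarrow> fv \<phi> = {} \<Longrightarrow> sat K e \<phi> = sat N e' \<phi>"
  shows "is_model L T K"
  unfolding is_model_def
proof (intro conjI ballI assms(2))
  fix \<phi> assume \<phi>: "\<phi> \<in> T"
  then have f: "fm_in L \<phi>" "fv \<phi> = {}" using assms(3) by (auto simp: sentences_def)
  have N: "is_struct L N" "holds N \<phi>" using assms(1) \<phi> by (auto simp: is_model_def)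
  then show "holds K \<phi>"
    using holds_sentence[OF N(1) f(2)] holds_sentence[OF assms(2) f(2)] assms(4)[OF f] by blast
qed

lemma is_model_elem_sub:
  assumes "is_model L T M" "elem_sub L M N" "is_struct L N" "T \<subseteq> sentences L"
  shows "is_model L T N"
proof (rule is_model_elem_equiv[OF assms(1,3,4)])
  fix \<phi> e e' assume f: "fm_in L \<phi>" "fv \<phi> = {}"
  have "univ M \<noteq> {}" using assms(1) by (simp add: is_model_def is_struct_def)
  then have "sat M e' \<phi> = sat N e' \<phi>" using assms(2) f by (intro elem_subD) auto
  moreover have "sat N e \<phi> = sat N e' \<phi>" by (rule sat_cong) (simp add: f)
  ultimately show "sat N e \<phi> = sat M e' \<phi>" by simp
qed

text \<open>The new model need not contain \<open>N\<close>, so \<open>Z\<close> may be as large as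
  \<open>'a\<close>. This leaves room for models of the successor cardinality of \<lambda>, even if
  \<open>'a\<close> itself has no more elements.\<close>

lemma realize_theory:
  fixes N :: "('f, 'r, 'a) struct" and \<Gamma> :: "(('f, 'r) fm \<times> (nat \<Rightarrow> 'v)) set" and Z :: "'z set"
  assumes N: "is_model L T N" and T: "T \<subseteq> sentences L" and L: "big L Z" and V: "|V| \<le>o |Z|"
    and ZU: "|Z| \<le>o |UNIV :: 'a set|"
    and \<Gamma>: "\<And>\<phi> \<sigma>. (\<phi>, \<sigma>) \<in> \<Gamma> \<Longrightarrow> fm_in L \<phi> \<and> \<sigma> ` fv \<phi> \<subseteq> V"
    and sat: "\<And>\<Gamma>0. finite \<Gamma>0 \<Longrightarrow> \<Gamma>0 \<subseteq> \<Gamma> \<Longrightarrow>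
       \<exists>h. range h \<subseteq> univ N \<and> (\<forall>(\<phi>, \<sigma>)\<in>\<Gamma>0. sat N (h \<circ> \<sigma>) \<phi>)"
  shows "\<exists>(K :: ('f, 'r, 'a) struct) h.
     is_model L T K \<and> |univ K| \<le>o |Z| \<and> h ` V \<subseteq> univ K \<and> (\<forall>(\<phi>, \<sigma>)\<in>\<Gamma>. sat K (h \<circ> \<sigma>) \<phi>)"
proof -
  have N': "is_struct L N" using N by (simp add: is_model_def)
  have "\<exists>(K :: ('f, 'r, (('f, 'r) fm \<times> (nat \<Rightarrow> 'v)) set \<Rightarrow> 'a) struct) h.
     is_struct L K \<and> |univ K| \<le>o |Z| \<and> h ` V \<subseteq> univ K \<and> (\<forall>(\<phi>, \<sigma>)\<in>\<Gamma>. sat K (h \<circ> \<sigma>) \<phi>) \<and>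
     (\<forall>\<phi> e e'. fm_in L \<phi> \<and> fv \<phi> = {} \<longrightarrow> sat K e \<phi> = sat N e' \<phi>)"
    by (rule compactness_small[OF N' L V]) (fact \<Gamma>, fact sat)
  then obtain K :: "('f, 'r, (('f, 'r) fm \<times> (nat \<Rightarrow> 'v)) set \<Rightarrow> 'a) struct" and h where
    K: "is_struct L K" "|univ K| \<le>o |Z|" "h ` V \<subseteq> univ K" "\<forall>(\<phi>, \<sigma>)\<in>\<Gamma>. sat K (h \<circ> \<sigma>) \<phi>"
     "\<forall>\<phi> e e'. fm_in L \<phi> \<and> fv \<phi> = {} \<longrightarrow> sat K e \<phi> = sat N e' \<phi>"
    by (elim exE conjE)
  obtain g :: "_ \<Rightarrow> 'a" where g: "inj_on g (univ K)"
    using ordLeq_transitive[OF K(2) ZU] by (auto simp: card_of_ordLeq[symmetric])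
  let ?P = "transport g K"
  have P: "is_struct L ?P" by (rule is_struct_transport[OF K(1) g])
  have uP: "univ ?P = g ` univ K" by (simp add: transport_def)
  have "is_model L T ?P"
  proof (rule is_model_elem_equiv[OF N P T])
    fix \<phi> e e' assume f: "fm_in L \<phi>" "fv \<phi> = {}"
    have "sat ?P e \<phi> = sat ?P (g \<circ> undefined) \<phi>" by (rule sat_cong) (simp add: f)
    also have "\<dots> = sat K undefined \<phi>" by (rule sat_transport'[OF K(1) g f(1)]) (simp add: f)
    finally show "sat ?P e \<phi> = sat N e' \<phi>" using K(5) f by blast
  qed
  moreover have "|univ ?P| \<le>o |Z|" unfolding uP by (rule card_image_le[OF K(2)])
  moreover have "(g \<circ> h) ` V \<subseteq> univ ?P" using K(3) by (auto simp: uP)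
  moreover have "sat ?P (g \<circ> h \<circ> \<sigma>) \<phi>" if p: "(\<phi>, \<sigma>) \<in> \<Gamma>" for \<phi> \<sigma>
  proof -
    have "sat ?P (g \<circ> (h \<circ> \<sigma>)) \<phi> = sat K (h \<circ> \<sigma>) \<phi>"
      by (rule sat_transport'[OF K(1) g]) (use \<Gamma>[OF p] K(3) in auto)
    then show ?thesis using K(4) p by (auto simp: comp_def)
  qed
  ultimately show ?thesis by (intro exI[of _ ?P] exI[of _ "g \<circ> h"]) auto
qed

text \<open>Compactness is applied to \<open>\<Gamma>\<close> together with the elementary diagram
  \<open>\<Delta>\<close> of \<open>P\<close>: \<open>Inl u\<close> names the element
  \<open>u\<close>, and \<open>Inr v\<close> is an unknown. Because finite parts of
  \<open>\<Gamma>\<close> are solved in \<open>P\<close> with every element naming itself, the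
  diagram is satisfied along with them.\<close>

lemma realize_extension:
  fixes P :: "('f, 'r, 'a) struct" and \<Gamma> :: "(('f, 'r) fm \<times> (nat \<Rightarrow> 'a + 'v)) set" and Z :: "'z set"
  assumes P: "is_struct L P" and L: "big L Z" and V: "|V| \<le>o |Z|" and PZ: "|univ P| \<le>o |Z|"
    and ZU: "|Z| <o |UNIV :: 'a set|"
    and \<Gamma>: "\<And>\<phi> \<sigma>. (\<phi>, \<sigma>) \<in> \<Gamma> \<Longrightarrow> fm_in L \<phi> \<and> \<sigma> ` fv \<phi> \<subseteq> Inl ` univ P \<union> Inr ` V"
    and sat: "\<And>\<Gamma>0. finite \<Gamma>0 \<Longrightarrow> \<Gamma>0 \<subseteq> \<Gamma> \<Longrightarrow>
       \<exists>h. range h \<subseteq> univ P \<and> (\<forall>(\<phi>, \<sigma>)\<in>\<Gamma>0. sat P (case_sum id h \<circ> \<sigma>) \<phi>)"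
  shows "\<exists>Q h. is_struct L Q \<and> elem_sub L P Q \<and> |univ Q| \<le>o |Z| \<and> h ` V \<subseteq> univ Q \<and>
     (\<forall>(\<phi>, \<sigma>)\<in>\<Gamma>. sat Q (case_sum id h \<circ> \<sigma>) \<phi>)"
proof -
  define \<Delta> :: "(('f, 'r) fm \<times> (nat \<Rightarrow> 'a + 'v)) set"
    where "\<Delta> = {(\<phi>, \<sigma>). fm_in L \<phi> \<and> (\<exists>e. \<sigma> = Inl \<circ> e \<and> range e \<subseteq> univ P \<and> sat P e \<phi>)}"
  obtain a where a: "a \<in> univ P" using P by (auto simp: is_struct_def)
  have Z: "infinite Z" using L by (simp add: big_def)
  have V': "|Inl ` univ P \<union> Inr ` V| \<le>o |Z|"
    by (intro card_Un_le card_image_le Z V PZ)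
  have "\<exists>(K :: ('f, 'r, (('f, 'r) fm \<times> (nat \<Rightarrow> 'a + 'v)) set \<Rightarrow> 'a) struct) h.
     is_struct L K \<and> |univ K| \<le>o |Z| \<and> h ` (Inl ` univ P \<union> Inr ` V) \<subseteq> univ K \<and>
     (\<forall>(\<phi>, \<sigma>)\<in>\<Gamma> \<union> \<Delta>. sat K (h \<circ> \<sigma>) \<phi>) \<and>
     (\<forall>\<phi> e e'. fm_in L \<phi> \<and> fv \<phi> = {} \<longrightarrow> sat K e \<phi> = sat P e' \<phi>)"
  proof (rule compactness_small[OF P L V'])
    fix \<phi> \<sigma> assume "(\<phi>, \<sigma>) \<in> \<Gamma> \<union> \<Delta>"
    then show "fm_in L \<phi> \<and> \<sigma> ` fv \<phi> \<subseteq> Inl ` univ P \<union> Inr ` V"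
    proof
      assume "(\<phi>, \<sigma>) \<in> \<Gamma>" then show ?thesis by (rule \<Gamma>)
    next
      assume "(\<phi>, \<sigma>) \<in> \<Delta>"
      then obtain e where "fm_in L \<phi>" "\<sigma> = Inl \<circ> e" "range e \<subseteq> univ P" by (auto simp: \<Delta>_def)
      then show ?thesis by auto
    qed
  next
    fix G assume G: "finite G" "G \<subseteq> \<Gamma> \<union> \<Delta>"
    then have "\<exists>h. range h \<subseteq> univ P \<and> (\<forall>(\<phi>, \<sigma>)\<in>G \<inter> \<Gamma>. sat P (case_sum id h \<circ> \<sigma>) \<phi>)"
      by (intro sat) auto
    then obtain h where h: "range h \<subseteq> univ P" "\<forall>(\<phi>, \<sigma>)\<in>G \<inter> \<Gamma>. sat P (case_sum id h \<circ> \<sigma>) \<phi>" by (elim exE conjE)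
    define k where "k = case_sum (\<lambda>u. if u \<in> univ P then u else a) h"
    have "h v \<in> univ P" for v using h(1) by blast
    then have "range k \<subseteq> univ P" using a by (auto simp: k_def split: sum.splits)
    moreover have "sat P (k \<circ> \<sigma>) \<phi>" if p: "(\<phi>, \<sigma>) \<in> G" for \<phi> \<sigma>
    proof (cases "(\<phi>, \<sigma>) \<in> \<Gamma>")
      case True
      have "sat P (k \<circ> \<sigma>) \<phi> = sat P (case_sum id h \<circ> \<sigma>) \<phi>"
      proof (rule sat_cong)
        fix v assume "v \<in> fv \<phi>"
        then have "\<sigma> v \<in> Inl ` univ P \<union> Inr ` V" using \<Gamma>[OF True] by auto
        then show "(k \<circ> \<sigma>) v = (case_sum id h \<circ> \<sigma>) v" by (auto simp: k_def)
      qed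
      then show ?thesis using h(2) p True by auto
    next
      case False
      then have "(\<phi>, \<sigma>) \<in> \<Delta>" using G(2) p by auto
      then obtain e where e: "\<sigma> = Inl \<circ> e" "range e \<subseteq> univ P" "sat P e \<phi>" by (auto simp: \<Delta>_def)
      have "k \<circ> \<sigma> = e" using e(1,2) by (auto simp: k_def fun_eq_iff)
      then show ?thesis using e(3) by simp
    qed
    ultimately show "\<exists>h. range h \<subseteq> univ P \<and> (\<forall>(\<phi>, \<sigma>)\<in>G. sat P (h \<circ> \<sigma>) \<phi>)"
      by (intro exI[of _ k]) auto
  qed
  then obtain K :: "('f, 'r, (('f, 'r) fm \<times> (nat \<Rightarrow> 'a + 'v)) set \<Rightarrow> 'a) struct" and h where
    K: "is_struct L K" "|univ K| \<le>o |Z|" "h ` (Inl ` univ P \<union> Inr ` V) \<subseteq> univ K"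
     "\<forall>(\<phi>, \<sigma>)\<in>\<Gamma> \<union> \<Delta>. sat K (h \<circ> \<sigma>) \<phi>"
    by (elim exE conjE)
  have diag: "sat K (h \<circ> Inl \<circ> e) \<phi> = sat P e \<phi>" if f: "fm_in L \<phi>" "range e \<subseteq> univ P" for \<phi> e
  proof -
    have "sat K (h \<circ> (Inl \<circ> e)) \<phi>" if "sat P e \<phi>" "fm_in L \<phi>" for \<phi>
    proof -
      have "(\<phi>, Inl \<circ> e) \<in> \<Delta>" using that f(2) by (auto simp: \<Delta>_def)
      then show ?thesis using K(4) by auto
    qed
    from this[of \<phi>] this[of "Neg \<phi>"] show ?thesis using f(1) by (auto simp: o_assoc)
  qed
  define k where "k u = h (Inl u)" for u
  have kK: "k ` univ P \<subseteq> univ K" using K(3) by (auto simp: k_def)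
  have k: "inj_on k (univ P)"
  proof (rule inj_onI)
    fix x y assume xy: "x \<in> univ P" "y \<in> univ P" "k x = k y"
    define e where "e v = (if v = 0 then x else y)" for v :: nat
    have "range e \<subseteq> univ P" using xy by (auto simp: e_def)
    then have "sat K (h \<circ> Inl \<circ> e) (Eq (Var 0) (Var 1)) = sat P e (Eq (Var 0) (Var 1))" by (intro diag) simp_all
    then show "x = y" using xy(3) by (simp add: e_def k_def)
  qed
  have PU: "|univ P| <o |UNIV :: 'a set|" by (rule ordLeq_ordLess_trans[OF PZ ZU])
  have inf: "infinite (UNIV :: 'a set)" using Z ZU by (metis card_of_ordLeq_infinite ordLess_imp_ordLeq)
  have "|UNIV :: 'a set| \<le>o |UNIV - univ P|"
  proof (rule ccontr)
    assume "\<not> |UNIV :: 'a set| \<le>o |UNIV - univ P|"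
    then have "|UNIV - univ P| <o |UNIV :: 'a set|" by (simp add: not_ordLeq_iff_ordLess card_of_Well_order)
    from card_of_Un_ordLess_infinite[OF inf this PU] show False
      by (simp add: ordLess_irreflexive)
  qed
  then have "|univ K| \<le>o |UNIV - univ P|"
    by (rule ordLeq_transitive[OF ordLeq_transitive[OF K(2) ordLess_imp_ordLeq[OF ZU]]])
  then obtain j where j: "inj_on j (univ K)" "j ` univ K \<subseteq> UNIV - univ P" by (auto simp: card_of_ordLeq[symmetric])
  \<comment> \<open>The copy of \<open>u\<close> is sent back to \<open>u\<close>, all other
    elements go outside \<open>univ P\<close>. So the extension contains \<open>P\<close> literally;
    the strict bound on |Z| provides the space.\<close>
  define g where "g x = (if x \<in> k ` univ P then inv_into (univ P) k x else j x)" for x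
  have gk: "g (k u) = u" if "u \<in> univ P" for u using that k by (simp add: g_def)
  have g: "inj_on g (univ K)"
  proof (rule inj_onI)
    fix x y assume xy: "x \<in> univ K" "y \<in> univ K" "g x = g y"
    have gP: "g z \<in> univ P \<longleftrightarrow> z \<in> k ` univ P" if "z \<in> univ K" for z
      using j(2) that gk by (auto simp: g_def)
    show "x = y"
    proof (cases "x \<in> k ` univ P")
      case True
      then have "y \<in> k ` univ P" using gP xy by metis
      then show ?thesis using True xy(3) gk by force
    next
      case False
      then have "y \<notin> k ` univ P" using gP xy by metis
      then show ?thesis using False xy j(1) by (simp add: g_def inj_on_eq_iff)
    qed
  qed
  let ?Q = "transport g K"
  have Q: "is_struct L ?Q" by (rule is_struct_transport[OF K(1) g])
  have uQ: "univ ?Q = g ` univ K" by (simp add: transport_def)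
  have "univ P \<subseteq> univ ?Q" unfolding uQ using gk kK by (auto simp: image_iff) (metis imageI subsetD)
  moreover have "sat P e \<phi> = sat ?Q e \<phi>" if f: "fm_in L \<phi>" "range e \<subseteq> univ P" for \<phi> e
  proof -
    have "sat ?Q (g \<circ> (h \<circ> Inl \<circ> e)) \<phi> = sat K (h \<circ> Inl \<circ> e) \<phi>"
      by (rule sat_transport'[OF K(1) g f(1)]) (use f(2) kK in \<open>auto simp: k_def\<close>)
    moreover have "g \<circ> (h \<circ> Inl \<circ> e) = e" using f(2) gk by (auto simp: fun_eq_iff k_def)
    ultimately show ?thesis using diag[OF f] by simp
  qed
  ultimately have "elem_sub L P ?Q" by (auto simp: elem_sub_def)
  moreover have "|univ ?Q| \<le>o |Z|" unfolding uQ by (rule card_image_le[OF K(2)])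
  moreover have "(g \<circ> h \<circ> Inr) ` V \<subseteq> univ ?Q"
    using K(3) by (auto simp: uQ image_Un image_image intro!: imageI)
  moreover have "sat ?Q (case_sum id (g \<circ> h \<circ> Inr) \<circ> \<sigma>) \<phi>" if p: "(\<phi>, \<sigma>) \<in> \<Gamma>" for \<phi> \<sigma>
  proof -
    have V: "\<sigma> v \<in> Inl ` univ P \<union> Inr ` V" if "v \<in> fv \<phi>" for v using \<Gamma>[OF p] that by auto
    have "sat ?Q (case_sum id (g \<circ> h \<circ> Inr) \<circ> \<sigma>) \<phi> = sat ?Q (g \<circ> (h \<circ> \<sigma>)) \<phi>"
    proof (rule sat_cong)
      fix v assume "v \<in> fv \<phi>"
      from V[OF this] show "(case_sum id (g \<circ> h \<circ> Inr) \<circ> \<sigma>) v = (g \<circ> (h \<circ> \<sigma>)) v"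
        using gk by (auto simp: k_def)
    qed
    also have "\<dots> = sat K (h \<circ> \<sigma>) \<phi>"
    proof (rule sat_transport'[OF K(1) g])
      show "fm_in L \<phi>" using \<Gamma>[OF p] by simp
      fix v assume "v \<in> fv \<phi>"
      from V[OF this] show "(h \<circ> \<sigma>) v \<in> univ K" using K(3) by auto
    qed
    finally show ?thesis using K(4) p by auto
  qed
  ultimately show ?thesis using Q by (intro exI[of _ ?Q] exI[of _ "g \<circ> h \<circ> Inr"]) auto
qed

section \<open>Ranks and binary trees\<close>

text \<open>
  \<open>rk SS m j t X\<close>: there are \<open>t\<close> successive members of \<open>SS\<close> each of which, outside its predecessors, cuts
  out of \<open>X\<close> a part of rank at least \<open>j - 1\<close>. The width \<open>m\<close> at the lower levels is bounded so that the
  rank is first-order expressible; only the limit \<open>Rk\<close> over all \<open>m\<close> is partition regular.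
\<close>

fun rk :: "'x set set \<Rightarrow> nat \<Rightarrow> nat \<Rightarrow> nat \<Rightarrow> 'x set \<Rightarrow> bool" where
  "rk SS m 0 t X \<longleftrightarrow> X \<noteq> {}"
| "rk SS m (Suc j) 0 X \<longleftrightarrow> True"
| "rk SS m (Suc j) (Suc t) X \<longleftrightarrow> (\<exists>S\<in>SS. rk SS m j m (X \<inter> S) \<and> rk SS m (Suc j) t (X - S))"

definition Rk :: "'x set set \<Rightarrow> nat \<Rightarrow> 'x set \<Rightarrow> bool" where
  "Rk SS j X \<longleftrightarrow> (\<forall>m. rk SS m j m X)"

lemma rk_mono: "rk SS m j t X \<Longrightarrow> X \<subseteq> Y \<Longrightarrow> rk SS m j t Y"
proof (induction SS m j t X arbitrary: Y rule: rk.induct)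
  case (3 SS m j t X)
  then obtain S where S: "S \<in> SS" "rk SS m j m (X \<inter> S)" "rk SS m (Suc j) t (X - S)" by auto
  have "X \<inter> S \<subseteq> Y \<inter> S" "X - S \<subseteq> Y - S" using 3(4) by blast+
  then have "rk SS m j m (Y \<inter> S)" "rk SS m (Suc j) t (Y - S)" using 3(1,2)[OF S(1)] S(2,3) by blast+
  then show ?case using S(1) by auto
qed auto

lemma rk_antimono: "rk SS m' j t' X \<Longrightarrow> m \<le> m' \<Longrightarrow> t \<le> t' \<Longrightarrow> rk SS m j t X"
proof (induction j arbitrary: t t' X)
  case (Suc j)
  note IH = Suc.IH and mm = Suc.prems(2)
  from Suc.prems(1,3) show ?case
  proof (induction t' arbitrary: t X)
    case (Suc s')
    show ?case
    proof (cases t)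
      case (Suc s)
      obtain S where S: "S \<in> SS" "rk SS m' j m' (X \<inter> S)" "rk SS m' (Suc j) s' (X - S)"
        using Suc.prems by auto
      have "rk SS m j m (X \<inter> S)" by (rule IH[OF S(2) mm mm])
      moreover have "rk SS m (Suc j) s (X - S)" by (rule Suc.IH[OF S(3)]) (use Suc Suc.prems in simp)
      ultimately show ?thesis using S(1) Suc by auto
    qed simp
  qed simp
qed simp

lemma Rk_mono: "Rk SS j X \<Longrightarrow> X \<subseteq> Y \<Longrightarrow> Rk SS j Y"
  unfolding Rk_def using rk_mono by blast

text \<open>Once the width is at least the \<open>m1\<close> of the level below, each of
  \<open>2 * m\<close> successive members cuts out a large part of \<open>X\<close> or a large part
  of \<open>Y\<close>; by pigeonhole one side collects \<open>m\<close> of them. The inner induction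
  counts them as \<open>u = s + t\<close>.\<close>

lemma rk_union: "\<exists>m'. \<forall>X Y. rk SS m' j m' (X \<union> Y) \<longrightarrow> rk SS m j m X \<or> rk SS m j m Y"
proof (induction j arbitrary: m)
  case (Suc j)
  obtain m1 where m1: "\<And>X Y. rk SS m1 j m1 (X \<union> Y) \<Longrightarrow> rk SS m j m X \<or> rk SS m j m Y"
    using Suc[of m] by blast
  define m' where "m' = max m1 (2 * m)"
  have *: "rk SS m' (Suc j) u (X \<union> Y) \<Longrightarrow> u = s + t \<Longrightarrow> rk SS m (Suc j) s X \<or> rk SS m (Suc j) t Y" for u s t X Y
  proof (induction u arbitrary: s t X Y)
    case (Suc u)
    show ?case
    proof (cases "s = 0 \<or> t = 0")
      case False
      then obtain s' t' where st: "s = Suc s'" "t = Suc t'" by (metis not0_implies_Suc)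
      obtain S where S: "S \<in> SS" "rk SS m' j m' ((X \<union> Y) \<inter> S)" "rk SS m' (Suc j) u ((X \<union> Y) - S)"
        using Suc.prems(1) by auto
      have "rk SS m1 j m1 ((X \<inter> S) \<union> (Y \<inter> S))"
        using rk_antimono[OF S(2), of m1 m1] by (simp add: m'_def Int_Un_distrib2)
      then have "rk SS m j m (X \<inter> S) \<or> rk SS m j m (Y \<inter> S)" by (rule m1)
      moreover have S3: "rk SS m' (Suc j) u ((X - S) \<union> (Y - S))" using S(3) by (simp add: Un_Diff)
      moreover have "rk SS m (Suc j) s' (X - S) \<or> rk SS m (Suc j) t (Y - S)"
        by (rule Suc.IH[OF S3]) (use Suc.prems st in simp)
      moreover have "rk SS m (Suc j) s (X - S) \<or> rk SS m (Suc j) t' (Y - S)"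
        by (rule Suc.IH[OF S3]) (use Suc.prems st in simp)
      moreover have "rk SS m (Suc j) t Y" if "rk SS m (Suc j) t (Y - S)" by (rule rk_mono[OF that]) auto
      moreover have "rk SS m (Suc j) s X" if "rk SS m (Suc j) s (X - S)" by (rule rk_mono[OF that]) auto
      ultimately show ?thesis using S(1) st by auto
    qed auto
  qed simp
  have "rk SS m (Suc j) m X \<or> rk SS m (Suc j) m Y" if "rk SS m' (Suc j) m' (X \<union> Y)" for X Y
  proof (rule *)
    show "rk SS m' (Suc j) (2 * m) (X \<union> Y)" by (rule rk_antimono[OF that]) (simp_all add: m'_def)
  qed simp
  then show ?case by blast
qed auto

lemma Rk_union:
  assumes "Rk SS j (X \<union> Y)" shows "Rk SS j X \<or> Rk SS j Y"
proof (rule ccontr)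
  assume "\<not> (Rk SS j X \<or> Rk SS j Y)"
  then obtain m1 m2 where m: "\<not> rk SS m1 j m1 X" "\<not> rk SS m2 j m2 Y" by (auto simp: Rk_def)
  define m where "m = max m1 m2"
  obtain m' where m': "rk SS m' j m' (X \<union> Y) \<longrightarrow> rk SS m j m X \<or> rk SS m j m Y" using rk_union[of SS j m] by blast
  have "rk SS m j m X \<or> rk SS m j m Y" using m' assms by (simp add: Rk_def)
  then have "rk SS m1 j m1 X \<or> rk SS m2 j m2 Y"
    using rk_antimono[of SS m j m X m1 m1] rk_antimono[of SS m j m Y m2 m2] by (auto simp: m_def)
  then show False using m by blast
qed

lemma Rk_nonempty:
  assumes "Rk SS j X" shows "X \<noteq> {}"
proof -
  have "rk SS (Suc m) j (Suc t) X \<Longrightarrow> X \<noteq> {}" for m t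
  proof (induction j arbitrary: t X)
    case (Suc j)
    then obtain S where "rk SS (Suc m) j (Suc m) (X \<inter> S)" by auto
    then have "X \<inter> S \<noteq> {}" by (rule Suc.IH)
    then show ?case by blast
  qed simp
  moreover have "rk SS (Suc 0) j (Suc 0) X" using assms by (simp add: Rk_def)
  ultimately show ?thesis by blast
qed

lemma Rk_UN:
  assumes "finite I" "Rk SS j X" "X \<subseteq> (\<Union>i\<in>I. F i)"
  shows "\<exists>i\<in>I. Rk SS j (X \<inter> F i)"
  using assms
proof (induction I arbitrary: X rule: finite_induct)
  case empty
  then show ?case using Rk_nonempty by blast
next
  case (insert i I)
  have "Rk SS j ((X \<inter> F i) \<union> (X - F i))" using insert.prems(1) by (rule Rk_mono) blast
  then have "Rk SS j (X \<inter> F i) \<or> Rk SS j (X - F i)" by (rule Rk_union)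
  then show ?case
  proof
    assume r: "Rk SS j (X - F i)"
    have "X - F i \<subseteq> (\<Union>i\<in>I. F i)" using insert.prems(2) by blast
    from insert.IH[OF r this] obtain i' where "i' \<in> I" "Rk SS j ((X - F i) \<inter> F i')" by blast
    moreover from this(2) have "Rk SS j (X \<inter> F i')" by (rule Rk_mono) blast
    ultimately show ?thesis by blast
  qed blast
qed

text \<open>Induction on \<open>k\<close>: either infinitely many \<open>c i\<close> stay large inside a fixed \<open>c i\<^sub>0\<close>, where the sequence is
  \<open>(k - 1)\<close>-inconsistent, or members can be removed one after another without losing rank.\<close>

lemma Rk_Suc:
  assumes "infinite J" "\<And>i. i \<in> J \<Longrightarrow> c i \<in> SS" "\<And>i. i \<in> J \<Longrightarrow> Rk SS j (X \<inter> c i)"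
    and "\<And>I. I \<subseteq> J \<Longrightarrow> finite I \<Longrightarrow> card I = k \<Longrightarrow> X \<inter> (\<Inter>i\<in>I. c i) = {}"
  shows "Rk SS (Suc j) X"
  using assms
proof (induction k arbitrary: J X)
  case 0
  have "X = {}" using "0.prems"(4)[of "{}"] by simp
  moreover obtain i where "i \<in> J" using "0.prems"(1) by (metis ex_in_conv finite.emptyI)
  ultimately show ?case using "0.prems"(3) Rk_nonempty by fastforce
next
  case (Suc k)
  note JSS = Suc.prems(2) and JRk = Suc.prems(3)
  show ?case
  proof (cases "\<exists>i0\<in>J. infinite {i\<in>J. i \<noteq> i0 \<and> Rk SS j (X \<inter> c i0 \<inter> c i)}")
    case True
    then obtain i0 where i0: "i0 \<in> J" "infinite {i\<in>J. i \<noteq> i0 \<and> Rk SS j (X \<inter> c i0 \<inter> c i)}" by blast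
    let ?J = "{i\<in>J. i \<noteq> i0 \<and> Rk SS j (X \<inter> c i0 \<inter> c i)}"
    have "Rk SS (Suc j) (X \<inter> c i0)"
    proof (rule Suc.IH[of ?J])
      fix I assume I: "I \<subseteq> ?J" "finite I" "card I = k"
      then have "i0 \<notin> I" "insert i0 I \<subseteq> J" using i0(1) by blast+
      then have "X \<inter> (\<Inter>i\<in>insert i0 I. c i) = {}" using I(2,3) by (intro Suc.prems(4)) auto
      then show "X \<inter> c i0 \<inter> (\<Inter>i\<in>I. c i) = {}" by blast
    qed (use i0 Suc.prems(2) in auto)
    then show ?thesis by (rule Rk_mono) blast
  next
    case False
    have "rk SS m (Suc j) t (X - (\<Union>g\<in>G. c g))" if "finite G" "G \<subseteq> J" for m t G
      using that
    proof (induction t arbitrary: G)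
      case (Suc t)
      \<comment> \<open>Besides \<open>G\<close> this excludes the indices \<open>i\<close> for
        which \<open>X \<inter> c i\<close> has large intersection with some earlier
        \<open>c g\<close>; there are finitely many. For any other \<open>i\<close> the part of
        \<open>X \<inter> c i\<close> covered by the earlier sets has small rank, so by
        \<open>Rk_union\<close> the remainder has rank \<open>j\<close>.\<close>
      let ?B = "G \<union> (\<Union>g\<in>G. {i\<in>J. i \<noteq> g \<and> Rk SS j (X \<inter> c g \<inter> c i)})"
      have "finite ?B" using False Suc.prems by auto
      then obtain i where i: "i \<in> J" "i \<notin> ?B" using \<open>infinite J\<close> by (meson finite_subset subsetI)
      let ?X = "X - (\<Union>g\<in>G. c g)"
      have "Rk SS j (X \<inter> c i)" by (rule JRk[OF i(1)])
      moreover have "X \<inter> c i = (?X \<inter> c i) \<union> (X \<inter> c i - ?X)" by blast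
      ultimately have "Rk SS j (?X \<inter> c i) \<or> Rk SS j (X \<inter> c i - ?X)" using Rk_union by metis
      moreover have "\<not> Rk SS j (X \<inter> c i - ?X)"
      proof
        assume r: "Rk SS j (X \<inter> c i - ?X)"
        have "X \<inter> c i - ?X \<subseteq> (\<Union>g\<in>G. c g)" by blast
        from Rk_UN[OF Suc.prems(1) r this] obtain g where g: "g \<in> G" "Rk SS j ((X \<inter> c i - ?X) \<inter> c g)" by blast
        from g(2) have "Rk SS j (X \<inter> c g \<inter> c i)" by (rule Rk_mono) blast
        then show False using i g(1) by blast
      qed
      ultimately have "Rk SS j (?X \<inter> c i)" by blast
      then have "rk SS m j m (?X \<inter> c i)" by (simp add: Rk_def)
      moreover have "rk SS m (Suc j) t (X - (\<Union>g\<in>insert i G. c g))" by (rule Suc.IH) (use Suc.prems i in auto)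
      moreover have "X - (\<Union>g\<in>insert i G. c g) = ?X - c i" by blast
      ultimately show ?case using JSS[OF i(1)] by auto
    qed simp
    from this[of "{}"] show ?thesis by (simp add: Rk_def)
  qed
qed

section \<open>Binary trees of splittings (Shelah's 2-rank) and their Ramsey property\<close>

fun bt :: "'x set set \<Rightarrow> nat \<Rightarrow> 'x set \<Rightarrow> bool" where
  "bt SS 0 X \<longleftrightarrow> X \<noteq> {}"
| "bt SS (Suc h) X \<longleftrightarrow> (\<exists>S\<in>SS. bt SS h (X \<inter> S) \<and> bt SS h (X - S))"

lemma bt_mono: "bt SS h X \<Longrightarrow> X \<subseteq> Y \<Longrightarrow> bt SS h Y"
proof (induction h arbitrary: X Y)
  case (Suc h)
  then obtain S where S: "S \<in> SS" "bt SS h (X \<inter> S)" "bt SS h (X - S)" by auto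
  have "X \<inter> S \<subseteq> Y \<inter> S" "X - S \<subseteq> Y - S" using Suc.prems(2) by blast+
  then show ?case using S Suc.IH by (meson bt.simps(2))
qed auto

lemma bt_nonempty: "bt SS h X \<Longrightarrow> X \<noteq> {}"
proof (induction h arbitrary: X)
  case (Suc h)
  then obtain S where "bt SS h (X \<inter> S)" by auto
  from Suc.IH[OF this] show ?case by blast
qed simp

text \<open>Width 2 is enough: the second member is applied to \<open>X - S\<close>, so the two
  parts of rank \<open>j\<close> lie on different sides of the first member
  \<open>S\<close>.\<close>

lemma rk_bt: "rk SS 2 j 2 X \<Longrightarrow> bt SS j X"
proof (induction j arbitrary: X)
  case (Suc j)
  then obtain S S' where S: "S \<in> SS" "rk SS 2 j 2 (X \<inter> S)" "rk SS 2 j 2 ((X - S) \<inter> S')"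
    by (auto simp: numeral_2_eq_2)
  have "rk SS 2 j 2 (X - S)" using S(3) by (rule rk_mono) blast
  then show ?case using S(1,2) Suc.IH by auto
qed simp

text \<open>If the label of the root is in \<open>S1\<close>, each subtree has height (n - 1) + m:
  either one of them yields a tree of height \<open>m\<close> with labels in \<open>S2\<close>, or
  both yield trees of height n - 1 with labels in \<open>S1\<close>, which the root joins. The other
  case is symmetric.\<close>

lemma bt_Ramsey: "bt (S1 \<union> S2) k X \<Longrightarrow> k = n + m \<Longrightarrow> bt S1 n X \<or> bt S2 m X"
proof (induction k arbitrary: n m X)
  case (Suc k)
  note ne = bt_nonempty[OF Suc.prems(1)]
  show ?case
  proof (cases "n = 0 \<or> m = 0")
    case True
    then show ?thesis using ne by auto
  next
    case False
    then obtain n' m' where nm: "n = Suc n'" "m = Suc m'" by (metis not0_implies_Suc)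
    obtain S where S: "S \<in> S1 \<union> S2" "bt (S1 \<union> S2) k (X \<inter> S)" "bt (S1 \<union> S2) k (X - S)"
      using Suc.prems(1) by auto
    have k: "k = n' + m" "k = n + m'" using Suc.prems(2) nm by auto
    have up: "bt SS h X" if "bt SS h (X \<inter> S) \<or> bt SS h (X - S)" for SS h
      using that bt_mono[of SS h _ X] by blast
    from S(1) show ?thesis
    proof
      assume "S \<in> S1"
      then show ?thesis using Suc.IH[OF S(2) k(1)] Suc.IH[OF S(3) k(1)] up nm by (metis bt.simps(2))
    next
      assume "S \<in> S2"
      then show ?thesis using Suc.IH[OF S(2) k(2)] Suc.IH[OF S(3) k(2)] up nm by (metis bt.simps(2))
    qed
  qed
qed simp

lemma bt_finite_UN:
  assumes "finite I" "\<And>h. bt (\<Union>i\<in>I. SS i) h X"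
  shows "\<exists>i\<in>I. \<forall>h. bt (SS i) h X"
  using assms
proof (induction I rule: finite_induct)
  case empty
  from empty[of "Suc 0"] show ?case by simp
next
  case (insert i I)
  show ?case
  proof (cases "\<forall>h. bt (SS i) h X")
    case False
    then obtain n where n: "\<not> bt (SS i) n X" by blast
    have "bt (\<Union>i\<in>I. SS i) m X" for m
      using bt_Ramsey[of "SS i" "\<Union>i\<in>I. SS i" "n + m" X n m] insert.prems[of "n + m"] n by auto
    then show ?thesis using insert.IH by blast
  qed blast
qed

text \<open>The levels are indexed by \<open>I\<close>, a path is coded by an arbitrary set
  \<open>g\<close>, and the label at level \<open>i\<close> depends only on the part of
  \<open>g\<close> below \<open>i\<close>. So finitely many levels of a tree that is much longer are
  served by one finite tree. The least element of \<open>I\<close> becomes the root level.\<close>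

lemma bt_tree:
  assumes r: "Well_order r" and "finite I" "I \<subseteq> Field r" "bt SS (card I) X"
  shows "\<exists>c b. (\<forall>i\<in>I. \<forall>g. c i g \<in> SS) \<and>
    (\<forall>g. b g \<in> X \<and> (\<forall>i\<in>I. b g \<in> c i (g \<inter> underS r i) \<longleftrightarrow> i \<in> g))"
  using assms(2-)
proof (induction "card I" arbitrary: I X)
  case 0
  then obtain x where "x \<in> X" "I = {}" by auto
  then show ?case by (intro exI[of _ "\<lambda>_ _. undefined"] exI[of _ "\<lambda>_. x"]) auto
next
  case (Suc h)
  have wo: "wo_rel r" using r by (simp add: wo_rel_def)
  have ne: "I \<noteq> {}" using Suc by auto
  define i0 where "i0 = wo_rel.minim r I"
  have i0: "i0 \<in> I" "\<And>i. i \<in> I \<Longrightarrow> (i0, i) \<in> r"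
    using wo_rel.minim_in[OF wo Suc.prems(2) ne] wo_rel.minim_least[OF wo Suc.prems(2)] by (auto simp: i0_def)
  then have us: "i0 \<in> underS r i" if "i \<in> I - {i0}" for i using that by (auto simp: underS_def)
  let ?I = "I - {i0}"
  have cI: "card ?I = h" using Suc i0 by simp
  obtain S where S: "S \<in> SS" "bt SS h (X \<inter> S)" "bt SS h (X - S)" using Suc by (metis bt.simps(2))
  have "\<exists>c b. (\<forall>i\<in>?I. \<forall>g. c i g \<in> SS) \<and>
    (\<forall>g. b g \<in> X \<inter> S \<and> (\<forall>i\<in>?I. b g \<in> c i (g \<inter> underS r i) \<longleftrightarrow> i \<in> g))"
    by (rule Suc.hyps(1)) (use Suc.prems cI S in auto)
  then obtain c1 b1 where c1: "\<forall>i\<in>?I. \<forall>g. c1 i g \<in> SS"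
    and b1: "\<forall>g. b1 g \<in> X \<inter> S \<and> (\<forall>i\<in>?I. b1 g \<in> c1 i (g \<inter> underS r i) \<longleftrightarrow> i \<in> g)"
    by (elim exE conjE)
  have "\<exists>c b. (\<forall>i\<in>?I. \<forall>g. c i g \<in> SS) \<and>
    (\<forall>g. b g \<in> X - S \<and> (\<forall>i\<in>?I. b g \<in> c i (g \<inter> underS r i) \<longleftrightarrow> i \<in> g))"
    by (rule Suc.hyps(1)) (use Suc.prems cI S in auto)
  then obtain c2 b2 where c2: "\<forall>i\<in>?I. \<forall>g. c2 i g \<in> SS"
    and b2: "\<forall>g. b2 g \<in> X - S \<and> (\<forall>i\<in>?I. b2 g \<in> c2 i (g \<inter> underS r i) \<longleftrightarrow> i \<in> g)"
    by (elim exE conjE)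
  define c where "c i g = (if i = i0 then S else if i0 \<in> g then c1 i g else c2 i g)" for i g
  define b where "b g = (if i0 \<in> g then b1 g else b2 g)" for g
  have "\<forall>i\<in>I. \<forall>g. c i g \<in> SS" using c1 c2 S(1) by (simp add: c_def)
  moreover have "b g \<in> X" for g using b1[rule_format, of g] b2[rule_format, of g] by (simp add: b_def)
  moreover have "b g \<in> c i (g \<inter> underS r i) \<longleftrightarrow> i \<in> g" if i: "i \<in> I" for g i
  proof (cases "i = i0")
    case True
    then show ?thesis using b1[rule_format, of g] b2[rule_format, of g] by (simp add: b_def c_def)
  next
    case False
    then have "i \<in> ?I" using i by blast
    then show ?thesis using b1[rule_format, of g] b2[rule_format, of g] us[of i] by (simp add: b_def c_def)
  qed
  ultimately show ?case by (intro exI[of _ c] exI[of _ b]) simp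
qed

section \<open>Counting types in stable theories\<close>

text \<open>Every formula whose variables are assigned to the coordinates of an \<open>n\<close>-tuple or to parameters
  can be brought into the normal form of \<^const>\<open>pfmls\<close>.\<close>

lemma pack:
  fixes c :: "nat \<Rightarrow> nat + 'a" and L :: "('f, 'r) lang"
  assumes "fm_in L \<phi>" and c: "\<And>v. v \<in> fv \<phi> \<Longrightarrow> c v \<in> Inl ` {..<n} \<union> Inr ` A"
  shows "\<exists>\<phi>' b. (\<phi>', b) \<in> pfmls L n A \<and>
    (\<forall>(N :: ('f, 'r, 'a) struct) x g. length x = n \<longrightarrow>
       sat N (\<lambda>i. (x @ map g b) ! i) \<phi>' = sat N (\<lambda>v. case c v of Inl j \<Rightarrow> x ! j | Inr u \<Rightarrow> g u) \<phi>)"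
proof -
  obtain m where m: "\<And>v. v \<in> fv \<phi> \<Longrightarrow> v < m" using finite_nat_set_iff_bounded[of "fv \<phi>"] by auto
  define vs where "vs = filter (\<lambda>v. v \<in> fv \<phi> \<and> c v \<in> Inr ` A) [0..<m]"
  define b where "b = map (\<lambda>v. projr (c v)) vs"
  define ix where "ix v = (SOME i. i < length vs \<and> vs ! i = v)" for v
  define \<rho> where "\<rho> v = (case c v of Inl j \<Rightarrow> j | Inr u \<Rightarrow> n + ix v)" for v
  have ix: "ix v < length vs \<and> vs ! ix v = v" if "v \<in> fv \<phi>" "c v \<in> Inr ` A" for v
  proof -
    have "v \<in> set vs" using that m by (auto simp: vs_def)
    then have "\<exists>i. i < length vs \<and> vs ! i = v" by (simp add: in_set_conv_nth)
    then show ?thesis unfolding ix_def by (rule someI_ex)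
  qed
  obtain \<phi>' where p: "fm_in L \<phi>'" "fv \<phi>' = \<rho> ` fv \<phi>"
     "\<And>(N :: ('f, 'r, 'a) struct) e. sat N e \<phi>' = sat N (e \<circ> \<rho>) \<phi>" using fm_rename[of L \<phi> \<rho>] assms(1) by blast
  have "\<rho> v < n + length b" if "v \<in> fv \<phi>" for v
    using c[OF that] ix[OF that] by (auto simp: \<rho>_def b_def)
  moreover have "set b \<subseteq> A" by (auto simp: b_def vs_def)
  ultimately have "(\<phi>', b) \<in> pfmls L n A" using p(1,2) by (auto simp: pfmls_def)
  moreover have "sat N (\<lambda>i. (x @ map g b) ! i) \<phi>' = sat N (\<lambda>v. case c v of Inl j \<Rightarrow> x ! j | Inr u \<Rightarrow> g u) \<phi>"
    if "length x = n" for N :: "('f, 'r, 'a) struct" and x g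
    unfolding p(3)
  proof (rule sat_cong)
    fix v assume v: "v \<in> fv \<phi>"
    from c[OF v] show "((\<lambda>i. (x @ map g b) ! i) \<circ> \<rho>) v = (case c v of Inl j \<Rightarrow> x ! j | Inr u \<Rightarrow> g u)"
    proof
      assume "c v \<in> Inl ` {..<n}"
      then show ?thesis using that by (auto simp: \<rho>_def nth_append)
    next
      assume "c v \<in> Inr ` A"
      then show ?thesis using ix[OF v] that by (auto simp: \<rho>_def nth_append b_def)
    qed
  qed
  ultimately show ?thesis by (intro exI[of _ \<phi>'] exI[of _ b]) simp
qed

text \<open>Equality of the types of two \<open>n\<close>-tuples over \<open>A\<close>, phrased with
  assignments instead of \<open>pfmls\<close>, so that it applies to every formula and, through
  \<open>dfn_tpeq\<close>, to every definable predicate.\<close>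

definition tpeq :: "('f, 'r) lang \<Rightarrow> ('f, 'r, 'a) struct \<Rightarrow> 'a set \<Rightarrow> nat \<Rightarrow> (nat \<Rightarrow> 'a) \<Rightarrow> (nat \<Rightarrow> 'a) \<Rightarrow> bool" where
  "tpeq L N A n x y \<longleftrightarrow> (\<forall>\<phi> e e'. fm_in L \<phi> \<and>
     (\<forall>v\<in>fv \<phi>. (\<exists>j<n. e v = x j \<and> e' v = y j) \<or> e v = e' v \<and> e v \<in> A) \<longrightarrow> sat N e \<phi> = sat N e' \<phi>)"

lemma tpeqD:
  "tpeq L N A n x y \<Longrightarrow> fm_in L \<phi> \<Longrightarrow>
    (\<And>v. v \<in> fv \<phi> \<Longrightarrow> (\<exists>j<n. e v = x j \<and> e' v = y j) \<or> e v = e' v \<and> e v \<in> A) \<Longrightarrow> sat N e \<phi> = sat N e' \<phi>"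
  unfolding tpeq_def by blast

lemma tpeq_refl: "tpeq L N A n x x"
  unfolding tpeq_def by (intro allI impI sat_cong) auto

lemma tpeq_sym:
  assumes "tpeq L N A n x y" shows "tpeq L N A n y x"
  unfolding tpeq_def
proof (intro allI impI, elim conjE)
  fix \<phi> e e'
  assume "fm_in L \<phi>" and "\<forall>v\<in>fv \<phi>. (\<exists>j<n. e v = y j \<and> e' v = x j) \<or> e v = e' v \<and> e v \<in> A"
  then have "sat N e' \<phi> = sat N e \<phi>" by (intro tpeqD[OF assms]) auto
  then show "sat N e \<phi> = sat N e' \<phi>" by simp
qed

lemma tpeq_trans:
  assumes "tpeq L N A n x y" "tpeq L N A n y z" shows "tpeq L N A n x z"
  unfolding tpeq_def
proof (intro allI impI, elim conjE)
  fix \<phi> e e'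
  assume f: "fm_in L \<phi>" and e: "\<forall>v\<in>fv \<phi>. (\<exists>j<n. e v = x j \<and> e' v = z j) \<or> e v = e' v \<and> e v \<in> A"
  \<comment> \<open>The assignment in between: a variable may read several coordinates, so one index
    is picked for it.\<close>
  define d where "d v = (if \<exists>j<n. e v = x j \<and> e' v = z j then y (SOME j. j < n \<and> e v = x j \<and> e' v = z j) else e v)" for v
  have d: "(\<exists>j<n. e v = x j \<and> d v = y j \<and> e' v = z j) \<or> d v = e v \<and> e v = e' v \<and> e v \<in> A" if "v \<in> fv \<phi>" for v
  proof (cases "\<exists>j<n. e v = x j \<and> e' v = z j")
    case True
    from someI_ex[OF this] show ?thesis using True unfolding d_def by auto
  next
    case False
    then have "d v = e v" unfolding d_def by (rule if_not_P)
    then show ?thesis using False e that by auto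
  qed
  have "sat N e \<phi> = sat N d \<phi>" by (rule tpeqD[OF assms(1) f]) (use d in fastforce)
  also have "\<dots> = sat N e' \<phi>" by (rule tpeqD[OF assms(2) f]) (use d in fastforce)
  finally show "sat N e \<phi> = sat N e' \<phi>" .
qed

lemma dfn_tpeq:
  assumes "dfn L W R" "tpeq L N A n x y" "is_struct L N" "range e \<subseteq> univ N" "range e' \<subseteq> univ N"
    "\<And>w. w \<in> W \<Longrightarrow> (\<exists>j<n. e w = x j \<and> e' w = y j) \<or> e w = e' w \<and> e w \<in> A"
  shows "R N e = R N e'"
proof -
  obtain \<phi> \<sigma> where "dfn_by L W R \<phi> \<sigma>" using assms(1) by (rule dfnE)
  note d = dfn_byD[OF this]
  have "sat N (e \<circ> \<sigma>) \<phi> = sat N (e' \<circ> \<sigma>) \<phi>"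
    by (rule tpeqD[OF assms(2) d(1)]) (use d(2) assms(6) in auto)
  then show ?thesis using d(3)[OF assms(3,4)] d(3)[OF assms(3,5)] by simp
qed

lemma tpeq_eq:
  assumes "tpeq L N A n x y" "j < n"
  shows "i < n \<Longrightarrow> x i = x j \<longleftrightarrow> y i = y j" "u \<in> A \<Longrightarrow> x j = u \<longleftrightarrow> y j = u"
proof -
  assume "i < n"
  then have "sat N (\<lambda>v. if v = 0 then x i else x j) (Eq (Var 0) (Var 1)) =
      sat N (\<lambda>v. if v = 0 then y i else y j) (Eq (Var 0) (Var 1))"
    using assms(2) by (intro tpeqD[OF assms(1)]) auto
  then show "x i = x j \<longleftrightarrow> y i = y j" by simp
next
  assume "u \<in> A"
  then have "sat N (\<lambda>v. if v = 0 then x j else u) (Eq (Var 0) (Var 1)) =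
      sat N (\<lambda>v. if v = 0 then y j else u) (Eq (Var 0) (Var 1))"
    using assms(2) by (intro tpeqD[OF assms(1)]) auto
  then show "x j = u \<longleftrightarrow> y j = u" by simp
qed

text \<open>The type of \<open>z\<close> over the image of \<open>B\<close> under \<open>g\<close>,
  pulled back to parameters in \<open>B\<close>. Tuples with the same representative thus give types
  over one common set, where stability counts them.\<close>

definition shift_tp ::
  "('f, 'r) lang \<Rightarrow> ('f, 'r, 'a) struct \<Rightarrow> 'a set \<Rightarrow> ('a \<Rightarrow> 'a) \<Rightarrow> 'a \<Rightarrow> (('f, 'r) fm \<times> 'a list) set" where
  "shift_tp L N B g z = {(\<phi>, b). (\<phi>, b) \<in> pfmls L 1 B \<and> sat N (\<lambda>i. ([z] @ map g b) ! i) \<phi>}"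

text \<open>Finite satisfiability: that some element satisfies the finitely many formulas of
  \<open>q\<close> is a definable condition on the parameters. With the parameters read through
  \<open>g\<close> it holds, witnessed by \<open>z\<close>; as \<open>x\<close> and \<open>r\<close>
  have the same type over \<open>A\<close>, it also holds for the parameters themselves.\<close>

lemma complete_shift_tp:
  fixes N :: "('f, 'r, 'a) struct"
  assumes N: "is_struct L N" and x: "range x \<subseteq> univ N" "range r \<subseteq> univ N" and A: "A \<subseteq> univ N"
    and xr: "tpeq L N A n x r"
    and g: "\<And>j. j < n \<Longrightarrow> g (r j) = x j" "\<And>u. u \<in> A \<Longrightarrow> g u = u"
    and z: "z \<in> univ N"
  shows "complete_type L N 1 (A \<union> r ` {..<n}) (shift_tp L N (A \<union> r ` {..<n}) g z)"
    (is "complete_type L N 1 ?B ?p")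
  unfolding complete_type_def
proof (intro conjI allI impI)
  show "?p \<subseteq> pfmls L 1 ?B" by (auto simp: shift_tp_def)
  show "\<forall>(\<phi>, b)\<in>pfmls L 1 ?B. (\<phi>, b) \<in> ?p \<or> (Neg \<phi>, b) \<in> ?p"
    by (auto simp: shift_tp_def pfmls_def)
next
  fix q assume q: "finite q \<and> q \<subseteq> ?p"
  define \<tau> where "\<tau> b i = (if i = 0 then None else Some (b ! (i - 1)))" for b :: "'a list" and i :: nat
  let ?R = "\<lambda>(M :: ('f, 'r, 'a) struct) e. \<forall>\<psi>\<in>q. sat M (e \<circ> \<tau> (snd \<psi>)) (fst \<psi>)"
  have "dfn L (insert None (Some ` ?B)) ?R"
  proof (rule dfn_ball)
    fix \<psi> assume "\<psi> \<in> q"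
    then have "(fst \<psi>, snd \<psi>) \<in> pfmls L 1 ?B" using q by (auto simp: shift_tp_def)
    then show "dfn L (insert None (Some ` ?B)) (\<lambda>M e. sat M (e \<circ> \<tau> (snd \<psi>)) (fst \<psi>))"
      by (intro dfn_base) (auto simp: pfmls_def \<tau>_def)
  qed (use q in simp)
  from dfn_ex[OF this, of "{None}"]
  have "dfn L (Some ` ?B) (\<lambda>M. ex_on M {None} (?R M))" by (rule dfn_mono) auto
  note d = this
  define e1 where "e1 w = (case w of None \<Rightarrow> z | Some u \<Rightarrow> if u \<in> ?B then g u else z)" for w
  define e2 where "e2 w = (case w of None \<Rightarrow> z | Some u \<Rightarrow> if u \<in> ?B then u else z)" for w
  have "g u \<in> univ N" if "u \<in> ?B" for u using that g x(1) A by auto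
  then have e1: "range e1 \<subseteq> univ N" using z by (auto simp: e1_def split: option.splits)
  have "u \<in> univ N" if "u \<in> ?B" for u using that x(2) A by auto
  then have e2: "range e2 \<subseteq> univ N" using z by (auto simp: e2_def split: option.splits)
  have qp: "(fst \<psi>, snd \<psi>) \<in> ?p" if "\<psi> \<in> q" for \<psi> using q that by auto
  have len: "i < Suc (length (snd \<psi>))" if "\<psi> \<in> q" "i \<in> fv (fst \<psi>)" for \<psi> i
    using qp[OF that(1)] that(2) by (auto simp: shift_tp_def pfmls_def)
  have setb: "set (snd \<psi>) \<subseteq> ?B" if "\<psi> \<in> q" for \<psi>
    using qp[OF that] by (auto simp: shift_tp_def pfmls_def)
  have "ex_on N {None} (?R N) e1"
  proof -
    have "?R N e1"
    proof
      fix \<psi> assume \<psi>: "\<psi> \<in> q"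
      have "sat N (e1 \<circ> \<tau> (snd \<psi>)) (fst \<psi>) = sat N (\<lambda>i. ([z] @ map g (snd \<psi>)) ! i) (fst \<psi>)"
      proof (rule sat_cong)
        fix i assume "i \<in> fv (fst \<psi>)"
        then have "i < Suc (length (snd \<psi>))" by (rule len[OF \<psi>])
        then show "(e1 \<circ> \<tau> (snd \<psi>)) i = ([z] @ map g (snd \<psi>)) ! i"
          using setb[OF \<psi>] by (cases i) (auto simp: e1_def \<tau>_def subset_iff)
      qed
      then show "sat N (e1 \<circ> \<tau> (snd \<psi>)) (fst \<psi>)" using qp[OF \<psi>] by (simp add: shift_tp_def split_beta)
    qed
    then show ?thesis unfolding ex_on_def using e1 by (intro exI[of _ e1]) simp
  qed
  moreover have "ex_on N {None} (?R N) e1 = ex_on N {None} (?R N) e2"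
  proof (rule dfn_tpeq[OF d xr N e1 e2])
    fix w assume "w \<in> Some ` ?B"
    then show "(\<exists>j<n. e1 w = x j \<and> e2 w = r j) \<or> e1 w = e2 w \<and> e1 w \<in> A"
      using g by (auto simp: e1_def e2_def)
  qed
  ultimately obtain e' where e': "range e' \<subseteq> univ N" "\<And>w. w \<notin> {None} \<Longrightarrow> e' w = e2 w" "?R N e'"
    unfolding ex_on_def by auto
  have "psat N [e' None] \<psi>" if \<psi>: "\<psi> \<in> q" for \<psi>
  proof -
    have "sat N (e' \<circ> \<tau> (snd \<psi>)) (fst \<psi>) = sat N (\<lambda>i. ([e' None] @ snd \<psi>) ! i) (fst \<psi>)"
    proof (rule sat_cong)
      fix i assume "i \<in> fv (fst \<psi>)"
      then have "i < Suc (length (snd \<psi>))" by (rule len[OF \<psi>])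
      then show "(e' \<circ> \<tau> (snd \<psi>)) i = ([e' None] @ snd \<psi>) ! i"
        using setb[OF \<psi>] e'(2) by (cases i) (auto simp: e2_def \<tau>_def subset_iff)
    qed
    then show ?thesis using e'(3) \<psi> by (simp add: psat_def split_beta)
  qed
  moreover have "[e' None] \<in> tuples N 1" using e'(1) by (auto simp: tuples_def)
  ultimately show "\<exists>x\<in>tuples N 1. \<forall>\<psi>\<in>q. psat N x \<psi>" by blast
qed

text \<open>By \<open>pack\<close>, a formula about the first \<open>n + 1\<close> coordinates and
  elements of \<open>A\<close> becomes one about the last coordinate with parameters from
  \<open>A\<close> and \<open>r\<close>; reading these through \<open>g\<close> or \<open>g'\<close>
  gives back the coordinates of \<open>x\<close> or \<open>y\<close>.\<close>

lemma shift_tp_inj: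
  fixes N :: "('f, 'r, 'a) struct"
  assumes g: "\<And>j. j < n \<Longrightarrow> g (r j) = x j" "\<And>u. u \<in> A \<Longrightarrow> g u = u"
    and g': "\<And>j. j < n \<Longrightarrow> g' (r j) = y j" "\<And>u. u \<in> A \<Longrightarrow> g' u = u"
    and eq: "shift_tp L N (A \<union> r ` {..<n}) g (x n) = shift_tp L N (A \<union> r ` {..<n}) g' (y n)"
  shows "tpeq L N A (Suc n) x y"
  unfolding tpeq_def
proof (intro allI impI, elim conjE)
  let ?B = "A \<union> r ` {..<n}"
  fix \<phi> e e'
  assume f: "fm_in L \<phi>" and e: "\<forall>v\<in>fv \<phi>. (\<exists>j<Suc n. e v = x j \<and> e' v = y j) \<or> e v = e' v \<and> e v \<in> A"
  have "\<forall>v\<in>fv \<phi>. \<exists>w. w \<in> Inl ` {..<1} \<union> Inr ` ?B \<and>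
     e v = (case w of Inl j \<Rightarrow> [x n] ! j | Inr u \<Rightarrow> g u) \<and> e' v = (case w of Inl j \<Rightarrow> [y n] ! j | Inr u \<Rightarrow> g' u)"
  proof
    fix v assume "v \<in> fv \<phi>"
    then consider "e v = x n" "e' v = y n" | j where "j < n" "e v = x j" "e' v = y j" | "e v = e' v" "e v \<in> A"
      using e less_Suc_eq by auto
    then show "\<exists>w. w \<in> Inl ` {..<1} \<union> Inr ` ?B \<and>
       e v = (case w of Inl j \<Rightarrow> [x n] ! j | Inr u \<Rightarrow> g u) \<and> e' v = (case w of Inl j \<Rightarrow> [y n] ! j | Inr u \<Rightarrow> g' u)"
    proof cases
      case 1 then show ?thesis by (intro exI[of _ "Inl 0"]) auto
    next
      case (2 j) then show ?thesis using g(1) g'(1) by (intro exI[of _ "Inr (r j)"]) auto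
    next
      case 3 then show ?thesis using g(2) g'(2) by (intro exI[of _ "Inr (e v)"]) auto
    qed
  qed
  from bchoice[OF this] obtain c where c: "\<forall>v\<in>fv \<phi>. c v \<in> Inl ` {..<1} \<union> Inr ` ?B \<and>
     e v = (case c v of Inl j \<Rightarrow> [x n] ! j | Inr u \<Rightarrow> g u) \<and> e' v = (case c v of Inl j \<Rightarrow> [y n] ! j | Inr u \<Rightarrow> g' u)"
    by (elim exE)
  have "\<exists>\<phi>' b. (\<phi>', b) \<in> pfmls L 1 ?B \<and>
    (\<forall>(N :: ('f, 'r, 'a) struct) x g. length x = 1 \<longrightarrow>
       sat N (\<lambda>i. (x @ map g b) ! i) \<phi>' = sat N (\<lambda>v. case c v of Inl j \<Rightarrow> x ! j | Inr u \<Rightarrow> g u) \<phi>)"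
    by (rule pack[OF f]) (use c in simp)
  then obtain \<phi>' b where b: "(\<phi>', b) \<in> pfmls L 1 ?B"
    "\<forall>(N :: ('f, 'r, 'a) struct) x g. length x = 1 \<longrightarrow>
       sat N (\<lambda>i. (x @ map g b) ! i) \<phi>' = sat N (\<lambda>v. case c v of Inl j \<Rightarrow> x ! j | Inr u \<Rightarrow> g u) \<phi>"
    by (elim exE conjE)
  have "sat N e \<phi> = sat N (\<lambda>v. case c v of Inl j \<Rightarrow> [x n] ! j | Inr u \<Rightarrow> g u) \<phi>"
    by (rule sat_cong) (use c in simp)
  also have "\<dots> = sat N (\<lambda>i. ([x n] @ map g b) ! i) \<phi>'" using b(2)[rule_format, of "[x n]" N g] by simp
  also have "\<dots> \<longleftrightarrow> (\<phi>', b) \<in> shift_tp L N ?B g (x n)" using b(1) by (simp add: shift_tp_def)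
  also have "\<dots> \<longleftrightarrow> (\<phi>', b) \<in> shift_tp L N ?B g' (y n)" using eq by simp
  also have "\<dots> \<longleftrightarrow> sat N (\<lambda>i. ([y n] @ map g' b) ! i) \<phi>'" using b(1) by (simp add: shift_tp_def)
  also have "\<dots> = sat N (\<lambda>v. case c v of Inl j \<Rightarrow> [y n] ! j | Inr u \<Rightarrow> g' u) \<phi>" using b(2)[rule_format, of "[y n]" N g'] by simp
  also have "\<dots> = sat N e' \<phi>" by (rule sat_cong) (use c in simp)
  finally show "sat N e \<phi> = sat N e' \<phi>" .
qed

text \<open>\<^const>\<open>stable_in\<close> only bounds the number of \<open>1\<close>-types. Replacing the first \<open>n\<close> coordinates of an
  \<open>(n + 1)\<close>-tuple by a representative of their type turns the last coordinate into a \<open>1\<close>-type.\<close>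

lemma stable_tuples:
  fixes N :: "('f, 'r, 'a) struct" and lambda :: "'a rel"
  assumes N: "is_model L T N" and st: "stable_in L T lambda" and l: "Card_order lambda" "infinite (Field lambda)"
    and A: "A \<subseteq> univ N" "|A| \<le>o lambda"
    and Y: "\<And>x. x \<in> Y \<Longrightarrow> range x \<subseteq> univ N" "\<And>x y. x \<in> Y \<Longrightarrow> y \<in> Y \<Longrightarrow> tpeq L N A n x y \<Longrightarrow> x = y"
  shows "|Y| \<le>o lambda"
  using Y
proof (induction n arbitrary: Y)
  case 0
  have "tpeq L N A 0 x y" for x y unfolding tpeq_def by (intro allI impI sat_cong) auto
  then have "x = y" if "x \<in> Y" "y \<in> Y" for x y using 0 that by blast
  then have "Y = {} \<or> (\<exists>x. Y = {x})" by blast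
  then have "finite Y" by auto
  then show ?case using l by (intro ordLess_imp_ordLeq finite_ordLess_infinite)
    (auto simp: Field_card_of card_of_Well_order card_of_well_order_on card_order_on_def)
next
  case (Suc n)
  have Ns: "is_struct L N" using N by (simp add: is_model_def)
  define rep where "rep x = (SOME y. y \<in> Y \<and> tpeq L N A n x y)" for x
  have rep: "rep x \<in> Y \<and> tpeq L N A n x (rep x)" if "x \<in> Y" for x
    unfolding rep_def by (rule someI[of _ x]) (simp add: that tpeq_refl)
  have rep_eq: "rep x = rep y" if "tpeq L N A n x y" for x y
  proof -
    have "tpeq L N A n x z \<longleftrightarrow> tpeq L N A n y z" for z using that tpeq_sym tpeq_trans by metis
    then show ?thesis by (simp add: rep_def)
  qed
  have R: "|rep ` Y| \<le>o lambda"
  proof (rule Suc.IH)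
    show "range x \<subseteq> univ N" if "x \<in> rep ` Y" for x using that rep Suc.prems(1) by blast
  next
    fix x y assume xy: "x \<in> rep ` Y" "y \<in> rep ` Y" "tpeq L N A n x y"
    obtain x' y' where x': "x' \<in> Y" "x = rep x'" and y': "y' \<in> Y" "y = rep y'" using xy by blast
    have "tpeq L N A n x' x" using rep[OF x'(1)] x'(2) by simp
    moreover have "tpeq L N A n y y'" using rep[OF y'(1)] y'(2) by (simp add: tpeq_sym)
    ultimately have "tpeq L N A n x' y'" using xy(3) tpeq_trans by metis
    then show "x = y" using rep_eq x' y' by simp
  qed
  define B where "B r = A \<union> r ` {..<n}" for r
  \<comment> \<open>Sends \<open>rep x\<close> to \<open>x\<close> and fixes \<open>A\<close>. This
    is consistent because \<open>x\<close> and \<open>rep x\<close> satisfy the same equations among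
    their coordinates and with elements of \<open>A\<close>.\<close>
  define g where "g x u = (if u \<in> A then u else x (SOME j. j < n \<and> rep x j = u))" for x u
  have g1: "g x (rep x j) = x j" if "x \<in> Y" "j < n" for x j
  proof (cases "rep x j \<in> A")
    case True
    have "x j = rep x j \<longleftrightarrow> rep x j = rep x j" by (rule tpeq_eq(2)[OF _ that(2) True]) (use rep that in blast)
    then show ?thesis using True by (simp add: g_def)
  next
    case False
    let ?i = "SOME i. i < n \<and> rep x i = rep x j"
    have i: "?i < n \<and> rep x ?i = rep x j" by (rule someI[of _ j]) (simp add: that)
    have "x ?i = x j \<longleftrightarrow> rep x ?i = rep x j" by (rule tpeq_eq(1)[OF _ that(2)]) (use rep that i in blast)+
    then show ?thesis using i False by (simp add: g_def)
  qed
  have g2: "g x u = u" if "u \<in> A" for x u using that by (simp add: g_def)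
  define p where "p x = shift_tp L N (B (rep x)) (g x) (x n)" for x
  have "complete_type L N 1 (B (rep x)) (p x)" if x: "x \<in> Y" for x
    unfolding p_def B_def
  proof (rule complete_shift_tp[OF Ns _ _ A(1)])
    show "range x \<subseteq> univ N" "range (rep x) \<subseteq> univ N" using Suc.prems(1) rep x by blast+
    then show "x n \<in> univ N" by blast
  qed (use rep g1 g2 x in blast)+
  then have im: "(\<lambda>x. (rep x, p x)) ` Y \<subseteq> (SIGMA r:rep ` Y. {p. complete_type L N 1 (B r) p})" by auto
  have inj: "inj_on (\<lambda>x. (rep x, p x)) Y"
  proof (rule inj_onI)
    fix x y assume xy: "x \<in> Y" "y \<in> Y" "(rep x, p x) = (rep y, p y)"
    have "tpeq L N A (Suc n) x y"
    proof (rule shift_tp_inj[of n "g x" "rep x" x A "g y" y])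
      show "g y (rep x j) = y j" if "j < n" for j using g1[OF xy(2) that] xy(3) by simp
      have r: "rep x = rep y" and p: "p x = p y" using xy(3) by simp_all
      show "shift_tp L N (A \<union> rep x ` {..<n}) (g x) (x n) = shift_tp L N (A \<union> rep x ` {..<n}) (g y) (y n)"
        using p unfolding p_def B_def by (simp only: r)
    qed (use g1 g2 xy in blast)+
    then show "x = y" using Suc.prems(2) xy by blast
  qed
  have "|SIGMA r:rep ` Y. {p. complete_type L N 1 (B r) p}| \<le>o lambda"
  proof (rule card_of_Sigma_ordLeq_infinite_Field[OF l(2,1) R], rule ballI)
    fix r assume r: "r \<in> rep ` Y"
    then have "B r \<subseteq> univ N" using A(1) Suc.prems(1) rep unfolding B_def by blast
    moreover have "|r ` {..<n}| \<le>o lambda"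
      by (intro ordLess_imp_ordLeq finite_ordLess_infinite)
        (use l in \<open>auto simp: Field_card_of card_of_well_order_on card_order_on_def\<close>)
    then have "|B r| \<le>o lambda" unfolding B_def
      by (intro card_of_Un_ordLeq_infinite_Field[OF l(2) A(2) _ l(1)])
    ultimately show "|{p. complete_type L N 1 (B r) p}| \<le>o lambda"
      using st N unfolding stable_in_def by blast
  qed
  then show ?case
    using ordLeq_transitive[of "|Y|" "|SIGMA r:rep ` Y. {p. complete_type L N 1 (B r) p}|" lambda]
      inj im by (auto simp: card_of_ordLeq[symmetric])
qed

text \<open>Follows the variable convention of \<open>pfmls\<close>, with sequences in place of
  lists so that lengths need not be tracked.\<close>

definition jn :: "nat \<Rightarrow> (nat \<Rightarrow> 'a) \<Rightarrow> (nat \<Rightarrow> 'a) \<Rightarrow> nat \<Rightarrow> 'a" where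
  "jn n x c v = (if v < n then x v else c (v - n))"

lemma infinite_card_le:
  assumes "Card_order r" "infinite (Field r)" "finite A" shows "|A| \<le>o r"
proof -
  have "|A| \<le>o |Field r|" by (rule card_finite_le[OF assms(2,3)])
  then show ?thesis by (rule ordLeq_ordIso_trans[OF _ card_of_Field_ordIso[OF assms(1)]])
qed

text \<open>The tree is spread over \<open>2\<^sup><\<^sup>\<chi>\<close> for the least \<open>\<chi>\<close> with \<open>2\<^sup>\<chi> > \<lambda>\<close>; a path is coded as a subset of \<open>Field chi\<close>,
  a node as a proper initial segment of a path. Only \<open>\<lambda>\<^sup>+\<close> of the paths are used, to stay inside \<open>'a\<close>.\<close>

lemma stable_imp_no_bt:
  fixes N :: "('f, 'r, 'a) struct" and lambda :: "'a rel" and \<pi> :: "'x \<Rightarrow> nat \<Rightarrow> 'a"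
  assumes T: "T \<subseteq> sentences L" and N: "is_model L T N" and st: "stable_in L T lambda"
    and l: "Card_order lambda" "infinite (Field lambda)" and lU: "lambda <o |UNIV :: 'a set|"
    and L: "big L (Field lambda)" and \<psi>: "fm_in L \<psi>"
    and X: "\<And>x. x \<in> X \<Longrightarrow> range (\<pi> x) \<subseteq> univ N"
  shows "\<exists>h. \<not> bt ((\<lambda>c. {x. sat N (jn n (\<pi> x) c) \<psi>}) ` {c. range c \<subseteq> univ N}) h X"
proof (rule ccontr)
  let ?SS = "(\<lambda>c. {x. sat N (jn n (\<pi> x) c) \<psi>}) ` {c. range c \<subseteq> univ N}"
  assume "\<not> ?thesis"
  then have bt: "bt ?SS h X" for h by blast
  have Ns: "is_struct L N" using N by (simp add: is_model_def)
  then obtain a where a: "a \<in> univ N" by (auto simp: is_struct_def)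
  have lF: "|Field lambda| =o lambda" by (rule card_of_Field_ordIso[OF l(1)])
  define K where "K = {k :: 'a rel. Card_order k \<and> lambda <o |Pow (Field k)|}"
  have "lambda \<in> K" using Card_order_Pow[OF l(1)] l(1) by (simp add: K_def)
  then have "\<exists>r\<in>K. \<forall>r'\<in>K. r \<le>o r'" by (intro exists_minim_Card_order) (auto simp: K_def)
  then obtain chi where "chi \<in> K" and chi_min: "\<forall>r\<in>K. chi \<le>o r" by (rule bexE)
  then have chi: "Card_order chi" "lambda <o |Pow (Field chi)|" by (simp_all add: K_def)
  have chi_wo: "Well_order chi" using chi(1) by (simp add: card_order_on_def)
  have chi_l: "chi \<le>o lambda" using chi_min \<open>lambda \<in> K\<close> by blast
  have F_chi: "|Field chi| \<le>o lambda" by (rule ordIso_ordLeq_trans[OF card_of_Field_ordIso[OF chi(1)] chi_l])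
  \<comment> \<open>A proper initial segment of \<open>chi\<close> is smaller than
    \<open>chi\<close>, so minimality leaves it at most \<lambda> subsets. Hence each level has at
    most \<lambda> nodes.\<close>
  have us: "|Pow (underS chi i)| \<le>o lambda" if i: "i \<in> Field chi" for i
  proof (rule ccontr)
    assume "\<not> |Pow (underS chi i)| \<le>o lambda"
    then have "lambda <o |Pow (underS chi i)|"
      using l(1) by (simp add: not_ordLeq_iff_ordLess card_of_Well_order card_order_on_def)
    then have "|underS chi i| \<in> K" by (simp add: K_def Field_card_of card_of_Card_order card_of_card_order_on)
    then have "chi \<le>o |underS chi i|" using chi_min by blast
    moreover have "|underS chi i| <o chi" by (rule card_of_underS[OF chi(1) i])
    ultimately show False using not_ordLess_ordLeq by blast
  qed
  define Z where "Z = Field (cardSuc lambda)"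
  have Zc: "|Z| =o cardSuc lambda" unfolding Z_def
    by (rule card_of_Field_ordIso[OF cardSuc_Card_order[OF l(1)]])
  have lZ: "lambda <o |Z|"
    by (rule ordLess_ordIso_trans[OF cardSuc_greater[OF l(1)] ordIso_symmetric[OF Zc]])
  have leZ: "|A| \<le>o |Z|" if "|A| \<le>o lambda" for A :: "'y set"
    by (rule ordLeq_transitive[OF that ordLess_imp_ordLeq[OF lZ]])
  have "|Z| \<le>o |UNIV :: 'a set|"
    by (rule ordIso_ordLeq_trans[OF Zc cardSuc_least[OF l(1) card_of_Card_order lU]])
  note ZU = this
  have Zi: "infinite Z" unfolding Z_def using l cardSuc_finite by blast
  have "|funs L| \<le>o lambda" "|rels L| \<le>o lambda"
    using L by (simp_all add: big_def ordLeq_ordIso_trans[OF _ lF])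
  then have LZ: "big L Z" using Zi unfolding big_def by (simp add: leZ)
  have "|Z| \<le>o |Pow (Field chi)|"
    by (rule ordIso_ordLeq_trans[OF Zc cardSuc_least[OF l(1) card_of_Card_order chi(2)]])
  then obtain em where em: "inj_on em Z" "em ` Z \<subseteq> Pow (Field chi)" by (auto simp: card_of_ordLeq[symmetric])
  define F where "F = em ` Z"
  have FZ: "|F| =o |Z|" unfolding F_def
    by (rule ordIso_symmetric, rule card_of_ordIsoI[of em]) (simp add: bij_betw_def em(1))
  define D where "D = (SIGMA i:Field chi. Pow (underS chi i))"
  have D: "|D| \<le>o lambda" unfolding D_def
    by (rule card_of_Sigma_ordLeq_infinite_Field[OF l(2,1) F_chi]) (use us in blast)
  have nat: "|UNIV :: nat set| \<le>o lambda"
    using l(2) infinite_iff_card_of_nat[of "Field lambda"] ordLeq_ordIso_trans[OF _ lF] by blast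
  have DN: "|D \<times> (UNIV :: nat set)| \<le>o lambda"
    by (rule card_of_Times_ordLeq_infinite_Field[OF l(2) D nat l(1)])
  \<comment> \<open>The unknowns: \<open>Inl ((i, g), k)\<close> is the \<open>k\<close>-th
    parameter at the node on level \<open>i\<close> reached by \<open>g\<close>, and
    \<open>Inr (f, k)\<close> is the \<open>k\<close>-th coordinate of the tuple at the end of the
    path \<open>f\<close>.\<close>
  define V :: "((('a \<times> 'a set) \<times> nat) + ('a set \<times> nat)) set" where
    "V = Inl ` (D \<times> UNIV) \<union> Inr ` (F \<times> UNIV)"
  have V: "|V| \<le>o |Z|" unfolding V_def
    by (intro card_Un_le card_image_le card_Times_le Zi leZ D nat ordIso_imp_ordLeq FZ)
  define sg :: "'a set \<Rightarrow> 'a \<Rightarrow> nat \<Rightarrow> (('a \<times> 'a set) \<times> nat) + ('a set \<times> nat)" where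
    "sg f i v = (if v < n then Inr (f, v) else Inl ((i, f \<inter> underS chi i), v - n))" for f i v
  define fm where "fm f i = (if i \<in> f then \<psi> else Neg \<psi>)" for f :: "'a set" and i
  define \<Gamma> where "\<Gamma> = (\<lambda>(f, i). (fm f i, sg f i)) ` (F \<times> Field chi)"
  have "\<exists>(K :: ('f, 'r, 'a) struct) h. is_model L T K \<and> |univ K| \<le>o |Z| \<and> h ` V \<subseteq> univ K \<and>
      (\<forall>(\<phi>, \<sigma>)\<in>\<Gamma>. sat K (h \<circ> \<sigma>) \<phi>)"
  proof (rule realize_theory[OF N T LZ V ZU])
    fix \<phi> \<sigma> assume "(\<phi>, \<sigma>) \<in> \<Gamma>"
    then obtain f i where fi: "f \<in> F" "i \<in> Field chi" "\<phi> = fm f i" "\<sigma> = sg f i" by (auto simp: \<Gamma>_def)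
    then show "fm_in L \<phi> \<and> \<sigma> ` fv \<phi> \<subseteq> V" using \<psi> by (auto simp: fm_def sg_def V_def D_def)
  next
    fix G assume G: "finite G" "G \<subseteq> \<Gamma>"
    obtain P where P: "P \<subseteq> F \<times> Field chi" "finite P" "G = (\<lambda>(f, i). (fm f i, sg f i)) ` P"
      using finite_subset_image[OF G(1) G(2)[unfolded \<Gamma>_def]] by blast
    \<comment> \<open>A finite part of \<open>\<Gamma>\<close> mentions finitely many levels, so a
      tree of height \<open>card I\<close> in \<open>N\<close> satisfies it.\<close>
    define I where "I = snd ` P"
    have "\<exists>c b. (\<forall>i\<in>I. \<forall>g. c i g \<in> ?SS) \<and> (\<forall>g. b g \<in> X \<and> (\<forall>i\<in>I. b g \<in> c i (g \<inter> underS chi i) \<longleftrightarrow> i \<in> g))"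
      by (rule bt_tree[OF chi_wo _ _ bt]) (use P in \<open>auto simp: I_def\<close>)
    then obtain c b where c: "\<forall>i\<in>I. \<forall>g. c i g \<in> ?SS"
      and b: "\<forall>g. b g \<in> X \<and> (\<forall>i\<in>I. b g \<in> c i (g \<inter> underS chi i) \<longleftrightarrow> i \<in> g)" by (elim exE conjE)
    have "\<forall>i g. \<exists>d. i \<in> I \<longrightarrow> range d \<subseteq> univ N \<and> c i g = {x. sat N (jn n (\<pi> x) d) \<psi>}"
      using c by (auto simp: image_iff)
    then have "\<forall>i. \<exists>d. \<forall>g. i \<in> I \<longrightarrow> range (d g) \<subseteq> univ N \<and> c i g = {x. sat N (jn n (\<pi> x) (d g)) \<psi>}"
      by (intro allI choice) simp
    from choice[OF this] obtain d where d: "\<forall>i g. i \<in> I \<longrightarrow> range (d i g) \<subseteq> univ N \<and> c i g = {x. sat N (jn n (\<pi> x) (d i g)) \<psi>}"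
      by (elim exE)
    define h where "h w = (case w of Inl ((i, g), k) \<Rightarrow> if i \<in> I then d i g k else a | Inr (f, k) \<Rightarrow> \<pi> (b f) k)"
      for w :: "(('a \<times> 'a set) \<times> nat) + ('a set \<times> nat)"
    have "h w \<in> univ N" for w
    proof (cases w)
      case (Inl u)
      obtain i g k where u: "u = ((i, g), k)" by (metis surj_pair)
      show ?thesis
      proof (cases "i \<in> I")
        case True
        then have "range (d i g) \<subseteq> univ N" using d by blast
        then show ?thesis using True Inl u by (auto simp: h_def)
      qed (simp add: Inl u h_def a)
    next
      case (Inr u)
      have "range (\<pi> (b (fst u))) \<subseteq> univ N" using X b by blast
      then show ?thesis using Inr by (auto simp: h_def split: prod.splits)
    qed
    then have "range h \<subseteq> univ N" by blast
    moreover have "sat N (h \<circ> sg f i) (fm f i)" if p: "(f, i) \<in> P" for f i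
    proof -
      have i: "i \<in> I" using p by (force simp: I_def)
      have "h \<circ> sg f i = jn n (\<pi> (b f)) (d i (f \<inter> underS chi i))"
        using i by (auto simp: h_def sg_def jn_def fun_eq_iff)
      moreover have "sat N (jn n (\<pi> (b f)) (d i (f \<inter> underS chi i))) \<psi> \<longleftrightarrow> i \<in> f"
        using b[rule_format, of f] d[rule_format, of i "f \<inter> underS chi i"] i by auto
      ultimately show ?thesis by (simp add: fm_def)
    qed
    ultimately show "\<exists>h. range h \<subseteq> univ N \<and> (\<forall>(\<phi>, \<sigma>)\<in>G. sat N (h \<circ> \<sigma>) \<phi>)"
      unfolding P(3) by (intro exI[of _ h]) auto
  qed
  then obtain K :: "('f, 'r, 'a) struct" and h where K: "is_model L T K" "|univ K| \<le>o |Z|" "h ` V \<subseteq> univ K"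
      "\<forall>(\<phi>, \<sigma>)\<in>\<Gamma>. sat K (h \<circ> \<sigma>) \<phi>" by (elim exE conjE)
  \<comment> \<open>Only the parameters at the nodes, hence at most \<lambda> elements; over them
    the tuples \<open>y f\<close> will have pairwise different types.\<close>
  define A where "A = h ` Inl ` (D \<times> UNIV)"
  define y where "y f k = h (Inr (f, k))" for f k
  have ineq: "\<not> tpeq L K A n (y f) (y f')"
    if f: "f \<in> F" "f' \<in> F" and i: "i \<in> f" "i \<notin> f'" "i \<in> Field chi" "f \<inter> underS chi i = f' \<inter> underS chi i" for f f' i
  proof
    assume t: "tpeq L K A n (y f) (y f')"
    have "sat K (h \<circ> sg f i) \<psi> = sat K (h \<circ> sg f' i) \<psi>"
    proof (rule tpeqD[OF t \<psi>])
      fix v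
      have "(i, f' \<inter> underS chi i) \<in> D" using i by (auto simp: D_def)
      then show "(\<exists>j<n. (h \<circ> sg f i) v = y f j \<and> (h \<circ> sg f' i) v = y f' j) \<or>
         (h \<circ> sg f i) v = (h \<circ> sg f' i) v \<and> (h \<circ> sg f i) v \<in> A"
        using i(4) by (auto simp: sg_def y_def A_def)
    qed
    moreover have "sat K (h \<circ> sg g i) (fm g i)" if "g \<in> F" for g
    proof -
      have "(fm g i, sg g i) \<in> \<Gamma>" using that i(3) by (auto simp: \<Gamma>_def)
      then show ?thesis using K(4) by auto
    qed
    from this[OF f(1)] this[OF f(2)] have "sat K (h \<circ> sg f i) \<psi>" "\<not> sat K (h \<circ> sg f' i) \<psi>"
      using i by (auto simp: fm_def)
    ultimately show False by blast
  qed
  have eq: "f = f'" if f: "f \<in> F" "f' \<in> F" and t: "tpeq L K A n (y f) (y f')" for f f'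
  proof (rule ccontr)
    assume "f \<noteq> f'"
    \<comment> \<open>At the first level where the two paths differ they pass through the same node,
      and its formula separates them.\<close>
    define I where "I = (f - f') \<union> (f' - f)"
    have I: "I \<noteq> {}" "I \<subseteq> Field chi" using \<open>f \<noteq> f'\<close> f em(2) by (auto simp: I_def F_def)
    have wo: "wo_rel chi" using chi_wo by (simp add: wo_rel_def)
    define i where "i = wo_rel.minim chi I"
    have i: "i \<in> I" "\<And>j. j \<in> I \<Longrightarrow> (i, j) \<in> chi"
      using wo_rel.minim_in[OF wo I(2,1)] wo_rel.minim_least[OF wo I(2)] by (auto simp: i_def)
    have "f \<inter> underS chi i = f' \<inter> underS chi i"
    proof -
      have "j \<notin> I" if "j \<in> underS chi i" for j
        using that i(2)[of j] wo_rel.ANTISYM[OF wo] by (auto simp: underS_def antisym_def)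
      then show ?thesis by (auto simp: I_def)
    qed
    then show False using ineq[OF f] ineq[OF f(2,1)] t tpeq_sym[OF t] i(1) I(2) unfolding I_def by blast
  qed
  have "|y ` F| \<le>o lambda"
  proof (rule stable_tuples[OF K(1) st l, of A _ n])
    show "A \<subseteq> univ K" using K(3) by (auto simp: A_def V_def image_Un)
    have "|h ` Inl ` (D \<times> UNIV)| \<le>o |Field lambda|"
      by (intro card_image_le ordLeq_ordIso_trans[OF DN ordIso_symmetric[OF lF]])
    then show "|A| \<le>o lambda" unfolding A_def by (rule ordLeq_ordIso_trans[OF _ lF])
    show "range x \<subseteq> univ K" if "x \<in> y ` F" for x
      using that K(3) by (auto simp: y_def V_def image_Un image_subset_iff)
    show "x = x'" if "x \<in> y ` F" "x' \<in> y ` F" "tpeq L K A n x x'" for x x'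
      using that eq by blast
  qed
  moreover have "inj_on y F" by (rule inj_onI) (metis eq tpeq_refl)
  then have "|F| =o |y ` F|" by (intro card_of_ordIsoI[of y]) (simp add: bij_betw_def)
  ultimately have "|F| \<le>o lambda" by (metis ordIso_ordLeq_trans)
  then have "|Z| \<le>o lambda" using FZ by (metis ordIso_ordLeq_trans ordIso_symmetric)
  then show False using lZ not_ordLess_ordLeq by blast
qed

section \<open>Types do not fork over their domain\<close>

lemma dfn_agree:
  assumes "dfn L W R" "is_struct L N" "range e \<subseteq> univ N" "range e' \<subseteq> univ N" "\<And>w. w \<in> W \<Longrightarrow> e w = e' w"
  shows "R N e = R N e'"
proof -
  obtain \<phi> \<sigma> where "dfn_by L W R \<phi> \<sigma>" using assms(1) by (rule dfnE)
  note d = dfn_byD[OF this]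
  have "sat N (e \<circ> \<sigma>) \<phi> = sat N (e' \<circ> \<sigma>) \<phi>" by (rule sat_cong) (use assms(5) d(2) in auto)
  then show ?thesis using d(3)[OF assms(2,3)] d(3)[OF assms(2,4)] by simp
qed

text \<open>Blocks of variables: \<open>Inr (b, p)\<close> is the \<open>p\<close>-th variable of block \<open>b\<close>. Block \<open>0\<close> holds the point of a
  definable set, the other blocks and the variables \<open>Inl u\<close> its parameters.\<close>

abbreviation blk :: "nat \<Rightarrow> ('a + nat \<times> (nat \<times> nat)) set" where
  "blk b \<equiv> Inr ` ({b} \<times> UNIV)"

definition setblk :: "nat \<Rightarrow> ('a + nat \<times> (nat \<times> nat) \<Rightarrow> 'b) \<Rightarrow> (nat \<times> nat \<Rightarrow> 'b) \<Rightarrow> 'a + nat \<times> (nat \<times> nat) \<Rightarrow> 'b" where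
  "setblk b e x w = (case w of Inl u \<Rightarrow> e w | Inr (b', p) \<Rightarrow> if b' = b then x p else e w)"

lemma setblk_simps [simp]:
  "setblk b e x (Inl u) = e (Inl u)"
  "setblk b e x (Inr (b', p)) = (if b' = b then x p else e (Inr (b', p)))"
  by (simp_all add: setblk_def)

lemma setblk_range: "range e \<subseteq> U \<Longrightarrow> range x \<subseteq> U \<Longrightarrow> range (setblk b e x) \<subseteq> U"
  by (auto simp: setblk_def image_subset_iff split: sum.splits prod.splits)

lemma setblk_off: "w \<notin> blk b \<Longrightarrow> setblk b e x w = e w"
  by (auto simp: setblk_def split: sum.splits prod.splits)

lemma ex_on_blk:
  assumes "range e \<subseteq> univ N"
  shows "ex_on N (blk b) P e \<longleftrightarrow> (\<exists>x. range x \<subseteq> univ N \<and> P (setblk b e x))"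
proof
  assume "ex_on N (blk b) P e"
  then obtain e' where e': "range e' \<subseteq> univ N" "\<forall>v. v \<notin> blk b \<longrightarrow> e' v = e v" "P e'"
    unfolding ex_on_def by (elim exE conjE)
  have "setblk b e (\<lambda>p. e' (Inr (b, p))) = e'"
  proof
    fix w show "setblk b e (\<lambda>p. e' (Inr (b, p))) w = e' w"
    proof (cases w)
      case (Inl u)
      then show ?thesis using e'(2) by (simp add: image_iff)
    next
      case (Inr q)
      obtain b' p where "q = (b', p)" by (cases q)
      then show ?thesis using e'(2) Inr by (auto simp: image_iff)
    qed
  qed
  then show "\<exists>x. range x \<subseteq> univ N \<and> P (setblk b e x)"
    using e'(1,3) by (intro exI[of _ "\<lambda>p. e' (Inr (b, p))"]) auto
next
  assume "\<exists>x. range x \<subseteq> univ N \<and> P (setblk b e x)"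
  then obtain x where x: "range x \<subseteq> univ N" "P (setblk b e x)" by (elim exE conjE)
  then show "ex_on N (blk b) P e"
    unfolding ex_on_def using assms
    by (intro exI[of _ "setblk b e x"] conjI setblk_range allI impI setblk_off)
qed

text \<open>A point is a family of tuples, \<open>x (j, i)\<close> being the \<open>i\<close>-th
  coordinate of the \<open>j\<close>-th tuple: in \<open>avoid_finite\<close> finitely many tuples
  have to be avoided simultaneously.\<close>

definition dset :: "('f, 'r, 'a) struct \<Rightarrow> (('f, 'r, 'a) struct \<Rightarrow> ('a + nat \<times> (nat \<times> nat) \<Rightarrow> 'a) \<Rightarrow> bool) \<Rightarrow>
    ('a + nat \<times> (nat \<times> nat) \<Rightarrow> 'a) \<Rightarrow> (nat \<times> nat \<Rightarrow> 'a) set" where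
  "dset N R e = {x. range x \<subseteq> univ N \<and> R N (setblk 0 e x)}"

definition inst :: "('f, 'r, 'a) struct \<Rightarrow> nat \<Rightarrow> nat \<times> ('f, 'r) fm \<Rightarrow> (nat \<Rightarrow> 'a) \<Rightarrow> (nat \<times> nat \<Rightarrow> 'a) set" where
  "inst N n = (\<lambda>(j, \<psi>) c. {x. sat N (jn n (\<lambda>i. x (j, i)) c) \<psi>})"

definition fam :: "('f, 'r, 'a) struct \<Rightarrow> nat \<Rightarrow> nat \<times> ('f, 'r) fm \<Rightarrow> (nat \<times> nat \<Rightarrow> 'a) set set" where
  "fam N n k = inst N n k ` {c. range c \<subseteq> univ N}"

text \<open>Lets a formula speak about the \<open>j\<close>-th tuple of block 0, with its parameters
  taken from row 0 of block \<open>b\<close>.\<close>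

definition itau :: "nat \<Rightarrow> nat \<Rightarrow> nat \<Rightarrow> nat \<Rightarrow> 'a + nat \<times> (nat \<times> nat)" where
  "itau n b j v = (if v < n then Inr (0, (j, v)) else Inr (b, (0, v - n)))"

lemma sat_itau:
  assumes "b \<noteq> 0"
  shows "sat N (setblk 0 e x \<circ> itau n b j) \<psi> \<longleftrightarrow> x \<in> inst N n (j, \<psi>) (\<lambda>i. e (Inr (b, (0, i))))"
proof -
  have "setblk 0 e x \<circ> itau n b j = jn n (\<lambda>i. x (j, i)) (\<lambda>i. e (Inr (b, (0, i))))"
    using assms by (auto simp: itau_def jn_def fun_eq_iff)
  then show ?thesis by (simp add: inst_def)
qed

lemma dset_Int:
  assumes "b \<noteq> 0"
  shows "dset N (\<lambda>N e. R N e \<and> sat N (e \<circ> itau n b j) \<psi>) e = dset N R e \<inter> inst N n (j, \<psi>) (\<lambda>i. e (Inr (b, (0, i))))"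
    and "dset N (\<lambda>N e. R N e \<and> \<not> sat N (e \<circ> itau n b j) \<psi>) e = dset N R e - inst N n (j, \<psi>) (\<lambda>i. e (Inr (b, (0, i))))"
  unfolding dset_def sat_itau[OF assms] by auto

lemma dset_agree:
  assumes R: "dfn L W R" and N: "is_struct L N" and e: "range e \<subseteq> univ N" "range e' \<subseteq> univ N"
    and w: "\<And>w. w \<in> W - blk 0 \<Longrightarrow> e w = e' w"
  shows "dset N R e = dset N R e'"
proof -
  have "R N (setblk 0 e x) = R N (setblk 0 e' x)" if "range x \<subseteq> univ N" for x
  proof (rule dfn_agree[OF R N])
    fix v assume "v \<in> W"
    show "setblk 0 e x v = setblk 0 e' x v"
    proof (cases "v \<in> blk 0")
      case True
      then show ?thesis by auto
    next
      case False
      then show ?thesis using w[of v] \<open>v \<in> W\<close> by (simp add: setblk_off)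
    qed
  qed (intro setblk_range e that)+
  then show ?thesis by (auto simp: dset_def)
qed

text \<open>For fixed \<open>m\<close>, \<open>h\<close> and \<open>t\<close> the recursion unfolds
  into boundedly many quantifiers: a member of the family is an instance of one of the finitely many
  formulas in \<open>J\<close>, and its parameters are bound as the block \<open>b\<close>. The
  bound \<open>b\<close> grows along the recursion so that each such block is fresh.\<close>

lemma dfn_rk:
  fixes L :: "('f, 'r) lang" and R :: "('f, 'r, 'a) struct \<Rightarrow> ('a + nat \<times> (nat \<times> nat) \<Rightarrow> 'a) \<Rightarrow> bool"
  assumes J: "finite J" "\<And>j \<psi>. (j, \<psi>) \<in> J \<Longrightarrow> fm_in L \<psi>"
    and "dfn L W R" "W \<subseteq> range Inl \<union> Inr ` ({..<b} \<times> UNIV)" "0 < b"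
  shows "dfn L (W - blk 0) (\<lambda>N e. rk (\<Union>k\<in>J. fam N n k) m h t (dset N R e))"
  using assms(3-)
proof (induction h arbitrary: t W R b)
  case 0
  show ?case
  proof (rule dfn_cong[OF dfn_ex[OF 0(1), of "blk 0"]])
    fix N :: "('f, 'r, 'a) struct" and e :: "'a + nat \<times> (nat \<times> nat) \<Rightarrow> 'a"
    assume "range e \<subseteq> univ N"
    then show "rk (\<Union>k\<in>J. fam N n k) m 0 t (dset N R e) = ex_on N (blk 0) (R N) e"
      by (subst ex_on_blk) (auto simp: dset_def)
  qed
next
  case (Suc h)
  note IHh = Suc.IH
  from Suc.prems show ?case
  proof (induction t arbitrary: W R b)
    case 0
    show ?case by (rule dfn_cong[OF dfn_True]) simp
  next
    case (Suc t)
    have b0: "b \<noteq> 0" using Suc.prems(3) by simp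
    let ?W = "W \<union> blk 0 \<union> blk b"
    let ?SS = "\<lambda>N. \<Union>k\<in>J. fam N n k"
    have W: "?W \<subseteq> range Inl \<union> Inr ` ({..<Suc b} \<times> UNIV)"
      using Suc.prems(2) b0 by (auto simp: less_Suc_eq image_iff subset_iff)
    define R1 where "R1 k N e \<longleftrightarrow> R N e \<and> sat N (e \<circ> itau n b (fst k)) (snd k)" for k :: "nat \<times> ('f, 'r) fm" and N e
    define R2 where "R2 k N e \<longleftrightarrow> R N e \<and> \<not> sat N (e \<circ> itau n b (fst k)) (snd k)" for k :: "nat \<times> ('f, 'r) fm" and N e
    define G where "G k N e \<longleftrightarrow> rk (?SS N) m h m (dset N (R1 k) e) \<and> rk (?SS N) m (Suc h) t (dset N (R2 k) e)" for k N e
    have dG: "dfn L (W - blk 0) (\<lambda>N e. ex_on N (blk b) (G k N) e)" if k: "k \<in> J" for k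
    proof -
      have "dfn L ?W (\<lambda>N e. sat N (e \<circ> itau n b (fst k)) (snd k))"
        by (rule dfn_base) (use J(2)[of "fst k" "snd k"] k in \<open>auto simp: itau_def\<close>)
      moreover have "dfn L ?W R" using Suc.prems(1) by (rule dfn_mono) auto
      ultimately have "dfn L ?W (R1 k)" "dfn L ?W (R2 k)" unfolding R1_def R2_def
        by (intro dfn_and dfn_not; simp)+
      then have "dfn L (?W - blk 0) (\<lambda>N e. rk (?SS N) m h m (dset N (R1 k) e))"
        "dfn L (?W - blk 0) (\<lambda>N e. rk (?SS N) m (Suc h) t (dset N (R2 k) e))"
        using IHh[OF _ W] Suc.IH[OF _ W] by simp_all
      then have "dfn L (?W - blk 0) (G k)" unfolding G_def by (rule dfn_and)
      from dfn_ex[OF this, of "blk b"] show ?thesis by (rule dfn_mono) auto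
    qed
    show ?case
    proof (rule dfn_cong[OF dfn_bex[OF J(1) dG]])
      fix N :: "('f, 'r, 'a) struct" and e :: "'a + nat \<times> (nat \<times> nat) \<Rightarrow> 'a"
      assume N: "is_struct L N" and e: "range e \<subseteq> univ N"
      have "ex_on N (blk b) (G k N) e \<longleftrightarrow> (\<exists>S\<in>fam N n k. rk (?SS N) m h m (dset N R e \<inter> S) \<and>
          rk (?SS N) m (Suc h) t (dset N R e - S))" for k
      proof -
        have *: "dset N (R1 k) (setblk b e x) = dset N R e \<inter> inst N n k (\<lambda>i. x (0, i))"
          "dset N (R2 k) (setblk b e x) = dset N R e - inst N n k (\<lambda>i. x (0, i))"
          if x: "range x \<subseteq> univ N" for x
        proof -
          have d: "dset N R (setblk b e x) = dset N R e"
          proof (rule dset_agree[OF Suc.prems(1) N setblk_range[OF e x] e])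
            fix w :: "'a + nat \<times> (nat \<times> nat)" assume "w \<in> W - blk 0"
            then have "w \<notin> blk b" using Suc.prems(2) by auto
            then show "setblk b e x w = e w" by (rule setblk_off)
          qed
          obtain j \<psi> where k: "k = (j, \<psi>)" by (cases k)
          show "dset N (R1 k) (setblk b e x) = dset N R e \<inter> inst N n k (\<lambda>i. x (0, i))"
            using dset_Int(1)[OF b0, of N R n j \<psi> "setblk b e x"] by (simp add: R1_def[abs_def] k d)
          show "dset N (R2 k) (setblk b e x) = dset N R e - inst N n k (\<lambda>i. x (0, i))"
            using dset_Int(2)[OF b0, of N R n j \<psi> "setblk b e x"] by (simp add: R2_def[abs_def] k d)
        qed
        have "ex_on N (blk b) (G k N) e \<longleftrightarrow> (\<exists>x. range x \<subseteq> univ N \<and> G k N (setblk b e x))"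
          by (rule ex_on_blk[OF e])
        also have "\<dots> \<longleftrightarrow> (\<exists>x :: nat \<times> nat \<Rightarrow> 'a. range x \<subseteq> univ N \<and>
           rk (?SS N) m h m (dset N R e \<inter> inst N n k (\<lambda>i. x (0, i))) \<and>
           rk (?SS N) m (Suc h) t (dset N R e - inst N n k (\<lambda>i. x (0, i))))"
        proof (rule iff_exI)
          fix x
          show "(range x \<subseteq> univ N \<and> G k N (setblk b e x)) \<longleftrightarrow> (range x \<subseteq> univ N \<and>
             rk (?SS N) m h m (dset N R e \<inter> inst N n k (\<lambda>i. x (0, i))) \<and>
             rk (?SS N) m (Suc h) t (dset N R e - inst N n k (\<lambda>i. x (0, i))))"
            using *[of x] by (cases "range x \<subseteq> univ N") (simp_all add: G_def)
        qed
        also have "\<dots> \<longleftrightarrow> (\<exists>c. range c \<subseteq> univ N \<and>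
           rk (?SS N) m h m (dset N R e \<inter> inst N n k c) \<and>
           rk (?SS N) m (Suc h) t (dset N R e - inst N n k c))" (is "?l \<longleftrightarrow> ?r")
        proof
          assume ?l
          then obtain x :: "nat \<times> nat \<Rightarrow> 'a" where x: "range x \<subseteq> univ N" "rk (?SS N) m h m (dset N R e \<inter> inst N n k (\<lambda>i. x (0, i)))"
           "rk (?SS N) m (Suc h) t (dset N R e - inst N n k (\<lambda>i. x (0, i)))" by (elim exE conjE)
          then show ?r by (intro exI[of _ "\<lambda>i. x (0, i)"]) auto
        next
          assume ?r
          then obtain c where c: "range c \<subseteq> univ N" "rk (?SS N) m h m (dset N R e \<inter> inst N n k c)"
           "rk (?SS N) m (Suc h) t (dset N R e - inst N n k c)" by (elim exE conjE)
          then show ?l by (intro exI[of _ "\<lambda>p. c (snd p)"]) auto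
        qed
        finally show ?thesis by (auto simp: fam_def)
      qed
      then show "rk (?SS N) m (Suc h) (Suc t) (dset N R e) = (\<exists>k\<in>J. ex_on N (blk b) (G k N) e)"
        by simp
    qed
  qed
qed

text \<open>The formulas of the cover may concern different tuples \<open>j\<close> of a point. This
  does no harm: if the instances on one tuple are \<open>k\<close>-inconsistent, so are the subsets
  of the definable set that they cut out.\<close>

lemma nonforking_cover:
  fixes N :: "('f, 'r, 'a) struct" and lambda :: "'a rel"
  assumes T: "T \<subseteq> sentences L" and N: "is_model L T N" and st: "stable_in L T lambda"
    and l: "Card_order lambda" "infinite (Field lambda)" and lU: "lambda <o |UNIV :: 'a set|"
    and L: "big L (Field lambda)"
    and R: "dfn L (Inl ` B \<union> blk 0) R" and B: "B \<subseteq> univ N"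
    and e0: "range e0 \<subseteq> univ N" "\<And>u. u \<in> B \<Longrightarrow> e0 (Inl u) = u"
    and J: "finite J" "\<And>k d. (k, d) \<in> J \<Longrightarrow> fm_in L (snd k) \<and> range d \<subseteq> univ N"
    and cover: "dset N R e0 \<subseteq> (\<Union>(k, d)\<in>J. inst N n k d)"
    and div: "\<And>j \<psi> d. ((j, \<psi>), d) \<in> J \<Longrightarrow> \<exists>k len ds. fv \<psi> \<subseteq> {..<n + len} \<and>
       (\<forall>i::nat. range (ds i) \<subseteq> univ N \<and> tpeq L N B len d (ds i)) \<and>
       (\<forall>I. finite I \<and> card I = k \<longrightarrow> \<not> (\<exists>y. range y \<subseteq> univ N \<and> (\<forall>i\<in>I. sat N (jn n y (ds i)) \<psi>)))"
  shows "dset N R e0 = {}"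
proof (rule ccontr)
  let ?X = "dset N R e0" and ?K = "fst ` J"
  let ?SS = "\<Union>k\<in>?K. fam N n k"
  have Ns: "is_struct L N" using N by (simp add: is_model_def)
  have K: "finite ?K" "\<And>j \<psi>. (j, \<psi>) \<in> ?K \<Longrightarrow> fm_in L \<psi>" using J by force+
  assume ne: "?X \<noteq> {}"
  have step: "Rk ?SS (Suc h) ?X" if h: "Rk ?SS h ?X" for h
  proof -
    have "\<exists>q\<in>J. Rk ?SS h (?X \<inter> (case q of (k, d) \<Rightarrow> inst N n k d))"
      by (rule Rk_UN[OF J(1) h cover])
    then obtain j \<psi> d where jd: "((j, \<psi>), d) \<in> J" "Rk ?SS h (?X \<inter> inst N n (j, \<psi>) d)" by auto
    have d: "range d \<subseteq> univ N" "fm_in L \<psi>" using J(2)[OF jd(1)] by simp_all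
    from div[OF jd(1)] obtain k len ds where len: "fv \<psi> \<subseteq> {..<n + len}"
      and ds: "\<forall>i::nat. range (ds i) \<subseteq> univ N \<and> tpeq L N B len d (ds i)"
      and inc: "\<forall>I. finite I \<and> card I = k \<longrightarrow> \<not> (\<exists>y. range y \<subseteq> univ N \<and> (\<forall>i\<in>I. sat N (jn n y (ds i)) \<psi>))"
      by (elim exE conjE)
    \<comment> \<open>Block 1 holds the parameters of the instance as variables, so that
      \<open>d\<close> can be exchanged for its conjugates \<open>ds i\<close>; the blocks bound in
      the rank formula start at 2.\<close>
    define R1 where "R1 N e \<longleftrightarrow> R N e \<and> sat N (e \<circ> itau n 1 j) \<psi>" for N e
    let ?P = "(\<lambda>v. Inr (1, (0, v))) ` {..<len} :: ('a + nat \<times> (nat \<times> nat)) set"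
    have R1: "dfn L (Inl ` B \<union> blk 0 \<union> ?P) R1" unfolding R1_def
    proof (rule dfn_and)
      show "dfn L (Inl ` B \<union> blk 0 \<union> ?P) R" by (rule dfn_mono[OF R]) auto
      have "itau n 1 j v \<in> Inl ` B \<union> blk 0 \<union> ?P" if "v \<in> fv \<psi>" for v
        using len that by (cases "v < n") (auto simp: itau_def image_iff)
      then show "dfn L (Inl ` B \<union> blk 0 \<union> ?P) (\<lambda>N e. sat N (e \<circ> itau n 1 j) \<psi>)"
        by (intro dfn_base[OF d(2)]) auto
    qed
    have "dfn L (Inl ` B \<union> blk 0 \<union> ?P - blk 0) (\<lambda>N e. rk (\<Union>k\<in>?K. fam N n k) m h m (dset N R1 e))" for m
      by (rule dfn_rk[OF K(1) _ R1, where b = 2]) (use K(2) in auto)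
    then have rk_dfn: "dfn L (Inl ` B \<union> ?P) (\<lambda>N e. rk (\<Union>k\<in>?K. fam N n k) m h m (dset N R1 e))" for m
      by (rule dfn_mono) auto
    have dset1: "dset N R1 (setblk 1 e0 (\<lambda>p. c (snd p))) = ?X \<inter> inst N n (j, \<psi>) c" if c: "range c \<subseteq> univ N" for c
    proof -
      have "dset N R (setblk 1 e0 (\<lambda>p. c (snd p))) = ?X"
        by (rule dset_agree[OF R Ns setblk_range[OF e0(1)] e0(1)]) (use c in auto)
      then show ?thesis using dset_Int(1)[of 1 N R n j \<psi> "setblk 1 e0 (\<lambda>p. c (snd p))"]
        by (simp add: R1_def[abs_def])
    qed
    have Rk_i: "Rk ?SS h (?X \<inter> inst N n (j, \<psi>) (ds i))" for i
      unfolding Rk_def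
    proof
      fix m
      have dsi: "range (ds i) \<subseteq> univ N" "tpeq L N B len d (ds i)" using ds by simp_all
      have "rk ?SS m h m (dset N R1 (setblk 1 e0 (\<lambda>p. d (snd p)))) =
            rk ?SS m h m (dset N R1 (setblk 1 e0 (\<lambda>p. ds i (snd p))))"
      proof (rule dfn_tpeq[OF rk_dfn dsi(2) Ns])
        fix w assume "w \<in> Inl ` B \<union> ?P"
        then show "(\<exists>j<len. setblk 1 e0 (\<lambda>p. d (snd p)) w = d j \<and> setblk 1 e0 (\<lambda>p. ds i (snd p)) w = ds i j) \<or>
          setblk 1 e0 (\<lambda>p. d (snd p)) w = setblk 1 e0 (\<lambda>p. ds i (snd p)) w \<and> setblk 1 e0 (\<lambda>p. d (snd p)) w \<in> B"
          using e0(2) by auto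
      next
        show "range (setblk 1 e0 (\<lambda>p. d (snd p))) \<subseteq> univ N"
          by (rule setblk_range[OF e0(1)]) (use d(1) in auto)
        show "range (setblk 1 e0 (\<lambda>p. ds i (snd p))) \<subseteq> univ N"
          by (rule setblk_range[OF e0(1)]) (use dsi(1) in auto)
      qed
      then show "rk ?SS m h m (?X \<inter> inst N n (j, \<psi>) (ds i))"
        using jd(2) unfolding dset1[OF d(1)] dset1[OF dsi(1)] Rk_def by simp
    qed
    show ?thesis
    proof (rule Rk_Suc[of "UNIV :: nat set" "\<lambda>i. inst N n (j, \<psi>) (ds i)" _ _ _ k])
      fix i :: nat
      have "inst N n (j, \<psi>) (ds i) \<in> fam N n (j, \<psi>)" using ds by (simp add: fam_def)
      moreover have "(j, \<psi>) \<in> ?K" using jd(1) by force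
      ultimately show "inst N n (j, \<psi>) (ds i) \<in> ?SS" by blast
    next
      fix I :: "nat set" assume I: "finite I" "card I = k"
      show "?X \<inter> (\<Inter>i\<in>I. inst N n (j, \<psi>) (ds i)) = {}"
      proof (rule equals0I)
        fix x assume x: "x \<in> ?X \<inter> (\<Inter>i\<in>I. inst N n (j, \<psi>) (ds i))"
        then have "range (\<lambda>i. x (j, i)) \<subseteq> univ N" by (auto simp: dset_def)
        moreover have "\<forall>i\<in>I. sat N (jn n (\<lambda>i. x (j, i)) (ds i)) \<psi>" using x by (simp add: inst_def)
        ultimately show False using inc[rule_format, of I] I by blast
      qed
    qed (use Rk_i in simp_all)
  qed
  have "Rk ?SS h ?X" for h
  proof (induction h)
    case 0
    show ?case using ne by (simp add: Rk_def)
  qed (rule step)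
  \<comment> \<open>The labels of these trees come from all formulas of the cover. The Ramsey
    property leaves trees of every height for a single formula, which is what stability
    excludes.\<close>
  then have "bt ?SS h ?X" for h by (intro rk_bt) (simp add: Rk_def)
  from bt_finite_UN[OF K(1) this] obtain k where k: "k \<in> ?K" "\<forall>h. bt (fam N n k) h ?X" by (rule bexE)
  obtain j \<psi> where "k = (j, \<psi>)" by (cases k)
  with k have jp: "(j, \<psi>) \<in> ?K" "\<forall>h. bt (fam N n (j, \<psi>)) h ?X" by simp_all
  have "\<exists>h. \<not> bt ((\<lambda>c. {x. sat N (jn n (\<lambda>i. x (j, i)) c) \<psi>}) ` {c. range c \<subseteq> univ N}) h ?X"
    by (rule stable_imp_no_bt[OF T N st l lU L K(2)[OF jp(1)], where \<pi> = "\<lambda>x i. x (j, i)"]) (auto simp: dset_def)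
  moreover have "fam N n (j, \<psi>) = (\<lambda>c. {x. sat N (jn n (\<lambda>i. x (j, i)) c) \<psi>}) ` {c. range c \<subseteq> univ N}"
    by (simp add: fam_def inst_def)
  ultimately show False using jp(2) by simp
qed

section \<open>Extending elementary maps without realizing a forking type\<close>

text \<open>Sentences are included, as they assign no variables: even for empty \<open>B\<close> the
  structures \<open>M\<close> and \<open>P\<close> must be elementarily equivalent.\<close>

definition pelem :: "('f, 'r) lang \<Rightarrow> ('f, 'r, 'a) struct \<Rightarrow> ('f, 'r, 'a) struct \<Rightarrow> 'a set \<Rightarrow> ('a \<Rightarrow> 'a) \<Rightarrow> bool" where
  "pelem L M P B f \<longleftrightarrow> (\<forall>\<phi> e. fm_in L \<phi> \<and> e ` fv \<phi> \<subseteq> B \<longrightarrow> sat M e \<phi> = sat P (f \<circ> e) \<phi>)"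

lemma pelemD:
  assumes "pelem L M P B f" "fm_in L \<phi>" "\<And>v. v \<in> fv \<phi> \<Longrightarrow> e v \<in> B"
  shows "sat M e \<phi> = sat P (f \<circ> e) \<phi>"
proof -
  have "e ` fv \<phi> \<subseteq> B" using assms(3) by (simp add: image_subset_iff)
  then show ?thesis using assms(1,2) unfolding pelem_def by blast
qed

lemma dfn_pelem:
  assumes "dfn L W R" "pelem L M P B f" "is_struct L M" "is_struct L P" "range e \<subseteq> univ M" "range e' \<subseteq> univ P"
    "\<And>w. w \<in> W \<Longrightarrow> e w \<in> B \<and> e' w = f (e w)"
  shows "R M e = R P e'"
proof -
  obtain \<phi> \<sigma> where "dfn_by L W R \<phi> \<sigma>" using assms(1) by (rule dfnE)
  note d = dfn_byD[OF this]
  have "sat M (e \<circ> \<sigma>) \<phi> = sat P (f \<circ> (e \<circ> \<sigma>)) \<phi>"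
    by (rule pelemD[OF assms(2) d(1)]) (use d(2) assms(7) in auto)
  also have "\<dots> = sat P (e' \<circ> \<sigma>) \<phi>" by (rule sat_cong) (use d(2) assms(7) in auto)
  finally show ?thesis using d(3)[OF assms(3,5)] d(3)[OF assms(4,6)] by simp
qed

lemma pelem_elem_sub:
  assumes "elem_sub L M N" "univ M \<noteq> {}" shows "pelem L M N (univ M) id"
  unfolding pelem_def
proof (intro allI impI, elim conjE)
  fix \<phi> e assume "fm_in L \<phi>" "e ` fv \<phi> \<subseteq> univ M"
  then show "sat M e \<phi> = sat N (id \<circ> e) \<phi>" using elem_subD[OF assms, of \<phi> e] by auto
qed

lemma pfmls_case:
  assumes "(\<phi>, b) \<in> pfmls L n A" "\<And>i. i < n \<Longrightarrow> e i = x ! i" "\<And>i. i < length b \<Longrightarrow> e (n + i) = b ! i" "length x = n"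
  shows "psat M x (\<phi>, b) = sat M e \<phi>"
proof -
  have "sat M (\<lambda>i. (x @ b) ! i) \<phi> = sat M e \<phi>"
  proof (rule sat_cong)
    fix i assume "i \<in> fv \<phi>"
    then have "i < n + length b" using assms(1) by (auto simp: pfmls_def)
    then show "(x @ b) ! i = e i"
      using assms(2)[of i] assms(3)[of "i - n"] assms(4) by (cases "i < n") (auto simp: nth_append)
  qed
  then show ?thesis by (simp add: psat_def)
qed

section \<open>Dividing, forking and finite parts of types, in terms of assignments\<close>

lemma tp_tpeq:
  fixes N :: "('f, 'r, 'a) struct"
  assumes x: "x \<in> tuples N len" and y: "y \<in> tuples N len" and tp: "tp L N A x = tp L N A y"
    and x': "\<And>i. i < len \<Longrightarrow> x' i = x ! i" and y': "\<And>i. i < len \<Longrightarrow> y' i = y ! i"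
  shows "tpeq L N A len x' y'"
  unfolding tpeq_def
proof (intro allI impI, elim conjE)
  fix \<phi> e e'
  assume f: "fm_in L \<phi>" and e: "\<forall>v\<in>fv \<phi>. (\<exists>j<len. e v = x' j \<and> e' v = y' j) \<or> e v = e' v \<and> e v \<in> A"
  have l: "length x = len" "length y = len" using x y by (simp_all add: tuples_def)
  have "\<forall>v\<in>fv \<phi>. \<exists>w. w \<in> Inl ` {..<len} \<union> Inr ` A \<and>
     e v = (case w of Inl j \<Rightarrow> x ! j | Inr u \<Rightarrow> id u) \<and> e' v = (case w of Inl j \<Rightarrow> y ! j | Inr u \<Rightarrow> id u)"
  proof
    fix v assume "v \<in> fv \<phi>"
    then consider j where "j < len" "e v = x' j" "e' v = y' j" | "e v = e' v" "e v \<in> A"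
      using e by auto
    then show "\<exists>w. w \<in> Inl ` {..<len} \<union> Inr ` A \<and>
       e v = (case w of Inl j \<Rightarrow> x ! j | Inr u \<Rightarrow> id u) \<and> e' v = (case w of Inl j \<Rightarrow> y ! j | Inr u \<Rightarrow> id u)"
    proof cases
      case (1 j) then show ?thesis using x' y' by (intro exI[of _ "Inl j"]) auto
    next
      case 2 then show ?thesis by (intro exI[of _ "Inr (e v)"]) auto
    qed
  qed
  from bchoice[OF this] obtain c where c: "\<forall>v\<in>fv \<phi>. c v \<in> Inl ` {..<len} \<union> Inr ` A \<and>
     e v = (case c v of Inl j \<Rightarrow> x ! j | Inr u \<Rightarrow> id u) \<and> e' v = (case c v of Inl j \<Rightarrow> y ! j | Inr u \<Rightarrow> id u)"
    by (elim exE)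
  have "\<exists>\<phi>' b. (\<phi>', b) \<in> pfmls L len A \<and>
    (\<forall>(N :: ('f, 'r, 'a) struct) x g. length x = len \<longrightarrow>
       sat N (\<lambda>i. (x @ map g b) ! i) \<phi>' = sat N (\<lambda>v. case c v of Inl j \<Rightarrow> x ! j | Inr u \<Rightarrow> g u) \<phi>)"
    by (rule pack[OF f]) (use c in simp)
  then obtain \<phi>' b where b: "(\<phi>', b) \<in> pfmls L len A"
    "\<forall>(N :: ('f, 'r, 'a) struct) x g. length x = len \<longrightarrow>
       sat N (\<lambda>i. (x @ map g b) ! i) \<phi>' = sat N (\<lambda>v. case c v of Inl j \<Rightarrow> x ! j | Inr u \<Rightarrow> g u) \<phi>"
    by (elim exE conjE)
  have "sat N e \<phi> = sat N (\<lambda>v. case c v of Inl j \<Rightarrow> x ! j | Inr u \<Rightarrow> id u) \<phi>"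
    by (rule sat_cong) (use c in simp)
  also have "\<dots> \<longleftrightarrow> (\<phi>', b) \<in> tp L N A x" using b(2)[rule_format, of x N id] b(1) l by (simp add: tp_def psat_def)
  also have "\<dots> \<longleftrightarrow> (\<phi>', b) \<in> tp L N A y" using tp by simp
  also have "\<dots> = sat N (\<lambda>v. case c v of Inl j \<Rightarrow> y ! j | Inr u \<Rightarrow> id u) \<phi>"
    using b(2)[rule_format, of y N id] b(1) l by (simp add: tp_def psat_def)
  also have "\<dots> = sat N e' \<phi>" by (rule sat_cong) (use c in simp)
  finally show "sat N e \<phi> = sat N e' \<phi>" .
qed

lemma tpeq_mono:
  assumes "tpeq L N A n x y" "B \<subseteq> A" shows "tpeq L N B n x y"
  unfolding tpeq_def
proof (intro allI impI, elim conjE)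
  fix \<phi> e e'
  assume "fm_in L \<phi>" "\<forall>v\<in>fv \<phi>. (\<exists>j<n. e v = x j \<and> e' v = y j) \<or> e v = e' v \<and> e v \<in> B"
  then show "sat N e \<phi> = sat N e' \<phi>" using assms(2) by (intro tpeqD[OF assms(1)]) auto
qed

text \<open>Besides padding tuples to sequences, this passes to the smaller set \<open>B\<close>:
  conjugates over \<open>A\<close> are conjugates over \<open>B\<close>, and inconsistency does not
  depend on the base.\<close>

lemma divides_jn:
  fixes N :: "('f, 'r, 'a) struct"
  assumes a: "a \<in> univ N" and p: "(\<psi>, b) \<in> pfmls L n (univ N)" and div: "divides L N n (\<psi>, b) A" and B: "B \<subseteq> A"
  shows "\<exists>k len ds. fv \<psi> \<subseteq> {..<n + len} \<and>
       (\<forall>i::nat. range (ds i) \<subseteq> univ N \<and> tpeq L N B len (\<lambda>v. if v < length b then b ! v else a) (ds i)) \<and>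
       (\<forall>I. finite I \<and> card I = k \<longrightarrow> \<not> (\<exists>y. range y \<subseteq> univ N \<and> (\<forall>i\<in>I. sat N (jn n y (ds i)) \<psi>)))"
proof -
  let ?len = "length b"
  obtain k bs where bs: "\<forall>i::nat. bs i \<in> tuples N ?len \<and> tp L N A (bs i) = tp L N A b"
    and inc: "\<forall>I. finite I \<and> card I = k \<longrightarrow> \<not> (\<exists>x\<in>tuples N n. \<forall>i\<in>I. psat N x (\<psi>, bs i))"
    using div unfolding divides_def split by (elim exE conjE)
  define ds where "ds i v = (if v < ?len then bs i ! v else a)" for i v
  have l: "length (bs i) = ?len" "set (bs i) \<subseteq> univ N" for i using bs by (auto simp: tuples_def)
  have "range (ds i) \<subseteq> univ N" for i
  proof -
    have "ds i v \<in> univ N" for v using a l[of i] nth_mem[of v "bs i"] by (auto simp: ds_def)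
    then show ?thesis by blast
  qed
  moreover have "tpeq L N B ?len (\<lambda>v. if v < ?len then b ! v else a) (ds i)" for i
  proof (rule tpeq_mono[OF tp_tpeq B])
    show "b \<in> tuples N ?len" using p by (auto simp: pfmls_def tuples_def)
    show "bs i \<in> tuples N ?len" "tp L N A b = tp L N A (bs i)" using bs by simp_all
  qed (simp_all add: ds_def)
  moreover have "\<not> (\<exists>y. range y \<subseteq> univ N \<and> (\<forall>i\<in>I. sat N (jn n y (ds i)) \<psi>))" if I: "finite I" "card I = k" for I
  proof
    assume "\<exists>y. range y \<subseteq> univ N \<and> (\<forall>i\<in>I. sat N (jn n y (ds i)) \<psi>)"
    then obtain y where y: "range y \<subseteq> univ N" "\<forall>i\<in>I. sat N (jn n y (ds i)) \<psi>" by (elim exE conjE)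
    have "map y [0..<n] \<in> tuples N n" using y(1) by (auto simp: tuples_def image_subset_iff)
    moreover have "psat N (map y [0..<n]) (\<psi>, bs i)" if "i \<in> I" for i
    proof -
      have "(\<psi>, bs i) \<in> pfmls L n (univ N)" using p l[of i] by (auto simp: pfmls_def)
      then have "psat N (map y [0..<n]) (\<psi>, bs i) = sat N (jn n y (ds i)) \<psi>"
        by (rule pfmls_case) (auto simp: jn_def ds_def l)
      then show ?thesis using y(2) that by simp
    qed
    ultimately show False using inc[rule_format, of I] I by blast
  qed
  ultimately show ?thesis using p by (intro exI[of _ k] exI[of _ ?len] exI[of _ ds]) (auto simp: pfmls_def)
qed

text \<open>Makes the finite part \<open>q\<close> that witnesses forking explicit: it is its
  finitely many parameters that are copied into the chain.\<close>

definition forks_via ::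
  "('f, 'r) lang \<Rightarrow> ('f, 'r, 'a) struct \<Rightarrow> nat \<Rightarrow> (('f, 'r) fm \<times> 'a list) set \<Rightarrow> 'a set \<Rightarrow> bool"
where
  "forks_via L M n q A \<longleftrightarrow> (\<exists>N. is_struct L N \<and> elem_sub L M N \<and>
     (\<exists>D. finite D \<and> D \<subseteq> pfmls L n (univ N) \<and> (\<forall>\<psi>\<in>D. divides L N n \<psi> A) \<and>
        (\<forall>x\<in>tuples N n. (\<forall>\<psi>\<in>q. psat N x \<psi>) \<longrightarrow> (\<exists>\<psi>\<in>D. psat N x \<psi>))))"

lemma forks_imp_via:
  assumes "forks L M n p A" shows "\<exists>q. finite q \<and> q \<subseteq> p \<and> forks_via L M n q A"
proof -
  obtain N D q where "is_struct L N" "elem_sub L M N" "finite D" "D \<subseteq> pfmls L n (univ N)"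
    "\<forall>\<psi>\<in>D. divides L N n \<psi> A" "finite q" "q \<subseteq> p"
    "\<forall>x\<in>tuples N n. (\<forall>\<psi>\<in>q. psat N x \<psi>) \<longrightarrow> (\<exists>\<psi>\<in>D. psat N x \<psi>)"
    using assms unfolding forks_def by (elim exE conjE)
  then show ?thesis unfolding forks_via_def
    by (intro exI[of _ q] conjI exI[of _ N] exI[of _ D])
qed

text \<open>Satisfaction by \<open>x\<close> of the copy of \<open>q\<close> under \<open>f\<close>,
  without forming that copy. As \<open>x\<close> and \<open>f\<close> are functions, either can be
  replaced by variables, which gives \<open>dfn_msat\<close>.\<close>

definition msat :: "('f, 'r, 'a) struct \<Rightarrow> nat \<Rightarrow> (('f, 'r) fm \<times> 'a list) set \<Rightarrow> (nat \<Rightarrow> 'a) \<Rightarrow> ('a \<Rightarrow> 'a) \<Rightarrow> bool" where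
  "msat N n q x f \<longleftrightarrow> (\<forall>(\<phi>, b)\<in>q. sat N (\<lambda>i. if i < n then x i else f (b ! (i - n))) \<phi>)"

lemma msat_psat:
  assumes "q \<subseteq> pfmls L n A" "length xs = n" "\<And>i. i < n \<Longrightarrow> x i = xs ! i"
  shows "msat N n q x f \<longleftrightarrow> (\<forall>(\<phi>, b)\<in>q. psat N xs (\<phi>, map f b))"
proof -
  have "sat N (\<lambda>i. if i < n then x i else f (b ! (i - n))) \<phi> = psat N xs (\<phi>, map f b)" if "(\<phi>, b) \<in> q" for \<phi> b
  proof -
    have "(\<phi>, b) \<in> pfmls L n A" using assms(1) that by blast
    then have "(\<phi>, map f b) \<in> pfmls L n (f ` A)" by (auto simp: pfmls_def)
    then show ?thesis by (intro pfmls_case[symmetric]) (use assms in auto)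
  qed
  then show ?thesis unfolding msat_def by auto
qed

lemma msat_cong:
  assumes "q \<subseteq> pfmls L n A" "\<And>i. i < n \<Longrightarrow> x i = y i" "\<And>\<phi> b u. (\<phi>, b) \<in> q \<Longrightarrow> u \<in> set b \<Longrightarrow> f u = g u"
  shows "msat N n q x f = msat N n q y g"
proof -
  have "sat N (\<lambda>i. if i < n then x i else f (b ! (i - n))) \<phi> = sat N (\<lambda>i. if i < n then y i else g (b ! (i - n))) \<phi>"
    if q: "(\<phi>, b) \<in> q" for \<phi> b
  proof (rule sat_cong)
    fix i assume i: "i \<in> fv \<phi>"
    have "(\<phi>, b) \<in> pfmls L n A" using assms(1) q by blast
    then have "i < n + length b" using i by (auto simp: pfmls_def)
    then show "(if i < n then x i else f (b ! (i - n))) = (if i < n then y i else g (b ! (i - n)))"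
      using assms(2)[of i] assms(3)[OF q, of "b ! (i - n)"] by auto
  qed
  then show ?thesis unfolding msat_def by auto
qed

lemma dfn_msat:
  fixes L :: "('f, 'r) lang" and q :: "(('f, 'r) fm \<times> 'a list) set" and W :: "'v set"
  assumes "finite q" "q \<subseteq> pfmls L n A" "\<And>i. i < n \<Longrightarrow> \<xi> i \<in> W" "\<And>\<phi> b u. (\<phi>, b) \<in> q \<Longrightarrow> u \<in> set b \<Longrightarrow> \<eta> u \<in> W"
  shows "dfn L W (\<lambda>N e. msat N n q (\<lambda>i. e (\<xi> i)) (\<lambda>u. e (\<eta> u)))"
proof -
  have "dfn L W (\<lambda>N e. \<forall>\<psi>\<in>q. sat N (e \<circ> (\<lambda>i. if i < n then \<xi> i else \<eta> (snd \<psi> ! (i - n)))) (fst \<psi>))"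
  proof (rule dfn_ball[OF assms(1)], rule dfn_base)
    fix \<psi> assume \<psi>: "\<psi> \<in> q"
    obtain \<phi> b where pb: "\<psi> = (\<phi>, b)" by (cases \<psi>)
    have "(\<phi>, b) \<in> pfmls L n A" using assms(2) \<psi> pb by blast
    then have p: "fm_in L \<phi>" "fv \<phi> \<subseteq> {..<n + length b}" by (auto simp: pfmls_def)
    show "fm_in L (fst \<psi>)" using p pb by simp
    have "(if i < n then \<xi> i else \<eta> (b ! (i - n))) \<in> W" if "i \<in> fv \<phi>" for i
      using assms(3)[of i] assms(4)[of \<phi> b "b ! (i - n)"] p(2) that \<psi> pb by (auto simp: subset_iff)
    then show "(\<lambda>i. if i < n then \<xi> i else \<eta> (snd \<psi> ! (i - n))) ` fv (fst \<psi>) \<subseteq> W"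
      unfolding pb fst_conv snd_conv by (rule image_subsetI)
  qed
  then show ?thesis
  proof (rule dfn_cong)
    fix N :: "('f, 'r, 'a) struct" and e :: "'v \<Rightarrow> 'a"
    have eq: "(\<lambda>i. if i < n then e (\<xi> i) else e (\<eta> (b ! (i - n)))) = e \<circ> (\<lambda>i. if i < n then \<xi> i else \<eta> (b ! (i - n)))" for b
      by auto
    show "msat N n q (\<lambda>i. e (\<xi> i)) (\<lambda>u. e (\<eta> u)) =
        (\<forall>\<psi>\<in>q. sat N (e \<circ> (\<lambda>i. if i < n then \<xi> i else \<eta> (snd \<psi> ! (i - n)))) (fst \<psi>))"
      by (simp only: msat_def case_prod_unfold eq)
  qed
qed

text \<open>The finite case of \<open>avoid_extension\<close>: only a finite part
  \<open>\<Phi>\<close> of the type of the parameters has to be preserved, and only the finitely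
  many tuples in \<open>xl\<close> are to be avoided. It can then be solved in \<open>P\<close>
  itself.\<close>

lemma avoid_finite:
  fixes M P :: "('f, 'r, 'a) struct" and lambda :: "'a rel"
  assumes T: "T \<subseteq> sentences L" and st: "stable_in L T lambda"
    and l: "Card_order lambda" "infinite (Field lambda)" and lU: "lambda <o |UNIV :: 'a set|"
    and L: "big L (Field lambda)"
    and M: "is_model L T M" and via: "forks_via L M n q A" and q: "finite q" "q \<subseteq> pfmls L n (univ M)"
    and B: "B \<subseteq> A" "B \<subseteq> univ M"
    and P: "is_model L T P" and f: "pelem L M P B f" "f ` B \<subseteq> univ P"
    and E: "E = \<Union> (set ` snd ` q)"
    and \<Phi>: "finite \<Phi>" "\<And>\<phi> e. (\<phi>, e) \<in> \<Phi> \<Longrightarrow> fm_in L \<phi> \<and> e ` fv \<phi> \<subseteq> B \<union> E \<and> sat M e \<phi>"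
    and xl: "set xl \<subseteq> tuples P n"
  shows "\<exists>h. range h \<subseteq> univ P \<and> (\<forall>u\<in>B. h u = f u) \<and> (\<forall>(\<phi>, e)\<in>\<Phi>. sat P (h \<circ> e) \<phi>) \<and>
    (\<forall>x\<in>set xl. \<not> msat P n q (\<lambda>i. x ! i) h)"
proof (rule ccontr)
  assume no: "\<not> ?thesis"
  obtain N D where N: "is_struct L N" "elem_sub L M N" and D: "finite D" "D \<subseteq> pfmls L n (univ N)"
    "\<forall>\<psi>\<in>D. divides L N n \<psi> A"
    and imp: "\<forall>x\<in>tuples N n. (\<forall>\<psi>\<in>q. psat N x \<psi>) \<longrightarrow> (\<exists>\<psi>\<in>D. psat N x \<psi>)"
    using via unfolding forks_via_def by (elim exE conjE)
  have Ms: "is_struct L M" and Ps: "is_struct L P" using M P by (simp_all add: is_model_def)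
  have neM: "univ M \<noteq> {}" using Ms by (simp add: is_struct_def)
  have MN: "univ M \<subseteq> univ N" using N(2) by (simp add: elem_sub_def)
  obtain a where a: "a \<in> univ M" using neM by blast
  obtain c where c: "c \<in> univ P" using Ps by (auto simp: is_struct_def)
  have EM: "E \<subseteq> univ M" using q(2) by (fastforce simp: E pfmls_def)
  have qE: "u \<in> E" if "(\<phi>, b) \<in> q" "u \<in> set b" for \<phi> b u using that by (force simp: E)
  define m where "m = length xl"
  \<comment> \<open>\<open>Inl u\<close> is a variable for the copy of \<open>u\<close>, and row
    \<open>j\<close> of block 0 is a tuple to be avoided. \<open>R\<close> binds
    \<open>E - B\<close> only, since the copy of \<open>B\<close> is prescribed by \<open>f\<close>;
    so \<open>R\<close> is definable with parameters for \<open>B\<close> alone.\<close>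
  define S where "S K e \<longleftrightarrow> ((\<forall>\<psi>\<in>\<Phi>. sat K (e \<circ> (Inl \<circ> snd \<psi>)) (fst \<psi>)) \<longrightarrow>
     (\<exists>j\<in>{..<m}. msat K n q (\<lambda>i. e (Inr (0, (j, i)))) (\<lambda>u. e (Inl u))))"
    for K :: "('f, 'r, 'a) struct" and e :: "'a + nat \<times> (nat \<times> nat) \<Rightarrow> 'a"
  define R where "R K e \<longleftrightarrow> all_on K (Inl ` (E - B)) (S K) e"
    for K :: "('f, 'r, 'a) struct" and e :: "'a + nat \<times> (nat \<times> nat) \<Rightarrow> 'a"
  have dS: "dfn L (Inl ` (B \<union> E) \<union> blk 0) S" unfolding S_def
  proof (rule dfn_imp)
    show "dfn L (Inl ` (B \<union> E) \<union> blk 0) (\<lambda>K e. \<forall>\<psi>\<in>\<Phi>. sat K (e \<circ> (Inl \<circ> snd \<psi>)) (fst \<psi>))"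
    proof (rule dfn_ball[OF \<Phi>(1)], rule dfn_base)
      fix \<psi> assume "\<psi> \<in> \<Phi>"
      then have "fm_in L (fst \<psi>) \<and> snd \<psi> ` fv (fst \<psi>) \<subseteq> B \<union> E" using \<Phi>(2)[of "fst \<psi>" "snd \<psi>"] by simp
      then show "fm_in L (fst \<psi>)" "(Inl \<circ> snd \<psi>) ` fv (fst \<psi>) \<subseteq> Inl ` (B \<union> E) \<union> blk 0" by auto
    qed
    show "dfn L (Inl ` (B \<union> E) \<union> blk 0)
       (\<lambda>K e. \<exists>j\<in>{..<m}. msat K n q (\<lambda>i. e (Inr (0, (j, i)))) (\<lambda>u. e (Inl u)))"
    proof (rule dfn_bex)
      fix j
      show "dfn L (Inl ` (B \<union> E) \<union> blk 0) (\<lambda>K e. msat K n q (\<lambda>i. e (Inr (0, (j, i)))) (\<lambda>u. e (Inl u)))"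
        by (rule dfn_msat[OF q, where \<xi> = "\<lambda>i. Inr (0, (j, i))" and \<eta> = Inl]) (use qE in auto)
    qed simp
  qed
  have dR: "dfn L (Inl ` B \<union> blk 0) R" unfolding R_def
    by (rule dfn_mono[OF dfn_all[OF dS, of "Inl ` (E - B)"]]) auto
  have dxR: "dfn L (Inl ` B) (\<lambda>K. ex_on K (blk 0) (R K))"
    by (rule dfn_mono[OF dfn_ex[OF dR, of "blk 0"]]) auto
  define eP where "eP w = (case w of Inl u \<Rightarrow> if u \<in> B then f u else c
    | Inr (b, (j, i)) \<Rightarrow> if j < m \<and> i < n then xl ! j ! i else c)" for w :: "'a + nat \<times> (nat \<times> nat)"
  have xP: "xl ! j ! i \<in> univ P" if "j < m" "i < n" for i j
  proof -
    have "xl ! j \<in> tuples P n" using xl that(1) by (auto simp: m_def)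
    then show ?thesis using that(2) by (auto simp: tuples_def)
  qed
  have eP: "range eP \<subseteq> univ P"
  proof -
    have "eP w \<in> univ P" for w
      using c f(2) xP by (auto simp: eP_def split: sum.splits prod.splits)
    then show ?thesis by blast
  qed
  \<comment> \<open>The assumption \<open>no\<close>, that every admissible copy fails, says that
    \<open>R\<close> holds in \<open>P\<close> at the family \<open>xl\<close>.\<close>
  have "R P eP" unfolding R_def all_on_def
  proof (intro allI impI, elim conjE)
    fix e' :: "'a + nat \<times> (nat \<times> nat) \<Rightarrow> 'a" assume e': "range e' \<subseteq> univ P" "\<forall>v. v \<notin> Inl ` (E - B) \<longrightarrow> e' v = eP v"
    show "S P e'" unfolding S_def
    proof
      assume s: "\<forall>\<psi>\<in>\<Phi>. sat P (e' \<circ> (Inl \<circ> snd \<psi>)) (fst \<psi>)"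
      let ?h = "\<lambda>u. e' (Inl u)"
      have h1: "range ?h \<subseteq> univ P" using e'(1) by (auto simp: image_subset_iff)
      have h2: "?h u = f u" if "u \<in> B" for u
      proof -
        have "e' (Inl u) = eP (Inl u)" using that by (intro e'(2)[rule_format]) auto
        then show ?thesis using that by (simp add: eP_def)
      qed
      have h3: "sat P (?h \<circ> e) \<phi>" if "(\<phi>, e) \<in> \<Phi>" for \<phi> e
        using bspec[OF s that] by (simp add: comp_def)
      have "\<exists>x\<in>set xl. msat P n q (\<lambda>i. x ! i) ?h"
      proof (rule ccontr)
        assume n: "\<not> (\<exists>x\<in>set xl. msat P n q (\<lambda>i. x ! i) ?h)"
        show False
        proof (rule notE[OF no], rule exI[of _ ?h], intro conjI ballI)
          show "case z of (\<phi>, e) \<Rightarrow> sat P (?h \<circ> e) \<phi>" if "z \<in> \<Phi>" for z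
            using h3 that by (cases z) simp
        qed (use h1 h2 n in simp_all)
      qed
      then obtain j where j: "j < m" "msat P n q (\<lambda>i. xl ! j ! i) ?h" by (auto simp: in_set_conv_nth m_def)
      have "msat P n q (\<lambda>i. e' (Inr (0, (j, i)))) ?h = msat P n q (\<lambda>i. xl ! j ! i) ?h"
      proof (rule msat_cong[OF q(2)])
        fix i assume "i < n"
        have "e' (Inr (0, (j, i))) = eP (Inr (0, (j, i)))" by (intro e'(2)[rule_format]) auto
        then show "e' (Inr (0, (j, i))) = xl ! j ! i" using j(1) \<open>i < n\<close> by (simp add: eP_def)
      qed simp
      then show "\<exists>j\<in>{..<m}. msat P n q (\<lambda>i. e' (Inr (0, (j, i)))) (\<lambda>u. e' (Inl u))" using j by blast
    qed
  qed
  then have exP: "ex_on P (blk 0) (R P) eP" unfolding ex_on_def using eP by (intro exI[of _ eP]) simp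
  define eM where "eM w = (case w of Inl u \<Rightarrow> if u \<in> B then u else a | Inr _ \<Rightarrow> a)" for w :: "'a + nat \<times> (nat \<times> nat)"
  have eM: "range eM \<subseteq> univ M"
  proof -
    have "eM w \<in> univ M" for w using a B(2) by (auto simp: eM_def split: sum.splits)
    then show ?thesis by blast
  qed
  \<comment> \<open>Solvability of \<open>R\<close> is a condition on \<open>B\<close>, hence it
    passes from \<open>P\<close> back to \<open>M\<close> along \<open>f\<close>.\<close>
  have "ex_on M (blk 0) (R M) eM = ex_on P (blk 0) (R P) eP"
    by (rule dfn_pelem[OF dxR f(1) Ms Ps eM eP]) (auto simp: eM_def eP_def)
  then have "ex_on M (blk 0) (R M) eM" using exP by simp
  then obtain x where x: "range x \<subseteq> univ M" "R M (setblk 0 eM x)" unfolding ex_on_blk[OF eM] by (elim exE conjE)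
  define e0 where "e0 w = (case w of Inl u \<Rightarrow> if u \<in> univ M then u else a | Inr _ \<Rightarrow> a)" for w :: "'a + nat \<times> (nat \<times> nat)"
  have e0M: "range e0 \<subseteq> univ M"
  proof -
    have "e0 w \<in> univ M" for w using a by (auto simp: e0_def split: sum.splits)
    then show ?thesis by blast
  qed
  have e0: "range e0 \<subseteq> univ N" using e0M MN by blast
  have "R M (setblk 0 eM x) = R N (setblk 0 e0 x)"
  proof -
    have r: "range (setblk 0 eM x) \<subseteq> univ M" "range (setblk 0 e0 x) \<subseteq> univ M" by (intro setblk_range eM e0M x(1))+
    have "R M (setblk 0 eM x) = R M (setblk 0 e0 x)"
      by (rule dfn_agree[OF dR Ms r]) (use B(2) in \<open>auto simp: eM_def e0_def\<close>)
    also have "\<dots> = R N (setblk 0 e0 x)"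
      by (rule dfn_pelem[OF dR pelem_elem_sub[OF N(2) neM] Ms N(1) r(2)]) (use r(2) MN in auto)
    finally show ?thesis .
  qed
  then have "x \<in> dset N R e0" using x MN by (auto simp: dset_def)
  moreover have "dset N R e0 = {}"
  proof -
    define pad where "pad b v = (if v < length b then b ! v else a)" for b :: "'a list" and v
    define J where "J = (\<lambda>(j, \<psi>). ((j, fst \<psi>), pad (snd \<psi>))) ` ({..<m} \<times> D)"
    have padN: "range (pad b) \<subseteq> univ N" if "(\<psi>, b) \<in> D" for \<psi> b
    proof -
      have "set b \<subseteq> univ N" using D(2) that by (auto simp: pfmls_def)
      then have "pad b v \<in> univ N" for v using a MN nth_mem[of v b] by (auto simp: pad_def)
      then show ?thesis by blast
    qed
    show ?thesis
    proof (rule nonforking_cover[OF T is_model_elem_sub[OF M N(2,1) T] st l lU L dR _ e0])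
      show "B \<subseteq> univ N" using B(2) MN by blast
      show "e0 (Inl u) = u" if "u \<in> B" for u using that B(2) by (auto simp: e0_def)
      show "finite J" using D(1) by (simp add: J_def)
      show "fm_in L (snd k) \<and> range d \<subseteq> univ N" if kd: "(k, d) \<in> J" for k d
      proof -
        obtain j \<psi> b where "(\<psi>, b) \<in> D" "k = (j, \<psi>)" "d = pad b" using kd by (auto simp: J_def)
        then show ?thesis using D(2) padN by (auto simp: pfmls_def)
      qed
      show "dset N R e0 \<subseteq> (\<Union>(k, d)\<in>J. inst N n k d)"
      proof
        fix y assume "y \<in> dset N R e0"
        then have y: "range y \<subseteq> univ N" "R N (setblk 0 e0 y)" by (simp_all add: dset_def)
        \<comment> \<open>The universal quantifier in \<open>R\<close> is instantiated with the
          original parameters, which satisfy \<open>\<Phi>\<close>. So some row of \<open>y\<close>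
          satisfies \<open>q\<close> itself and with it a dividing formula.\<close>
        have "S N (setblk 0 e0 y)" using y(2) setblk_range[OF e0 y(1)] unfolding R_def all_on_def by simp
        moreover have "sat N (setblk 0 e0 y \<circ> (Inl \<circ> snd \<psi>)) (fst \<psi>)" if "\<psi> \<in> \<Phi>" for \<psi>
        proof -
          have p: "fm_in L (fst \<psi>)" "snd \<psi> ` fv (fst \<psi>) \<subseteq> B \<union> E" "sat M (snd \<psi>) (fst \<psi>)"
            using \<Phi>(2)[of "fst \<psi>" "snd \<psi>"] that by simp_all
          have eM': "snd \<psi> v \<in> univ M" if "v \<in> fv (fst \<psi>)" for v using p(2) that B(2) EM by blast
          have "sat N (setblk 0 e0 y \<circ> (Inl \<circ> snd \<psi>)) (fst \<psi>) = sat N (snd \<psi>) (fst \<psi>)"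
            by (rule sat_cong) (use eM' in \<open>simp add: e0_def\<close>)
          also have "\<dots> = sat M (snd \<psi>) (fst \<psi>)" using elem_subD[OF N(2) neM p(1) eM'] by simp
          finally show ?thesis using p(3) by simp
        qed
        ultimately obtain j where j: "j < m" "msat N n q (\<lambda>i. y (j, i)) (\<lambda>u. e0 (Inl u))"
          unfolding S_def by auto
        define xs where "xs = map (\<lambda>i. y (j, i)) [0..<n]"
        have "msat N n q (\<lambda>i. y (j, i)) (\<lambda>u. e0 (Inl u)) = msat N n q (\<lambda>i. y (j, i)) id"
        proof (rule msat_cong[OF q(2)])
          fix \<phi> b u assume "(\<phi>, b) \<in> q" "u \<in> set b"
          then have "u \<in> univ M" using qE EM by blast
          then show "e0 (Inl u) = id u" by (simp add: e0_def)
        qed simp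
        also have "\<dots> \<longleftrightarrow> (\<forall>(\<phi>, b)\<in>q. psat N xs (\<phi>, map id b))"
          by (rule msat_psat[OF q(2)]) (simp_all add: xs_def)
        finally have "\<forall>\<psi>\<in>q. psat N xs \<psi>" using j(2) by auto
        moreover have xsN: "xs \<in> tuples N n" using y(1) by (auto simp: xs_def tuples_def image_subset_iff)
        ultimately obtain \<psi> b where b: "(\<psi>, b) \<in> D" "psat N xs (\<psi>, b)" using imp by fastforce
        have "psat N xs (\<psi>, b) = sat N (jn n (\<lambda>i. y (j, i)) (pad b)) \<psi>"
        proof (rule pfmls_case)
          show "(\<psi>, b) \<in> pfmls L n (univ N)" using D(2) b(1) by blast
        qed (simp_all add: jn_def xs_def pad_def)
        then have "y \<in> inst N n (j, \<psi>) (pad b)" using b(2) by (simp add: inst_def)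
        moreover have "((j, \<psi>), pad b) \<in> J" using j(1) b(1) by (force simp: J_def)
        ultimately show "y \<in> (\<Union>(k, d)\<in>J. inst N n k d)" by blast
      qed
    next
      fix j \<psi> d assume "((j, \<psi>), d) \<in> J"
      then obtain b where b: "(\<psi>, b) \<in> D" "d = pad b" by (auto simp: J_def)
      have "(\<psi>, b) \<in> pfmls L n (univ N)" "divides L N n (\<psi>, b) A" "a \<in> univ N" using D b(1) a MN by auto
      from divides_jn[OF this(3,1,2) B(1)]
      show "\<exists>k len ds. fv \<psi> \<subseteq> {..<n + len} \<and>
       (\<forall>i::nat. range (ds i) \<subseteq> univ N \<and> tpeq L N B len d (ds i)) \<and>
       (\<forall>I. finite I \<and> card I = k \<longrightarrow> \<not> (\<exists>y. range y \<subseteq> univ N \<and> (\<forall>i\<in>I. sat N (jn n y (ds i)) \<psi>)))"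
        unfolding b(2) pad_def .
    qed
  qed
  ultimately show False by blast
qed

text \<open>Compactness over \<open>P\<close>: \<open>G1\<close> demands the type of
  \<open>B \<union> E\<close>, \<open>G2\<close> agreement with \<open>f\<close> on
  \<open>B\<close>, and \<open>G3\<close> the avoidance of each tuple of \<open>P\<close>; finite
  parts are solved by \<open>avoid_finite\<close>. Avoiding the tuples of \<open>P\<close> is what
  the chain asks for: each of its tuples lies in some model, and the finite part of that stage
  excludes it.\<close>

lemma avoid_extension:
  fixes M P :: "('f, 'r, 'a) struct" and lambda :: "'a rel"
  assumes T: "T \<subseteq> sentences L" and st: "stable_in L T lambda"
    and l: "Card_order lambda" "infinite (Field lambda)" and lU: "lambda <o |UNIV :: 'a set|"
    and L: "big L (Field lambda)"
    and M: "is_model L T M" and via: "forks_via L M n q A" and q: "finite q" "q \<subseteq> pfmls L n (univ M)"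
    and B: "B \<subseteq> A" "B \<subseteq> univ M" "|B| \<le>o lambda"
    and P: "is_model L T P" "|univ P| \<le>o lambda" and f: "pelem L M P B f" "f ` B \<subseteq> univ P"
    and E: "E = \<Union> (set ` snd ` q)"
  shows "\<exists>Q h. is_struct L Q \<and> elem_sub L P Q \<and> |univ Q| \<le>o lambda \<and> (\<forall>u\<in>B. h u = f u) \<and>
    pelem L M Q (B \<union> E) h \<and> h ` (B \<union> E) \<subseteq> univ Q \<and>
    (\<forall>x\<in>tuples P n. \<not> msat Q n q (\<lambda>i. x ! i) h)"
proof -
  have Ps: "is_struct L P" using P by (simp add: is_model_def)
  have lF: "|Field lambda| =o lambda" by (rule card_of_Field_ordIso[OF l(1)])
  note toF = ordLeq_ordIso_trans[OF _ ordIso_symmetric[OF lF]]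
  have ZU: "|Field lambda| <o |UNIV :: 'a set|" by (rule ordIso_ordLess_trans[OF lF lU])
  have qE: "u \<in> E" if "(\<phi>, b) \<in> q" "u \<in> set b" for \<phi> b u using that by (force simp: E)
  have "finite E" using q(1) by (simp add: E)
  then have V: "|B \<union> E| \<le>o |Field lambda|" by (intro card_Un_le l toF B(3) card_finite_le)
  let ?R = "\<lambda>(K :: ('f, 'r, 'a) struct) e. \<not> msat K n q (\<lambda>i. e (Inl i)) (\<lambda>u. e (Inr u))"
  have "dfn L (Inl ` {..<n} \<union> Inr ` E) ?R"
    by (rule dfn_not, rule dfn_msat[OF q, where \<xi> = Inl and \<eta> = Inr]) (use qE in auto)
  then obtain \<chi> \<rho> where "dfn_by L (Inl ` {..<n} \<union> Inr ` E) ?R \<chi> \<rho>" by (rule dfnE)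
  note chi = dfn_byD[OF this]
  define sx where "sx x v = (case \<rho> v of Inl i \<Rightarrow> Inl (x ! i) | Inr u \<Rightarrow> Inr u)" for x :: "'a list" and v
  have chi_sat: "sat K (case_sum id h \<circ> sx x) \<chi> \<longleftrightarrow> \<not> msat K n q (\<lambda>i. x ! i) h"
    if K: "is_struct L K" "x \<in> tuples K n" "h ` E \<subseteq> univ K" for K :: "('f, 'r, 'a) struct" and x h
  proof -
    obtain c where c: "c \<in> univ K" using K(1) by (auto simp: is_struct_def)
    define e where "e w = (case w of Inl i \<Rightarrow> if i < n then x ! i else c | Inr u \<Rightarrow> if u \<in> E then h u else c)" for w
    have "e w \<in> univ K" for w using K(2,3) c by (auto simp: e_def tuples_def split: sum.splits)
    then have e: "range e \<subseteq> univ K" by blast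
    have "sat K (case_sum id h \<circ> sx x) \<chi> = sat K (e \<circ> \<rho>) \<chi>"
    proof (rule sat_cong)
      fix v assume "v \<in> fv \<chi>"
      then have "\<rho> v \<in> Inl ` {..<n} \<union> Inr ` E" using chi(2) by blast
      then show "(case_sum id h \<circ> sx x) v = (e \<circ> \<rho>) v" by (auto simp: sx_def e_def)
    qed
    also have "\<dots> = ?R K e" by (rule chi(3)[symmetric, OF K(1) e])
    also have "msat K n q (\<lambda>i. e (Inl i)) (\<lambda>u. e (Inr u)) = msat K n q (\<lambda>i. x ! i) h"
      by (rule msat_cong[OF q(2)]) (use qE in \<open>auto simp: e_def\<close>)
    finally show ?thesis .
  qed
  define \<Phi> where "\<Phi> = {(\<phi>, e). fm_in L \<phi> \<and> e ` fv \<phi> \<subseteq> B \<union> E \<and> sat M e \<phi>}"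
  define G1 :: "('f, 'r) fm \<times> (nat \<Rightarrow> 'a) \<Rightarrow> ('f, 'r) fm \<times> (nat \<Rightarrow> 'a + 'a)"
    where "G1 = (\<lambda>(\<phi>, e). (\<phi>, Inr \<circ> e))"
  define G2 :: "'a \<Rightarrow> ('f, 'r) fm \<times> (nat \<Rightarrow> 'a + 'a)"
    where "G2 = (\<lambda>u. (Eq (Var 0) (Var 1), \<lambda>v. if v = 0 then Inr u else Inl (f u)))"
  define G3 :: "'a list \<Rightarrow> ('f, 'r) fm \<times> (nat \<Rightarrow> 'a + 'a)"
    where "G3 = (\<lambda>x. (\<chi>, sx x))"
  define \<Gamma> where "\<Gamma> = G1 ` \<Phi> \<union> (G2 ` B \<union> G3 ` tuples P n)"
  have "\<exists>Q h. is_struct L Q \<and> elem_sub L P Q \<and> |univ Q| \<le>o |Field lambda| \<and> h ` (B \<union> E) \<subseteq> univ Q \<and>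
     (\<forall>(\<phi>, \<sigma>)\<in>\<Gamma>. sat Q (case_sum id h \<circ> \<sigma>) \<phi>)"
  proof (rule realize_extension[OF Ps L V toF[OF P(2)] ZU])
    fix \<phi> \<sigma> assume "(\<phi>, \<sigma>) \<in> \<Gamma>"
    then consider "(\<phi>, \<sigma>) \<in> G1 ` \<Phi>" | "(\<phi>, \<sigma>) \<in> G2 ` B" | "(\<phi>, \<sigma>) \<in> G3 ` tuples P n"
      unfolding \<Gamma>_def by blast
    then show "fm_in L \<phi> \<and> \<sigma> ` fv \<phi> \<subseteq> Inl ` univ P \<union> Inr ` (B \<union> E)"
    proof cases
      case 1
      then show ?thesis by (auto simp: G1_def \<Phi>_def)
    next
      case 2
      then show ?thesis using f(2) by (auto simp: G2_def image_subset_iff)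
    next
      case 3
      then obtain x where x: "x \<in> tuples P n" "\<phi> = \<chi>" "\<sigma> = sx x" by (auto simp: G3_def)
      have "sx x v \<in> Inl ` univ P \<union> Inr ` (B \<union> E)" if "v \<in> fv \<chi>" for v
      proof -
        have "\<rho> v \<in> Inl ` {..<n} \<union> Inr ` E" using chi(2) that by blast
        then show ?thesis using x(1) by (auto simp: sx_def tuples_def)
      qed
      then show ?thesis using x chi(1) by (auto simp: image_subset_iff)
    qed
  next
    fix G assume G: "finite G" "G \<subseteq> \<Gamma>"
    have "finite (G \<inter> G1 ` \<Phi>)" "finite (G \<inter> G3 ` tuples P n)" using G(1) by simp_all
    then obtain \<Phi>0 X0 where \<Phi>0: "\<Phi>0 \<subseteq> \<Phi>" "finite \<Phi>0" "G \<inter> G1 ` \<Phi> = G1 ` \<Phi>0"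
      and X0: "X0 \<subseteq> tuples P n" "finite X0" "G \<inter> G3 ` tuples P n = G3 ` X0"
      by (metis finite_subset_image Int_lower2)
    obtain xl where xl: "set xl = X0" using finite_list[OF X0(2)] by blast
    have "\<exists>h. range h \<subseteq> univ P \<and> (\<forall>u\<in>B. h u = f u) \<and> (\<forall>(\<phi>, e)\<in>\<Phi>0. sat P (h \<circ> e) \<phi>) \<and>
      (\<forall>x\<in>set xl. \<not> msat P n q (\<lambda>i. x ! i) h)"
    proof (rule avoid_finite[OF T st l lU L M via q B(1,2) P(1) f E \<Phi>0(2)])
      show "fm_in L \<phi> \<and> e ` fv \<phi> \<subseteq> B \<union> E \<and> sat M e \<phi>" if "(\<phi>, e) \<in> \<Phi>0" for \<phi> e
        using that \<Phi>0(1) unfolding \<Phi>_def by blast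
      show "set xl \<subseteq> tuples P n" using xl X0(1) by simp
    qed
    then obtain h where h: "range h \<subseteq> univ P" "\<forall>u\<in>B. h u = f u" "\<forall>(\<phi>, e)\<in>\<Phi>0. sat P (h \<circ> e) \<phi>"
      "\<forall>x\<in>set xl. \<not> msat P n q (\<lambda>i. x ! i) h" by (elim exE conjE)
    have "sat P (case_sum id h \<circ> \<sigma>) \<phi>" if p: "(\<phi>, \<sigma>) \<in> G" for \<phi> \<sigma>
    proof -
      consider "(\<phi>, \<sigma>) \<in> G1 ` \<Phi>0" | "(\<phi>, \<sigma>) \<in> G2 ` B" | "(\<phi>, \<sigma>) \<in> G3 ` X0"
        using p G(2) \<Phi>0(3) X0(3) unfolding \<Gamma>_def by blast
      then show ?thesis
      proof cases
        case 1
        then obtain e where e: "(\<phi>, e) \<in> \<Phi>0" "\<sigma> = Inr \<circ> e" by (auto simp: G1_def)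
        have "case_sum id h \<circ> \<sigma> = h \<circ> e" using e(2) by (auto simp: fun_eq_iff)
        then show ?thesis using bspec[OF h(3) e(1)] by simp
      next
        case 2
        then show ?thesis using h(2) by (auto simp: G2_def)
      next
        case 3
        then obtain x where x: "x \<in> X0" "\<phi> = \<chi>" "\<sigma> = sx x" by (auto simp: G3_def)
        have "h ` E \<subseteq> univ P" using h(1) by blast
        then show ?thesis using chi_sat[OF Ps _ \<open>h ` E \<subseteq> univ P\<close>, of x] x h(4) xl X0(1) by auto
      qed
    qed
    then show "\<exists>h. range h \<subseteq> univ P \<and> (\<forall>(\<phi>, \<sigma>)\<in>G. sat P (case_sum id h \<circ> \<sigma>) \<phi>)"
      using h(1) by (intro exI[of _ h]) auto
  qed
  then obtain Q h where Q: "is_struct L Q" "elem_sub L P Q" "|univ Q| \<le>o |Field lambda|" "h ` (B \<union> E) \<subseteq> univ Q"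
    and sat: "\<forall>(\<phi>, \<sigma>)\<in>\<Gamma>. sat Q (case_sum id h \<circ> \<sigma>) \<phi>" by (elim exE conjE)
  have "h u = f u" if "u \<in> B" for u
  proof -
    have "G2 u \<in> \<Gamma>" using that by (auto simp: \<Gamma>_def)
    from bspec[OF sat this] show ?thesis by (simp add: G2_def)
  qed
  moreover have "pelem L M Q (B \<union> E) h"
  proof -
    have pos: "sat Q (h \<circ> e) \<phi>" if "fm_in L \<phi>" "e ` fv \<phi> \<subseteq> B \<union> E" "sat M e \<phi>" for \<phi> e
    proof -
      have "G1 (\<phi>, e) \<in> \<Gamma>" using that by (auto simp: \<Gamma>_def \<Phi>_def)
      from bspec[OF sat this] have "sat Q (case_sum id h \<circ> (Inr \<circ> e)) \<phi>" by (simp add: G1_def)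
      moreover have "case_sum id h \<circ> (Inr \<circ> e) = h \<circ> e" by auto
      ultimately show ?thesis by simp
    qed
    show ?thesis unfolding pelem_def
    proof (intro allI impI, elim conjE)
      fix \<phi> e assume p: "fm_in L \<phi>" "e ` fv \<phi> \<subseteq> B \<union> E"
      show "sat M e \<phi> = sat Q (h \<circ> e) \<phi>" using pos[OF p] pos[of "Neg \<phi>" e] p by auto
    qed
  qed
  moreover have "\<not> msat Q n q (\<lambda>i. x ! i) h" if x: "x \<in> tuples P n" for x
  proof -
    have "G3 x \<in> \<Gamma>" using x by (auto simp: \<Gamma>_def)
    from bspec[OF sat this] have "sat Q (case_sum id h \<circ> sx x) \<chi>" by (simp add: G3_def)
    moreover have "x \<in> tuples Q n" using x Q(2) by (auto simp: tuples_def elem_sub_def)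
    moreover have "h ` E \<subseteq> univ Q" using Q(4) by auto
    ultimately show ?thesis using chi_sat[OF Q(1), of x h] by simp
  qed
  moreover have "|univ Q| \<le>o lambda" by (rule ordLeq_ordIso_trans[OF Q(3) lF])
  ultimately show ?thesis using Q by (intro exI[of _ Q] exI[of _ h]) simp
qed

text \<open>Stage \<open>i\<close> fixes \<open>f\<close> on \<open>E i\<close>. The sets
  \<open>E i\<close> may overlap, so the value at \<open>u\<close> is taken from the first stage
  whose set contains \<open>u\<close>; by \<open>local\<close>, \<open>P i\<close> depends only on
  the values fixed up to stage \<open>i\<close>, so it survives all later stages.\<close>

lemma wo_dependent_choice:
  fixes r :: "'i rel" and P :: "'i \<Rightarrow> ('u \<Rightarrow> 'v) \<Rightarrow> bool"
  assumes r: "Well_order r"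
    and local: "\<And>i f g. i \<in> Field r \<Longrightarrow> P i f \<Longrightarrow> (\<And>j u. j \<in> under r i \<Longrightarrow> u \<in> E j \<Longrightarrow> f u = g u) \<Longrightarrow> P i g"
    and step: "\<And>i f. i \<in> Field r \<Longrightarrow> (\<And>j. j \<in> underS r i \<Longrightarrow> P j f) \<Longrightarrow>
       \<exists>g. (\<forall>j\<in>underS r i. \<forall>u\<in>E j. g u = f u) \<and> P i g"
  shows "\<exists>f. \<forall>i\<in>Field r. P i f"
proof -
  have wo: "wo_rel r" using r by (simp add: wo_rel_def)
  define first where "first u = wo_rel.minim r {i \<in> Field r. u \<in> E i}" for u
  have first: "first u \<in> Field r \<and> u \<in> E (first u) \<and> (first u, i) \<in> r" if "i \<in> Field r" "u \<in> E i" for u i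
  proof -
    let ?S = "{i \<in> Field r. u \<in> E i}"
    have S: "?S \<subseteq> Field r" "?S \<noteq> {}" using that by auto
    show ?thesis using wo_rel.minim_in[OF wo S] wo_rel.minim_least[OF wo S(1), of i] that by (auto simp: first_def)
  qed
  define step_fun where "step_fun H i = (SOME g. (\<forall>j\<in>underS r i. \<forall>u\<in>E j. g u = H (first u) u) \<and> P i g)"
    for H :: "'i \<Rightarrow> 'u \<Rightarrow> 'v" and i
  define H where "H = wo_rel.worec r step_fun"
  \<comment> \<open>\<open>step_fun\<close> consults \<open>H\<close> at \<open>first u\<close> for
    \<open>u\<close> in some \<open>E j\<close> with \<open>j\<close> below \<open>i\<close>, and
    such a stage is at most \<open>j\<close>.\<close>
  have adm: "wo_rel.adm_wo r step_fun"
    unfolding wo_rel.adm_wo_def[OF wo]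
  proof (intro allI impI)
    fix F G :: "'i \<Rightarrow> 'u \<Rightarrow> 'v" and i
    assume FG: "\<forall>j\<in>underS r i. F j = G j"
    have "F (first u) = G (first u)" if j: "j \<in> underS r i" "u \<in> E j" for j u
    proof -
      have "j \<in> Field r" "(j, i) \<in> r" "j \<noteq> i" using j(1) by (auto simp: underS_def Field_def)
      then have "(first u, j) \<in> r" using first j(2) by blast
      then have "(first u, i) \<in> r" using \<open>(j, i) \<in> r\<close> wo_rel.TRANS[OF wo] by (meson transD)
      moreover have "first u \<noteq> i"
        using \<open>(first u, j) \<in> r\<close> \<open>(j, i) \<in> r\<close> \<open>j \<noteq> i\<close> wo_rel.ANTISYM[OF wo] by (auto simp: antisym_def)
      ultimately show ?thesis using FG by (auto simp: underS_def)
    qed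
    then have "(\<forall>j\<in>underS r i. \<forall>u\<in>E j. g u = F (first u) u) \<longleftrightarrow> (\<forall>j\<in>underS r i. \<forall>u\<in>E j. g u = G (first u) u)"
      for g :: "'u \<Rightarrow> 'v" by simp
    then show "step_fun F i = step_fun G i" unfolding step_fun_def by simp
  qed
  have H: "H i = step_fun H i" for i
    unfolding H_def using wo_rel.worec_fixpoint[OF wo adm] by (rule fun_cong)
  define f where "f u = H (first u) u" for u
  have "P i f" if "i \<in> Field r" for i
    using that
  proof (induction i rule: wo_rel.well_order_induct[OF wo])
    case (1 i)
    have "P j f" if "j \<in> underS r i" for j
      using 1 that by (auto simp: underS_def Field_def)
    from step[OF 1(2) this] have "\<exists>g. (\<forall>j\<in>underS r i. \<forall>u\<in>E j. g u = H (first u) u) \<and> P i g"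
      unfolding f_def by blast
    from someI_ex[OF this] have g: "\<forall>j\<in>underS r i. \<forall>u\<in>E j. H i u = H (first u) u" "P i (H i)"
      unfolding step_fun_def[symmetric] H[symmetric] by simp_all
    show ?case
    proof (rule local[OF 1(2) g(2)])
      fix j u assume j: "j \<in> under r i" "u \<in> E j"
      show "H i u = f u"
      proof (cases "j = i")
        case False
        then have "j \<in> underS r i" using j(1) by (auto simp: under_def underS_def)
        then show ?thesis using g(1) j(2) by (simp add: f_def)
      next
        case True
        then have fi: "(first u, i) \<in> r" "u \<in> E (first u)" using first[OF 1(2)] j(2) by blast+
        show ?thesis
        proof (cases "first u = i")
          case True
          then show ?thesis by (simp add: f_def)
        next
          case False
          then have "first u \<in> underS r i" using fi(1) by (auto simp: underS_def)
          then show ?thesis using g(1) fi(2) by (simp add: f_def)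
        qed
      qed
    qed
  qed
  then show ?thesis by blast
qed

text \<open>If \<open>m\<close> had the property, the least cardinal with the property would exist
  and be at most \<open>m\<close>. As \<open>m\<close> is regular, the least regular cardinal above
  that one would also be at most \<open>m\<close>, so the hypothesis could not hold
  vacuously.\<close>

lemma less_kappa_r_not_kappa_prop:
  fixes m :: "'a rel"
  assumes m: "Cinfinite m" "regularCard m" and less: "less_kappa_r L T m"
  shows "\<not> kappa_prop L T m"
proof
  assume kp: "kappa_prop L T m"
  let ?K = "{k :: 'a rel. Cinfinite k \<and> kappa_prop L T k}"
  have "\<exists>k\<in>?K. \<forall>k'\<in>?K. k \<le>o k'" by (rule exists_minim_Card_order) (use m kp in auto)
  then obtain k where "k \<in> ?K" "\<forall>k'\<in>?K. k \<le>o k'" by (rule bexE)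
  then have k: "Cinfinite k" "kappa_prop L T k" "\<And>k' :: 'a rel. Cinfinite k' \<Longrightarrow> kappa_prop L T k' \<Longrightarrow> k \<le>o k'"
    by simp_all
  then have kap: "is_kappa L T k" by (simp add: is_kappa_def)
  let ?R = "{k' :: 'a rel. Cinfinite k' \<and> regularCard k' \<and> k \<le>o k'}"
  have mR: "m \<in> ?R" using m kp k(3) by simp
  have "\<exists>kr\<in>?R. \<forall>k'\<in>?R. kr \<le>o k'" by (rule exists_minim_Card_order) (use mR in auto)
  then obtain kr where kr: "kr \<in> ?R" "\<forall>k'\<in>?R. kr \<le>o k'" by (rule bexE)
  then have "is_kappa_r L T kr" using kap unfolding is_kappa_r_def by blast
  then have "m <o kr" using less by (simp add: less_kappa_r_def)
  moreover have "kr \<le>o m" using kr(2) mR by blast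
  ultimately show False using not_ordLess_ordLeq by blast
qed

section \<open>Limit models\<close>

definition limit_chain ::
  "('f, 'r) lang \<Rightarrow> ('f, 'r) fm set \<Rightarrow> 'a rel \<Rightarrow> 'a rel \<Rightarrow> ('a \<Rightarrow> ('f, 'r, 'a) struct) \<Rightarrow> ('f, 'r, 'a) struct \<Rightarrow> bool"
where
  "limit_chain L T l d M N \<longleftrightarrow> limit_ordinal d \<and>
     (\<forall>i\<in>Field d. is_model L T (M i) \<and> |univ (M i)| =o l) \<and>
     (\<forall>i j. i \<in> underS d j \<longrightarrow> elem_sub L (M i) (M j)) \<and>
     (\<forall>i j. succ_pos d i j \<longrightarrow> universal_over L T (M j) (M i)) \<and>
     is_model L T N \<and> (\<forall>i\<in>Field d. elem_sub L (M i) N) \<and> univ N = (\<Union>i\<in>Field d. univ (M i))"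

lemma limit_model_chain:
  assumes "limit_model L T l d N" shows "\<exists>M. limit_chain L T l d M N"
proof -
  obtain M where "\<forall>i\<in>Field d. is_model L T (M i) \<and> |univ (M i)| =o l"
    "\<forall>i j. i \<in> underS d j \<longrightarrow> elem_sub L (M i) (M j)"
    "\<forall>i j. succ_pos d i j \<longrightarrow> universal_over L T (M j) (M i)"
    "is_model L T N" "\<forall>i\<in>Field d. elem_sub L (M i) N" "univ N = (\<Union>i\<in>Field d. univ (M i))" "limit_ordinal d"
    using assms unfolding limit_model_def by (elim exE conjE)
  then show ?thesis unfolding limit_chain_def by (intro exI[of _ M] conjI)
qed

lemma limit_chainD:
  assumes "limit_chain L T l d M N"
  shows "limit_ordinal d" "i \<in> Field d \<Longrightarrow> is_model L T (M i)" "i \<in> Field d \<Longrightarrow> |univ (M i)| =o l"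
    "i \<in> underS d j \<Longrightarrow> elem_sub L (M i) (M j)" "succ_pos d i j \<Longrightarrow> universal_over L T (M j) (M i)"
    "is_model L T N" "i \<in> Field d \<Longrightarrow> elem_sub L (M i) N" "univ N = (\<Union>i\<in>Field d. univ (M i))"
  using assms unfolding limit_chain_def by simp_all

lemma limit_chain_mono:
  assumes "limit_chain L T l d M N" "(i, j) \<in> d"
  shows "univ (M i) \<subseteq> univ (M j)"
proof (cases "i = j")
  case False
  then have "elem_sub L (M i) (M j)" using assms(2) by (intro limit_chainD(4)[OF assms(1)]) (simp add: underS_def)
  then show ?thesis by (simp add: elem_sub_def)
qed simp

lemma ex_succ_pos:
  assumes "limit_ordinal d" "i \<in> Field d"
  shows "\<exists>j. succ_pos d i j"
proof -
  have wo: "wo_rel d" using assms(1) by (simp add: limit_ordinal_def wo_rel_def)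
  define S where "S = {j \<in> Field d. i \<in> underS d j}"
  have S: "S \<subseteq> Field d" "S \<noteq> {}"
    using assms by (auto simp: S_def limit_ordinal_def underS_def Field_def)
  define j where "j = wo_rel.minim d S"
  have j: "j \<in> Field d" "i \<in> underS d j" and min: "\<And>k. k \<in> S \<Longrightarrow> (j, k) \<in> d"
    using wo_rel.minim_in[OF wo S] wo_rel.minim_least[OF wo S(1)] by (auto simp: S_def j_def)
  have "underS d j = under d i"
  proof (intro equalityI subsetI)
    fix k assume k: "k \<in> underS d j"
    then have kF: "k \<in> Field d" by (auto simp: underS_def Field_def)
    have "k \<notin> S"
      using min[of k] k wo_rel.ANTISYM[OF wo] by (auto simp: underS_def antisym_def)
    then have "i \<notin> underS d k" using kF by (simp add: S_def)
    moreover have "(i, k) \<in> d \<or> (k, i) \<in> d" using wo_rel.TOTALS[OF wo] assms(2) kF by blast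
    moreover have "(i, i) \<in> d" using wo_rel.REFL[OF wo] assms(2) by (simp add: refl_on_def)
    ultimately show "k \<in> under d i" by (auto simp: under_def underS_def)
  next
    fix k assume "k \<in> under d i"
    then have k: "(k, i) \<in> d" by (simp add: under_def)
    have ij: "(i, j) \<in> d" "i \<noteq> j" using j(2) by (simp_all add: underS_def)
    have "(k, j) \<in> d" using wo_rel.TRANS[OF wo] k ij(1) by (meson transD)
    moreover have "k \<noteq> j" using k ij wo_rel.ANTISYM[OF wo] by (auto simp: antisym_def)
    ultimately show "k \<in> underS d j" by (simp add: underS_def)
  qed
  then show ?thesis using assms(2) j(1) unfolding succ_pos_def by blast
qed

lemma elem_embedding_sub:
  assumes "elem_embedding L Q M k" "elem_sub L M N"
  shows "elem_embedding L Q N k"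
  unfolding elem_embedding_def
proof (intro conjI allI impI, goal_cases)
  case 1
  show ?case using assms by (auto simp: elem_embedding_def elem_sub_def)
next
  case (2 \<phi> e)
  then have "range (k \<circ> e) \<subseteq> univ M" using assms(1) by (auto simp: elem_embedding_def image_subset_iff)
  moreover have "sat Q e \<phi> = sat M (k \<circ> e) \<phi>" using assms(1) 2 by (simp add: elem_embedding_def)
  ultimately show ?case using assms(2) 2 by (simp add: elem_sub_def)
qed

text \<open>Containing \<open>M i\<close>, the extension \<open>Q\<close> has size exactly
  \<open>l\<close>, as the definition of universality demands; the successor model therefore
  receives \<open>Q\<close> over \<open>M i\<close>.\<close>

lemma limit_chain_universal:
  assumes C: "limit_chain L T l d M N" and T: "T \<subseteq> sentences L" and i: "i \<in> Field d"
    and Q: "is_struct L Q" "elem_sub L (M i) Q" "|univ Q| \<le>o l"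
  shows "\<exists>j k. succ_pos d i j \<and> elem_embedding L Q (M j) k \<and> elem_embedding L Q N k \<and> (\<forall>x\<in>univ (M i). k x = x)"
proof -
  obtain j where j: "succ_pos d i j" using ex_succ_pos[OF limit_chainD(1)[OF C] i] by (rule exE)
  then have jF: "j \<in> Field d" by (simp add: succ_pos_def)
  have "|univ (M i)| \<le>o |univ Q|" using Q(2) by (intro card_of_mono1) (simp add: elem_sub_def)
  then have "l \<le>o |univ Q|" by (rule ordIso_ordLeq_trans[OF ordIso_symmetric[OF limit_chainD(3)[OF C i]]])
  then have "|univ Q| =o l" using Q(3) by (simp add: ordIso_iff_ordLeq)
  then have "|univ Q| =o |univ (M j)|" by (rule ordIso_transitive[OF _ ordIso_symmetric[OF limit_chainD(3)[OF C jF]]])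
  moreover have "is_model L T Q" by (rule is_model_elem_sub[OF limit_chainD(2)[OF C i] Q(2,1) T])
  moreover have "universal_over L T (M j) (M i)" by (rule limit_chainD(5)[OF C j])
  ultimately have "\<exists>h. elem_embedding L Q (M j) h \<and> (\<forall>x\<in>univ (M i). h x = x)"
    using Q(2) by (simp add: universal_over_def)
  then obtain h where h: "elem_embedding L Q (M j) h" "\<forall>x\<in>univ (M i). h x = x" by (elim exE conjE)
  then show ?thesis using j elem_embedding_sub[OF h(1) limit_chainD(7)[OF C jF]] by blast
qed

lemma msat_embed:
  assumes k: "elem_embedding L Q N k" and ne: "univ Q \<noteq> {}" and q: "q \<subseteq> pfmls L n A"
    and x: "\<And>i. i < n \<Longrightarrow> x i \<in> univ Q" and h: "\<And>\<phi> b u. (\<phi>, b) \<in> q \<Longrightarrow> u \<in> set b \<Longrightarrow> h u \<in> univ Q"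
  shows "msat Q n q x h \<longleftrightarrow> msat N n q (k \<circ> x) (k \<circ> h)"
proof -
  have "sat Q (\<lambda>i. if i < n then x i else h (b ! (i - n))) \<phi> =
      sat N (\<lambda>i. if i < n then (k \<circ> x) i else (k \<circ> h) (b ! (i - n))) \<phi>" if p: "(\<phi>, b) \<in> q" for \<phi> b
  proof -
    have b: "fm_in L \<phi>" "fv \<phi> \<subseteq> {..<n + length b}" using q p by (auto simp: pfmls_def)
    have "sat Q (\<lambda>i. if i < n then x i else h (b ! (i - n))) \<phi> =
      sat N (k \<circ> (\<lambda>i. if i < n then x i else h (b ! (i - n)))) \<phi>"
    proof (rule elem_embeddingD[OF k ne b(1)])
      fix v assume "v \<in> fv \<phi>"
      then have "v < n + length b" using b(2) by blast
      then show "(if v < n then x v else h (b ! (v - n))) \<in> univ Q"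
        using x[of v] h[OF p, of "b ! (v - n)"] by auto
    qed
    also have "k \<circ> (\<lambda>i. if i < n then x i else h (b ! (i - n))) =
      (\<lambda>i. if i < n then (k \<circ> x) i else (k \<circ> h) (b ! (i - n)))" by auto
    finally show ?thesis .
  qed
  then show ?thesis unfolding msat_def by auto
qed

lemma isomorphic_elem_embedding:
  assumes M: "is_struct L M" and iso: "isomorphic L M N"
  shows "\<exists>h. bij_betw h (univ M) (univ N) \<and> elem_embedding L M N h"
proof -
  obtain h where bij: "bij_betw h (univ M) (univ N)"
    and fn: "\<forall>f\<in>funs L. \<forall>xs\<in>lists (univ M). length xs = farity L f \<longrightarrow> h (fint M f xs) = fint N f (map h xs)"
    and rl: "\<forall>r\<in>rels L. \<forall>xs\<in>lists (univ M). length xs = rarity L r \<longrightarrow> (rint M r xs \<longleftrightarrow> rint N r (map h xs))"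
    using iso unfolding isomorphic_def by (elim exE conjE)
  have tm: "eval_tm N (h \<circ> e) t = h (eval_tm M e t)" if e: "range e \<subseteq> univ M" and t: "tm_in L t" for e t
    using t
  proof (induction t)
    case (Fun f ts)
    have "map (eval_tm N (h \<circ> e)) ts = map h (map (eval_tm M e) ts)" using Fun by (simp add: comp_def)
    moreover have "map (eval_tm M e) ts \<in> lists (univ M)"
      using Fun.prems e by (auto simp: image_subset_iff intro!: eval_tm_in_univ[OF M])
    then have "h (fint M f (map (eval_tm M e) ts)) = fint N f (map h (map (eval_tm M e) ts))"
      using fn Fun.prems by simp
    ultimately show ?case by (simp only: eval_tm.simps)
  qed simp
  have "sat M e \<phi> = sat N (h \<circ> e) \<phi>" if "fm_in L \<phi>" "range e \<subseteq> univ M" for \<phi> e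
    using that
  proof (induction \<phi> arbitrary: e)
    case (Eq s t)
    have "eval_tm M e s \<in> univ M" "eval_tm M e t \<in> univ M" using Eq by (auto intro!: eval_tm_in_univ[OF M])
    moreover have "inj_on h (univ M)" using bij by (simp add: bij_betw_def)
    ultimately show ?case using Eq by (simp add: tm inj_on_eq_iff del: o_apply)
  next
    case (Rel r ts)
    have "map (eval_tm N (h \<circ> e)) ts = map h (map (eval_tm M e) ts)" using Rel by (simp add: tm)
    moreover have "map (eval_tm M e) ts \<in> lists (univ M)"
      using Rel by (auto simp: image_subset_iff intro!: eval_tm_in_univ[OF M])
    then have "rint M r (map (eval_tm M e) ts) = rint N r (map h (map (eval_tm M e) ts))"
      using rl Rel.prems by simp
    ultimately show ?case by (simp only: sat.simps)
  next
    case (Ex v \<phi>)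
    have upd: "(h \<circ> e)(v := h x) = h \<circ> e(v := x)" for x by auto
    have IH: "sat M (e(v := x)) \<phi> = sat N (h \<circ> e(v := x)) \<phi>" if "x \<in> univ M" for x
      by (rule Ex.IH) (use Ex.prems that in auto)
    have "univ N = h ` univ M" using bij by (simp add: bij_betw_def)
    then have "sat N (h \<circ> e) (Ex v \<phi>) \<longleftrightarrow> (\<exists>x\<in>univ M. sat N ((h \<circ> e)(v := h x)) \<phi>)"
      by (simp only: sat.simps) blast
    then show ?case unfolding upd using IH by (simp only: sat.simps) blast
  qed auto
  then show ?thesis using bij unfolding elem_embedding_def bij_betw_def by (intro exI[of _ h]) auto
qed

lemma complete_theory_equiv:
  fixes M N :: "('f, 'r, 'a) struct"
  assumes T: "complete_theory TYPE('a) L T" and M: "is_model L T M" and N: "is_model L T N"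
    and \<phi>: "fm_in L \<phi>" "fv \<phi> = {}"
  shows "sat M e \<phi> = sat N e' \<phi>"
proof -
  have s: "is_struct L M" "is_struct L N" using M N by (simp_all add: is_model_def)
  have "\<phi> \<in> sentences L" using \<phi> by (simp add: sentences_def)
  then consider "entails TYPE('a) L T \<phi>" | "entails TYPE('a) L T (Neg \<phi>)" using T unfolding complete_theory_def by blast
  then show ?thesis
  proof cases
    case 1
    then have "holds M \<phi>" "holds N \<phi>" using M N unfolding entails_def by blast+
    then show ?thesis using holds_sentence[OF s(1) \<phi>(2)] holds_sentence[OF s(2) \<phi>(2)] by blast
  next
    case 2
    then have "holds M (Neg \<phi>)" "holds N (Neg \<phi>)" using M N unfolding entails_def by blast+
    moreover have "fv (Neg \<phi>) = {}" using \<phi> by simp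
    ultimately have "sat M e (Neg \<phi>)" "sat N e' (Neg \<phi>)"
      using holds_sentence[OF s(1)] holds_sentence[OF s(2)] by blast+
    then show ?thesis by simp
  qed
qed

lemma finite_max_in:
  assumes wo: "wo_rel r" and "finite I" "I \<noteq> {}" "I \<subseteq> Field r"
  shows "\<exists>m\<in>I. \<forall>i\<in>I. (i, m) \<in> r"
  using assms(2-)
proof (induction I rule: finite_ne_induct)
  case (singleton x)
  then show ?case using wo_rel.REFL[OF wo] by (simp add: refl_on_def)
next
  case (insert x I)
  then obtain m where m: "m \<in> I" "\<forall>i\<in>I. (i, m) \<in> r" by auto
  have F: "x \<in> Field r" "m \<in> Field r" using insert m by auto
  then consider "(x, m) \<in> r" | "(m, x) \<in> r" using wo_rel.TOTALS[OF wo] by blast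
  then show ?case
  proof cases
    case 1
    then show ?thesis using m by blast
  next
    case 2
    have "(i, x) \<in> r" if "i \<in> I" for i using m that 2 wo_rel.TRANS[OF wo] by (meson transD)
    moreover have "(x, x) \<in> r" using wo_rel.REFL[OF wo] F by (simp add: refl_on_def)
    ultimately show ?thesis by blast
  qed
qed

text \<open>The finitely many elements in a formula appear at finitely many stages, and the largest
  of these takes care of it. A sentence has no such stage, and \<open>I\<close> may be empty, so
  sentences are covered by \<open>eq\<close>.\<close>

lemma pelem_UN:
  assumes wo: "wo_rel r" and I: "I \<subseteq> Field r"
    and p: "\<And>i. i \<in> I \<Longrightarrow> pelem L M P (\<Union>j\<in>under r i. E j) f"
    and eq: "\<And>\<phi> e e'. fm_in L \<phi> \<Longrightarrow> fv \<phi> = {} \<Longrightarrow> sat M e \<phi> = sat P e' \<phi>"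
  shows "pelem L M P (\<Union>i\<in>I. E i) f"
  unfolding pelem_def
proof (intro allI impI, elim conjE)
  fix \<phi> e assume \<phi>: "fm_in L \<phi>" "e ` fv \<phi> \<subseteq> (\<Union>i\<in>I. E i)"
  show "sat M e \<phi> = sat P (f \<circ> e) \<phi>"
  proof (cases "fv \<phi> = {}")
    case True
    then show ?thesis using eq \<phi>(1) by blast
  next
    case False
    have "\<forall>v\<in>fv \<phi>. \<exists>i. i \<in> I \<and> e v \<in> E i" using \<phi>(2) by blast
    from bchoice[OF this] obtain ix where ix: "\<forall>v\<in>fv \<phi>. ix v \<in> I \<and> e v \<in> E (ix v)" by (rule exE)
    have "\<exists>m\<in>ix ` fv \<phi>. \<forall>i\<in>ix ` fv \<phi>. (i, m) \<in> r"
      by (rule finite_max_in[OF wo]) (use False ix I in auto)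
    then obtain m where m: "m \<in> ix ` fv \<phi>" "\<forall>i\<in>ix ` fv \<phi>. (i, m) \<in> r" by (rule bexE)
    have "m \<in> I" using m(1) ix by auto
    from p[OF this] show ?thesis
    proof (rule pelemD[OF _ \<phi>(1)])
      fix v assume v: "v \<in> fv \<phi>"
      then have "ix v \<in> under r m" using m(2) by (simp add: under_def)
      then show "e v \<in> (\<Union>j\<in>under r m. E j)" using ix v by blast
    qed
  qed
qed

text \<open>At stage \<open>i\<close> the images of the earlier parameters lie in
  \<open>Mc i\<close>, so \<open>avoid_extension\<close> applies to \<open>Mc i\<close>.
  Universality of the next model brings the extension back into the chain over \<open>Mc i\<close>,
  and avoidance, being preserved by elementary embeddings, holds in \<open>N\<close>.\<close>

lemma omitting_chain:
  fixes lambda mu :: "'a rel" and N :: "('f, 'r, 'a) struct"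
  assumes T: "complete_theory TYPE('a) L T" and st: "stable_in L T lambda"
    and l: "Card_order lambda" "infinite (Field lambda)" and lU: "lambda <o |UNIV :: 'a set|"
    and L: "big L (Field lambda)"
    and mu: "Cinfinite mu" "regularCard mu" "mu \<le>o lambda" and C: "limit_chain L T lambda mu Mc N"
    and M: "is_model L T M"
    and q: "\<And>i. i \<in> Field mu \<Longrightarrow> finite (q i) \<and> q i \<subseteq> pfmls L n (univ M) \<and> forks_via L M n (q i) (A i)"
    and E: "\<And>i. E i = \<Union> (set ` snd ` q i)"
    and EA: "\<And>i j. i \<in> Field mu \<Longrightarrow> j \<in> underS mu i \<Longrightarrow> E j \<subseteq> A i"
  shows "\<exists>f. pelem L M N (\<Union>i\<in>Field mu. E i) f \<and> f ` (\<Union>i\<in>Field mu. E i) \<subseteq> univ N \<and>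
    (\<forall>i\<in>Field mu. \<forall>x\<in>tuples (Mc i) n. \<not> msat N n (q i) (\<lambda>v. x ! v) f)"
proof -
  have Ts: "T \<subseteq> sentences L" using T by (simp add: complete_theory_def)
  have Wo: "Well_order mu" using mu(1) by (simp add: card_order_on_def)
  then have wo: "wo_rel mu" by (simp add: wo_rel_def)
  have Ns: "is_model L T N" by (rule limit_chainD(6)[OF C])
  note sent = complete_theory_equiv[OF T]
  \<comment> \<open>The image of \<open>E i\<close> must lie in the successor model: for
    \<open>j\<close> below \<open>i\<close> the successor of \<open>j\<close> is at most
    \<open>i\<close>, which puts the images of all earlier parameters into
    \<open>Mc i\<close>.\<close>
  define P where "P i f \<longleftrightarrow> pelem L M N (\<Union>j\<in>under mu i. E j) f \<and>
    (\<exists>j. succ_pos mu i j \<and> f ` E i \<subseteq> univ (Mc j)) \<and>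
    (\<forall>x\<in>tuples (Mc i) n. \<not> msat N n (q i) (\<lambda>v. x ! v) f)" for i f
  have under_refl: "i \<in> under mu i" if "i \<in> Field mu" for i
    using wo_rel.REFL[OF wo] that by (simp add: under_def refl_on_def)
  have qE: "u \<in> E i" if "(\<phi>, b) \<in> q i" "u \<in> set b" for \<phi> b u i using that by (force simp: E)
  have "\<exists>f. \<forall>i\<in>Field mu. P i f"
  proof (rule wo_dependent_choice[OF Wo, of P E])
    fix i f g assume i: "i \<in> Field mu" and Pf: "P i f" and fg: "\<And>j u. j \<in> under mu i \<Longrightarrow> u \<in> E j \<Longrightarrow> f u = g u"
    have fE: "f u = g u" if "u \<in> E i" for u using fg[OF under_refl[OF i] that] .
    have "pelem L M N (\<Union>j\<in>under mu i. E j) g"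
      unfolding pelem_def
    proof (intro allI impI, elim conjE)
      fix \<phi> e assume \<phi>: "fm_in L \<phi>" "e ` fv \<phi> \<subseteq> (\<Union>j\<in>under mu i. E j)"
      have "sat M e \<phi> = sat N (f \<circ> e) \<phi>" using Pf \<phi> unfolding P_def pelem_def by blast
      also have "\<dots> = sat N (g \<circ> e) \<phi>"
      proof (rule sat_cong)
        fix v assume "v \<in> fv \<phi>"
        then have "e v \<in> (\<Union>j\<in>under mu i. E j)" using \<phi>(2) by blast
        then show "(f \<circ> e) v = (g \<circ> e) v" using fg by auto
      qed
      finally show "sat M e \<phi> = sat N (g \<circ> e) \<phi>" .
    qed
    moreover have "g ` E i = f ` E i" by (rule image_cong) (simp_all add: fE)
    moreover have "msat N n (q i) (\<lambda>v. x ! v) g = msat N n (q i) (\<lambda>v. x ! v) f" for x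
      by (rule msat_cong[of _ L n "univ M"]) (use q[OF i] fE qE in simp_all)
    ultimately show "P i g" using Pf unfolding P_def by simp
  next
    fix i f assume i: "i \<in> Field mu" and Pf: "\<And>j. j \<in> underS mu i \<Longrightarrow> P j f"
    define B where "B = (\<Union>j\<in>underS mu i. E j)"
    have usF: "underS mu i \<subseteq> Field mu" by (auto simp: underS_def Field_def)
    have qi: "finite (q i)" "q i \<subseteq> pfmls L n (univ M)" "forks_via L M n (q i) (A i)" using q[OF i] by simp_all
    have finE: "finite (E j)" if "j \<in> Field mu" for j using q[OF that] by (simp add: E)
    have EM: "E j \<subseteq> univ M" if "j \<in> Field mu" for j using q[OF that] by (fastforce simp: E pfmls_def)
    have BA: "B \<subseteq> A i" unfolding B_def using EA[OF i] by blast
    have BM: "B \<subseteq> univ M" unfolding B_def using EM usF by blast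
    have "|underS mu i| \<le>o lambda"
      by (rule ordLeq_transitive[OF ordLess_imp_ordLeq[OF card_of_underS] mu(3)]) (use mu(1) i in simp_all)
    then have Bl: "|B| \<le>o lambda" unfolding B_def
      by (rule card_of_UNION_ordLeq_infinite_Field[OF l(2,1)]) (use finE usF infinite_card_le[OF l] in blast)
    have Pi: "is_model L T (Mc i)" by (rule limit_chainD(2)[OF C i])
    have Pne: "univ (Mc i) \<noteq> {}" using Pi by (simp add: is_model_def is_struct_def)
    have Pl: "|univ (Mc i)| \<le>o lambda" using limit_chainD(3)[OF C i] by (rule ordIso_imp_ordLeq)
    have PN: "elem_sub L (Mc i) N" by (rule limit_chainD(7)[OF C i])
    have fB: "f ` B \<subseteq> univ (Mc i)"
    proof -
      have "f ` E j \<subseteq> univ (Mc i)" if j: "j \<in> underS mu i" for j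
      proof -
        obtain s where s: "succ_pos mu j s" "f ` E j \<subseteq> univ (Mc s)" using Pf[OF j] unfolding P_def by blast
        have "i \<notin> underS mu s"
        proof
          assume "i \<in> underS mu s"
          then have "i \<in> under mu j" using s(1) by (simp add: succ_pos_def)
          then show False using j wo_rel.ANTISYM[OF wo] by (auto simp: under_def underS_def antisym_def)
        qed
        moreover have "s \<in> Field mu" using s(1) by (simp add: succ_pos_def)
        ultimately have "(s, i) \<in> mu" using wo_rel.TOTALS[OF wo] i by (auto simp: underS_def)
        then show ?thesis using limit_chain_mono[OF C] s(2) by blast
      qed
      then show ?thesis unfolding B_def by blast
    qed
    have fN: "pelem L M N B f" unfolding B_def
      by (rule pelem_UN[OF wo usF _ sent[OF M Ns]]) (use Pf in \<open>auto simp: P_def\<close>)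
    have fP: "pelem L M (Mc i) B f"
      unfolding pelem_def
    proof (intro allI impI, elim conjE)
      fix \<phi> e assume \<phi>: "fm_in L \<phi>" "e ` fv \<phi> \<subseteq> B"
      have "sat M e \<phi> = sat N (f \<circ> e) \<phi>" using fN \<phi> unfolding pelem_def by blast
      also have "\<dots> = sat (Mc i) (f \<circ> e) \<phi>"
        by (rule elem_subD[OF PN Pne \<phi>(1), symmetric]) (use \<phi>(2) fB in auto)
      finally show "sat M e \<phi> = sat (Mc i) (f \<circ> e) \<phi>" .
    qed
    obtain Q h where Q: "is_struct L Q" "elem_sub L (Mc i) Q" "|univ Q| \<le>o lambda" and hB: "\<forall>u\<in>B. h u = f u"
      and hp: "pelem L M Q (B \<union> E i) h" and hQ: "h ` (B \<union> E i) \<subseteq> univ Q"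
      and av: "\<forall>x\<in>tuples (Mc i) n. \<not> msat Q n (q i) (\<lambda>v. x ! v) h"
      using avoid_extension[OF Ts st l lU L M qi(3,1,2) BA BM Bl Pi Pl fP fB E] by (elim exE conjE)
    have Qne: "univ Q \<noteq> {}" using Q(1) by (simp add: is_struct_def)
    obtain s k where s: "succ_pos mu i s" and k: "elem_embedding L Q (Mc s) k" "elem_embedding L Q N k"
      "\<forall>x\<in>univ (Mc i). k x = x"
      using limit_chain_universal[OF C Ts i Q] by (elim exE conjE)
    have under_i: "(\<Union>j\<in>under mu i. E j) = B \<union> E i"
    proof -
      have "under mu i = insert i (underS mu i)" using under_refl[OF i] by (auto simp: under_def underS_def)
      then show ?thesis by (auto simp: B_def)
    qed
    have "P i (k \<circ> h)" unfolding P_def under_i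
    proof (intro conjI)
      show "pelem L M N (B \<union> E i) (k \<circ> h)"
        unfolding pelem_def
      proof (intro allI impI, elim conjE)
        fix \<phi> e assume \<phi>: "fm_in L \<phi>" "e ` fv \<phi> \<subseteq> B \<union> E i"
        have "sat M e \<phi> = sat Q (h \<circ> e) \<phi>" using hp \<phi> unfolding pelem_def by blast
        also have "\<dots> = sat N (k \<circ> (h \<circ> e)) \<phi>"
          by (rule elem_embeddingD[OF k(2) Qne \<phi>(1)]) (use \<phi>(2) hQ in auto)
        finally show "sat M e \<phi> = sat N (k \<circ> h \<circ> e) \<phi>" by (simp add: o_assoc)
      qed
      have "(k \<circ> h) ` E i \<subseteq> univ (Mc s)" using k(1) hQ unfolding elem_embedding_def by auto
      then show "\<exists>j. succ_pos mu i j \<and> (k \<circ> h) ` E i \<subseteq> univ (Mc j)" using s by blast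
      show "\<forall>x\<in>tuples (Mc i) n. \<not> msat N n (q i) (\<lambda>v. x ! v) (k \<circ> h)"
      proof
        fix x assume x: "x \<in> tuples (Mc i) n"
        have xi: "x ! v \<in> univ (Mc i)" if "v < n" for v using x that by (auto simp: tuples_def)
        have "msat Q n (q i) (\<lambda>v. x ! v) h \<longleftrightarrow> msat N n (q i) (k \<circ> (\<lambda>v. x ! v)) (k \<circ> h)"
          by (rule msat_embed[OF k(2) Qne qi(2)]) (use xi Q(2) hQ qE in \<open>auto simp: elem_sub_def\<close>)
        also have "\<dots> \<longleftrightarrow> msat N n (q i) (\<lambda>v. x ! v) (k \<circ> h)"
          by (rule msat_cong[OF qi(2)]) (use k(3) xi in auto)
        finally show "\<not> msat N n (q i) (\<lambda>v. x ! v) (k \<circ> h)" using av x by blast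
      qed
    qed
    moreover have "(k \<circ> h) u = f u" if "j \<in> underS mu i" "u \<in> E j" for j u
    proof -
      have "u \<in> B" using that by (auto simp: B_def)
      then have "h u = f u" "f u \<in> univ (Mc i)" using hB fB by auto
      then show ?thesis using k(3) by simp
    qed
    ultimately show "\<exists>g. (\<forall>j\<in>underS mu i. \<forall>u\<in>E j. g u = f u) \<and> P i g" by blast
  qed
  then obtain f where f: "\<forall>i\<in>Field mu. P i f" by (rule exE)
  have "pelem L M N (\<Union>i\<in>Field mu. E i) f"
    by (rule pelem_UN[OF wo _ _ sent[OF M Ns]]) (use f in \<open>auto simp: P_def\<close>)
  moreover have "f ` E i \<subseteq> univ N" if i: "i \<in> Field mu" for i
  proof -
    obtain s where "succ_pos mu i s" "f ` E i \<subseteq> univ (Mc s)" using f i unfolding P_def by blast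
    then show ?thesis unfolding limit_chainD(8)[OF C] succ_pos_def by blast
  qed
  then have "f ` (\<Union>i\<in>Field mu. E i) \<subseteq> univ N" by blast
  ultimately show ?thesis using f unfolding P_def by blast
qed

lemma ordLess_UN_finite:
  assumes "Cinfinite mu" "regularCard mu" "|I| <o mu" "\<And>i. i \<in> I \<Longrightarrow> finite (E i)"
  shows "|\<Union>i\<in>I. E i| <o mu"
proof (rule card_of_UNION_ordLess_infinite_Field_regularCard[OF assms(2,1,3)], rule ballI)
  fix i assume "i \<in> I"
  then show "|E i| <o mu" using assms(1,4)
    by (intro finite_ordLess_infinite)
      (auto simp: cinfinite_def Field_card_of card_of_well_order_on card_order_on_def)
qed

text \<open>As \<open>B\<close> has fewer than \<open>mu\<close> elements, regularity of
  \<open>mu\<close> puts its image into a single \<open>Mc j\<close>. The copied type is realized in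
  an extension of \<open>Mc j\<close> of size at most \<lambda>, which universality embeds into
  \<open>N\<close> over \<open>Mc j\<close>.\<close>

lemma realizing_chain:
  fixes lambda mu :: "'a rel" and N :: "('f, 'r, 'a) struct"
  assumes T: "T \<subseteq> sentences L"
    and l: "Card_order lambda" "infinite (Field lambda)" and lU: "lambda <o |UNIV :: 'a set|"
    and L: "big L (Field lambda)"
    and mu: "Cinfinite mu" "regularCard mu" and C: "limit_chain L T lambda mu Mc N"
    and M: "is_model L T M" and p: "complete_type L M n A p" and AM: "A \<subseteq> univ M"
    and q: "q \<subseteq> p" "\<Union> (set ` snd ` q) \<subseteq> B" and B: "B \<subseteq> univ M" "|B| <o mu"
    and f: "pelem L M N B f" "f ` B \<subseteq> univ N"
  shows "\<exists>x. (\<forall>i<n. x i \<in> univ N) \<and> msat N n q x f"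
proof -
  have Ms: "is_struct L M" using M by (simp add: is_model_def)
  have lF: "|Field lambda| =o lambda" by (rule card_of_Field_ordIso[OF l(1)])
  have ZU: "|Field lambda| <o |UNIV :: 'a set|" by (rule ordIso_ordLess_trans[OF lF lU])
  have qpf: "q \<subseteq> pfmls L n A" using p q(1) by (auto simp: complete_type_def)
  have qB: "u \<in> B" if "(\<phi>, b) \<in> q" "u \<in> set b" for \<phi> b u using that q(2) by force
  have "\<exists>j\<in>Field mu. f ` B \<subseteq> univ (Mc j)"
  proof (rule regularCard_UNION)
    show "Card_order mu" "regularCard mu" using mu by simp_all
    show "relChain mu (\<lambda>j. univ (Mc j))" unfolding relChain_def using limit_chain_mono[OF C] by blast
    show "f ` B \<subseteq> (\<Union>j\<in>Field mu. univ (Mc j))" using f(2) limit_chainD(8)[OF C] by simp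
    show "|f ` B| <o mu" by (rule ordLeq_ordLess_trans[OF card_of_image B(2)])
  qed
  then obtain j where j: "j \<in> Field mu" "f ` B \<subseteq> univ (Mc j)" by (rule bexE)
  let ?P = "Mc j"
  have P: "is_model L T ?P" by (rule limit_chainD(2)[OF C j(1)])
  then have Ps: "is_struct L ?P" by (simp add: is_model_def)
  then have Pne: "univ ?P \<noteq> {}" by (simp add: is_struct_def)
  have Pl: "|univ ?P| \<le>o |Field lambda|"
    by (rule ordIso_imp_ordLeq[OF ordIso_transitive[OF limit_chainD(3)[OF C j(1)] ordIso_symmetric[OF lF]]])
  have fP: "pelem L M ?P B f"
    unfolding pelem_def
  proof (intro allI impI, elim conjE)
    fix \<phi> e assume \<phi>: "fm_in L \<phi>" "e ` fv \<phi> \<subseteq> B"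
    have "sat M e \<phi> = sat N (f \<circ> e) \<phi>" using f(1) \<phi> unfolding pelem_def by blast
    also have "\<dots> = sat ?P (f \<circ> e) \<phi>"
      by (rule elem_subD[OF limit_chainD(7)[OF C j(1)] Pne \<phi>(1), symmetric]) (use \<phi>(2) j(2) in auto)
    finally show "sat M e \<phi> = sat ?P (f \<circ> e) \<phi>" .
  qed
  define G :: "('f, 'r) fm \<times> 'a list \<Rightarrow> ('f, 'r) fm \<times> (nat \<Rightarrow> 'a + nat)"
    where "G = (\<lambda>(\<phi>, b). (\<phi>, \<lambda>v. if v < n then Inr v else Inl (f (b ! (v - n)))))"
  have G_sat: "sat K (case_sum id h \<circ> snd (G \<psi>)) (fst (G \<psi>)) \<longleftrightarrow> msat K n {\<psi>} h f" for K h \<psi>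
  proof -
    obtain \<phi> b where \<psi>: "\<psi> = (\<phi>, b)" by (cases \<psi>)
    have "case_sum id h \<circ> (\<lambda>v. if v < n then Inr v else Inl (f (b ! (v - n)))) =
      (\<lambda>v. if v < n then h v else f (b ! (v - n)))" by auto
    then show ?thesis by (simp add: G_def \<psi> msat_def)
  qed
  have "\<exists>Q h. is_struct L Q \<and> elem_sub L ?P Q \<and> |univ Q| \<le>o |Field lambda| \<and> h ` {..<n} \<subseteq> univ Q \<and>
     (\<forall>(\<phi>, \<sigma>)\<in>G ` q. sat Q (case_sum id h \<circ> \<sigma>) \<phi>)"
  proof (rule realize_extension[OF Ps L _ Pl ZU])
    show "|{..<n}| \<le>o |Field lambda|" by (rule card_finite_le[OF l(2)]) simp
  next
    fix \<phi> \<sigma> assume "(\<phi>, \<sigma>) \<in> G ` q"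
    then obtain b where b: "(\<phi>, b) \<in> q" "\<sigma> = (\<lambda>v. if v < n then Inr v else Inl (f (b ! (v - n))))"
      by (auto simp: G_def)
    have pf: "fm_in L \<phi>" "fv \<phi> \<subseteq> {..<n + length b}" using qpf b(1) by (auto simp: pfmls_def)
    have "\<sigma> v \<in> Inl ` univ ?P \<union> Inr ` {..<n}" if v: "v \<in> fv \<phi>" for v
    proof (cases "v < n")
      case False
      then have "b ! (v - n) \<in> set b" using pf(2) v by (intro nth_mem) auto
      then have "f (b ! (v - n)) \<in> univ ?P" using qB[OF b(1)] j(2) by blast
      then show ?thesis using False b(2) by simp
    qed (simp add: b(2))
    then show "fm_in L \<phi> \<and> \<sigma> ` fv \<phi> \<subseteq> Inl ` univ ?P \<union> Inr ` {..<n}" using pf(1) by blast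
  next
    fix \<Gamma> assume "finite \<Gamma>" "\<Gamma> \<subseteq> G ` q"
    then obtain q0 where q0: "q0 \<subseteq> q" "finite q0" "\<Gamma> = G ` q0" by (metis finite_subset_image)
    have q0pf: "q0 \<subseteq> pfmls L n A" using q0(1) qpf by blast
    have q0B: "u \<in> B" if "(\<phi>, b) \<in> q0" "u \<in> set b" for \<phi> b u using that qB q0(1) by blast
    have "finite q0 \<and> q0 \<subseteq> p" using q0 q(1) by blast
    then have "\<exists>x\<in>tuples M n. \<forall>\<psi>\<in>q0. psat M x \<psi>" using p unfolding complete_type_def by blast
    then obtain xs where xs: "xs \<in> tuples M n" "\<forall>\<psi>\<in>q0. psat M xs \<psi>" by (rule bexE)
    have xl: "length xs = n" "set xs \<subseteq> univ M" using xs(1) by (auto simp: tuples_def)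
    have "msat M n q0 (\<lambda>i. xs ! i) id \<longleftrightarrow> (\<forall>(\<phi>, b)\<in>q0. psat M xs (\<phi>, map id b))"
      by (rule msat_psat[OF q0pf xl(1)]) simp
    then have xm: "msat M n q0 (\<lambda>i. xs ! i) id" using xs(2) by auto
    \<comment> \<open>Solvability of the finite part \<open>q0\<close> is a definable condition on
      \<open>B\<close>, so \<open>f\<close> carries it from \<open>M\<close> to
      \<open>Mc j\<close>.\<close>
    let ?R = "\<lambda>(K :: ('f, 'r, 'a) struct) e. msat K n q0 (\<lambda>i. e (Inl i)) (\<lambda>u. e (Inr u))"
    have "dfn L (range Inl \<union> Inr ` B) ?R"
      by (rule dfn_msat[OF q0(2) q0pf, where \<xi> = Inl and \<eta> = Inr]) (use q0B in auto)
    from dfn_ex[OF this, of "range Inl"]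
    have dR: "dfn L (Inr ` B) (\<lambda>K. ex_on K (range (Inl :: nat \<Rightarrow> nat + 'a)) (?R K))"
      by (rule dfn_mono) auto
    obtain a where a: "a \<in> univ M" using Ms by (auto simp: is_struct_def)
    obtain c where c: "c \<in> univ ?P" using Pne by blast
    define e1 where "e1 w = (case w of Inl i \<Rightarrow> if i < n then xs ! i else a | Inr u \<Rightarrow> if u \<in> B then u else a)" for w
    define e2 where "e2 w = (case w of Inl i \<Rightarrow> c | Inr u \<Rightarrow> if u \<in> B then f u else c)" for w :: "nat + 'a"
    have "e1 w \<in> univ M" for w using a B(1) xl by (auto simp: e1_def split: sum.splits)
    then have e1: "range e1 \<subseteq> univ M" by blast
    have "e2 w \<in> univ ?P" for w using c j(2) by (auto simp: e2_def split: sum.splits)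
    then have e2: "range e2 \<subseteq> univ ?P" by blast
    have "msat M n q0 (\<lambda>i. e1 (Inl i)) (\<lambda>u. e1 (Inr u)) = msat M n q0 (\<lambda>i. xs ! i) id"
      by (rule msat_cong[OF q0pf]) (use q0B in \<open>auto simp: e1_def\<close>)
    then have "ex_on M (range Inl) (?R M) e1" using xm e1 unfolding ex_on_def by (intro exI[of _ e1]) simp
    moreover have "ex_on M (range Inl) (?R M) e1 = ex_on ?P (range Inl) (?R ?P) e2"
      by (rule dfn_pelem[OF dR fP Ms Ps e1 e2]) (auto simp: e1_def e2_def)
    ultimately have "ex_on ?P (range Inl) (?R ?P) e2" by simp
    then obtain e where e: "range e \<subseteq> univ ?P" "\<forall>v. v \<notin> range Inl \<longrightarrow> e v = e2 v" "?R ?P e"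
      unfolding ex_on_def by (elim exE conjE)
    have "e (Inr u) = f u" if "u \<in> B" for u
    proof -
      have "e (Inr u) = e2 (Inr u)" by (rule e(2)[rule_format]) auto
      then show ?thesis using that by (simp add: e2_def)
    qed
    then have "msat ?P n q0 (\<lambda>i. e (Inl i)) (\<lambda>u. e (Inr u)) = msat ?P n q0 (\<lambda>i. e (Inl i)) f"
      by (intro msat_cong[OF q0pf]) (use q0B in auto)
    then have em: "msat ?P n q0 (\<lambda>i. e (Inl i)) f" using e(3) by simp
    have "sat ?P (case_sum id (\<lambda>i. e (Inl i)) \<circ> snd (G \<psi>)) (fst (G \<psi>))" if "\<psi> \<in> q0" for \<psi>
      unfolding G_sat using em that by (simp add: msat_def)
    then show "\<exists>h. range h \<subseteq> univ ?P \<and> (\<forall>(\<phi>, \<sigma>)\<in>\<Gamma>. sat ?P (case_sum id h \<circ> \<sigma>) \<phi>)"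
      using e(1) unfolding q0(3) by (intro exI[of _ "\<lambda>i. e (Inl i)"]) (auto simp: split_beta image_subset_iff)
  qed
  then obtain Q h where Q: "is_struct L Q" "elem_sub L ?P Q" "|univ Q| \<le>o |Field lambda|" "h ` {..<n} \<subseteq> univ Q"
    and sat: "\<forall>(\<phi>, \<sigma>)\<in>G ` q. sat Q (case_sum id h \<circ> \<sigma>) \<phi>" by (elim exE conjE)
  have hm: "msat Q n q h f"
  proof -
    have "msat Q n {\<psi>} h f" if "\<psi> \<in> q" for \<psi>
      using bspec[OF sat imageI[OF that]] unfolding G_sat[symmetric] by (simp add: split_beta)
    then show ?thesis unfolding msat_def by blast
  qed
  have Ql: "|univ Q| \<le>o lambda" by (rule ordLeq_ordIso_trans[OF Q(3) lF])
  obtain k where k: "elem_embedding L Q N k" "\<forall>x\<in>univ ?P. k x = x"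
    using limit_chain_universal[OF C T j(1) Q(1,2) Ql] by (elim exE conjE)
  have fQ: "f u \<in> univ Q" if "u \<in> B" for u using that j(2) Q(2) by (auto simp: elem_sub_def)
  have "msat Q n q h f \<longleftrightarrow> msat N n q (k \<circ> h) (k \<circ> f)"
  proof (rule msat_embed[OF k(1) _ qpf])
    show "univ Q \<noteq> {}" using Q(1) by (simp add: is_struct_def)
  qed (use Q(4) fQ qB in auto)
  also have "\<dots> \<longleftrightarrow> msat N n q (k \<circ> h) f"
  proof (rule msat_cong[OF qpf])
    fix \<phi> b u assume "(\<phi>, b) \<in> q" "u \<in> set b"
    then have "f u \<in> univ ?P" using qB j(2) by blast
    then show "(k \<circ> f) u = f u" using k(2) by simp
  qed simp
  finally have "msat N n q (k \<circ> h) f" using hm by simp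
  moreover have "(k \<circ> h) i \<in> univ N" if "i < n" for i
    using k(1) Q(4) that unfolding elem_embedding_def by auto
  ultimately show ?thesis by blast
qed

section \<open>Comparison of the two limit models\<close>

lemma pfmls_mono: "A \<subseteq> B \<Longrightarrow> pfmls L n A \<subseteq> pfmls L n B"
  by (auto simp: pfmls_def)

lemma pfmls_params: "q \<subseteq> pfmls L n A \<Longrightarrow> \<Union> (set ` snd ` q) \<subseteq> A"
  by (fastforce simp: pfmls_def)

lemma not_kappa_prop_witness:
  fixes k :: "'a rel" and L :: "('f, 'r) lang"
  assumes "\<not> kappa_prop L T k"
  shows "\<exists>(M :: ('f, 'r, 'a) struct) A n p. is_model L T M \<and> (\<forall>i\<in>Field k. A i \<subseteq> univ M) \<and> relChain k A \<and>
    complete_type L M n (\<Union>i\<in>Field k. A i) p \<and> (\<forall>i\<in>Field k. forks L M n p (A i))"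
proof (rule ccontr)
  assume n: "\<not> ?thesis"
  have "kappa_prop L T k" unfolding kappa_prop_def
  proof (intro allI impI, elim conjE)
    fix M :: "('f, 'r, 'a) struct" and A n p
    assume a: "is_model L T M" "\<forall>i\<in>Field k. A i \<subseteq> univ M" "relChain k A"
      "complete_type L M n (\<Union>i\<in>Field k. A i) p"
    show "\<exists>i\<in>Field k. \<not> forks L M n p (A i)"
    proof (rule ccontr)
      assume "\<not> (\<exists>i\<in>Field k. \<not> forks L M n p (A i))"
      then have f: "\<forall>i\<in>Field k. forks L M n p (A i)" by blast
      show False
        by (rule notE[OF n], rule exI[of _ M], rule exI[of _ A], rule exI[of _ n], rule exI[of _ p])
          (intro conjI a f)
    qed
  qed
  then show False using assms by blast
qed

theorem theorem3p2:
  fixes L :: "('f, 'r) lang"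
    and T :: "('f, 'r) fm set"
    and lambda mu1 mu2 :: "'a rel"
    and N1 N2 :: "('f, 'r, 'a) struct"
  assumes "complete_theory TYPE('a) L T"
    and "has_infinite_model TYPE('a) L T"
    and "Card_order lambda"
    and "lambda <o |UNIV :: 'a set|"
    and "theory_card L \<le>o lambda"
    and "stable_in L T lambda"
    and "Cinfinite mu1" and "regularCard mu1"
    and "Cinfinite mu2" and "regularCard mu2"
    and "less_kappa_r L T mu1"
    and "mu1 <o mu2" and "mu2 <o cardSuc lambda"
    and "limit_model L T lambda mu1 N1"
    and "limit_model L T lambda mu2 N2"
  shows "\<not> isomorphic L N1 N2"
proof
  assume iso: "isomorphic L N1 N2"
  note T = assms(1) and l = assms(3) and lU = assms(4) and st = assms(6) and mu1 = assms(7,8) and mu2 = assms(9,10)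
  have Ts: "T \<subseteq> sentences L" using T by (simp add: complete_theory_def)
  have lF: "|Field lambda| =o lambda" by (rule card_of_Field_ordIso[OF l])
  have "natLeq \<le>o theory_card L" by (rule ordLeq_csum2[OF natLeq_Card_order])
  from ordLeq_transitive[OF this assms(5)] have "natLeq \<le>o |Field lambda|"
    by (rule ordLeq_ordIso_trans[OF _ ordIso_symmetric[OF lF]])
  then have li: "infinite (Field lambda)" using infinite_iff_natLeq_ordLeq by blast
  have FR: "|funs L| +c |rels L| \<le>o lambda"
    by (rule ordLeq_transitive[OF ordLeq_csum1[OF Card_order_csum] assms(5)])
  note toF = ordLeq_ordIso_trans[OF _ ordIso_symmetric[OF lF]]
  have "|funs L| \<le>o |Field lambda|"
    by (rule toF[OF ordLeq_transitive[OF ordLeq_csum1[OF card_of_Card_order] FR]])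
  moreover have "|rels L| \<le>o |Field lambda|"
    by (rule toF[OF ordLeq_transitive[OF ordLeq_csum2[OF card_of_Card_order] FR]])
  ultimately have L: "big L (Field lambda)" using li by (simp add: big_def)
  have "mu1 <o cardSuc lambda" by (rule ordLess_transitive[OF assms(12,13)])
  then have mul: "mu1 \<le>o lambda" using mu1(1) l by (simp add: cardSuc_ordLeq_ordLess)
  obtain M1 where C1: "limit_chain L T lambda mu1 M1 N1" using limit_model_chain[OF assms(14)] by (rule exE)
  obtain M2 where C2: "limit_chain L T lambda mu2 M2 N2" using limit_model_chain[OF assms(15)] by (rule exE)
  have N1: "is_model L T N1" by (rule limit_chainD(6)[OF C1])
  then have N1s: "is_struct L N1" by (simp add: is_model_def)
  have Wo: "Well_order mu1" using mu1(1) by (simp add: card_order_on_def)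
  have "\<not> kappa_prop L T mu1" by (rule less_kappa_r_not_kappa_prop[OF mu1 assms(11)])
  from not_kappa_prop_witness[OF this]
  obtain M :: "('f, 'r, 'a) struct" and A n p where M: "is_model L T M"
    and AM: "\<forall>i\<in>Field mu1. A i \<subseteq> univ M" and ch: "relChain mu1 A"
    and p: "complete_type L M n (\<Union>i\<in>Field mu1. A i) p" and fk: "\<forall>i\<in>Field mu1. forks L M n p (A i)"
    by (elim exE conjE)
  have "\<forall>i\<in>Field mu1. \<exists>q. finite q \<and> q \<subseteq> p \<and> forks_via L M n q (A i)"
    using fk by (intro ballI forks_imp_via) simp
  from bchoice[OF this] obtain q where q: "\<forall>i\<in>Field mu1. finite (q i) \<and> q i \<subseteq> p \<and> forks_via L M n (q i) (A i)"
    by (rule exE)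
  define E where "E i = \<Union> (set ` snd ` q i)" for i
  have ppf: "p \<subseteq> pfmls L n (\<Union>i\<in>Field mu1. A i)" using p by (simp add: complete_type_def)
  have EA: "E i \<subseteq> (\<Union>i\<in>Field mu1. A i)" if "i \<in> Field mu1" for i
  proof -
    have "q i \<subseteq> pfmls L n (\<Union>i\<in>Field mu1. A i)" using q that ppf by blast
    then show ?thesis unfolding E_def by (rule pfmls_params)
  qed
  have finE: "finite (E i)" if "i \<in> Field mu1" for i using q that by (auto simp: E_def)
  \<comment> \<open>The forking chain is thinned. Fewer than \<open>mu1\<close> finite parameter
    sets have a union of size below \<open>mu1\<close>, which regularity places inside a single
    \<open>A k\<close>; choosing such a \<open>k\<close> as \<open>g i\<close> puts the parameters
    of all earlier stages into the set over which stage \<open>i\<close> forks.\<close>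
  have "\<exists>g. \<forall>i\<in>Field mu1. g i \<in> Field mu1 \<and> (\<forall>j\<in>underS mu1 i. E (g j) \<subseteq> A (g i))"
  proof (rule wo_dependent_choice[OF Wo, where E = "\<lambda>i. {i}"])
    fix i f g assume i: "i \<in> Field mu1" and fi: "f i \<in> Field mu1 \<and> (\<forall>j\<in>underS mu1 i. E (f j) \<subseteq> A (f i))"
      and fg: "\<And>j u. j \<in> under mu1 i \<Longrightarrow> u \<in> {j} \<Longrightarrow> f u = g u"
    have "(i, i) \<in> mu1" using Wo i by (auto simp: order_on_defs refl_on_def)
    then have "f i = g i" using fg[of i i] by (simp add: under_def)
    moreover have "f j = g j" if "j \<in> underS mu1 i" for j
      using fg[of j j] that by (simp add: under_def underS_def)
    ultimately show "g i \<in> Field mu1 \<and> (\<forall>j\<in>underS mu1 i. E (g j) \<subseteq> A (g i))" using fi by simp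
  next
    fix i f assume i: "i \<in> Field mu1"
      and IH: "\<And>j. j \<in> underS mu1 i \<Longrightarrow> f j \<in> Field mu1 \<and> (\<forall>k\<in>underS mu1 j. E (f k) \<subseteq> A (f j))"
    have "\<exists>k\<in>Field mu1. (\<Union>j\<in>underS mu1 i. E (f j)) \<subseteq> A k"
    proof (rule regularCard_UNION[OF _ mu1(2) ch])
      show "Card_order mu1" using mu1(1) by simp
      then have "|underS mu1 i| <o mu1" using i by (rule card_of_underS)
      then show "|\<Union>j\<in>underS mu1 i. E (f j)| <o mu1"
        by (rule ordLess_UN_finite[OF mu1]) (use finE IH in blast)
      show "(\<Union>j\<in>underS mu1 i. E (f j)) \<subseteq> (\<Union>i\<in>Field mu1. A i)" using EA IH by blast
    qed
    then obtain k where k: "k \<in> Field mu1" "(\<Union>j\<in>underS mu1 i. E (f j)) \<subseteq> A k" by (rule bexE)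
    have "i \<notin> underS mu1 i" by (simp add: underS_def)
    then show "\<exists>g. (\<forall>j\<in>underS mu1 i. \<forall>u\<in>{j}. g u = f u) \<and> g i \<in> Field mu1 \<and> (\<forall>j\<in>underS mu1 i. E (g j) \<subseteq> A (g i))"
      using k by (intro exI[of _ "f(i := k)"]) auto
  qed
  then obtain g where g: "\<forall>i\<in>Field mu1. g i \<in> Field mu1 \<and> (\<forall>j\<in>underS mu1 i. E (g j) \<subseteq> A (g i))" by (rule exE)
  define q' where "q' i = q (g i)" for i
  define E' where "E' i = E (g i)" for i
  define B where "B = (\<Union>i\<in>Field mu1. E' i)"
  have AM': "(\<Union>i\<in>Field mu1. A i) \<subseteq> univ M" using AM by blast
  have BM: "B \<subseteq> univ M" using EA g AM' unfolding B_def E'_def by blast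
  have q'p: "q' i \<subseteq> p" if "i \<in> Field mu1" for i using q g that by (simp add: q'_def)
  have q'M: "q' i \<subseteq> pfmls L n (univ M)" if "i \<in> Field mu1" for i
    using q'p[OF that] ppf pfmls_mono[OF AM', of L n] by (meson subset_trans)
  have "\<exists>f. pelem L M N1 B f \<and> f ` B \<subseteq> univ N1 \<and>
      (\<forall>i\<in>Field mu1. \<forall>x\<in>tuples (M1 i) n. \<not> msat N1 n (q' i) (\<lambda>v. x ! v) f)"
    unfolding B_def
  proof (rule omitting_chain[OF T st l li lU L mu1 mul C1 M, where A = "\<lambda>i. A (g i)"])
    show "finite (q' i) \<and> q' i \<subseteq> pfmls L n (univ M) \<and> forks_via L M n (q' i) (A (g i))" if "i \<in> Field mu1" for i
      using q g q'M that by (simp add: q'_def)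
    show "E' i = \<Union> (set ` snd ` q' i)" for i by (simp add: E'_def E_def q'_def)
    show "E' j \<subseteq> A (g i)" if "i \<in> Field mu1" "j \<in> underS mu1 i" for i j using g that by (simp add: E'_def)
  qed
  then obtain f where f: "pelem L M N1 B f" "f ` B \<subseteq> univ N1"
    and om: "\<forall>i\<in>Field mu1. \<forall>x\<in>tuples (M1 i) n. \<not> msat N1 n (q' i) (\<lambda>v. x ! v) f" by (elim exE conjE)
  obtain hh where bij: "bij_betw hh (univ N1) (univ N2)" and hh: "elem_embedding L N1 N2 hh"
    using isomorphic_elem_embedding[OF N1s iso] by (elim exE conjE)
  have N1ne: "univ N1 \<noteq> {}" using N1s by (simp add: is_struct_def)
  have f2: "pelem L M N2 B (hh \<circ> f)"
    unfolding pelem_def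
  proof (intro allI impI, elim conjE)
    fix \<phi> e assume \<phi>: "fm_in L \<phi>" "e ` fv \<phi> \<subseteq> B"
    have "sat M e \<phi> = sat N1 (f \<circ> e) \<phi>" using f(1) \<phi> unfolding pelem_def by blast
    also have "\<dots> = sat N2 (hh \<circ> (f \<circ> e)) \<phi>"
      by (rule elem_embeddingD[OF hh N1ne \<phi>(1)]) (use \<phi>(2) f(2) in auto)
    finally show "sat M e \<phi> = sat N2 (hh \<circ> f \<circ> e) \<phi>" by (simp add: o_assoc)
  qed
  define qq where "qq = (\<Union>i\<in>Field mu1. q' i)"
  have qqp: "qq \<subseteq> p" using q'p by (auto simp: qq_def)
  have qqpf: "qq \<subseteq> pfmls L n (univ M)" using q'M by (auto simp: qq_def)
  have qqB: "\<Union> (set ` snd ` qq) \<subseteq> B" by (auto simp: qq_def B_def E'_def E_def q'_def)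
  \<comment> \<open>The place where \<open>mu1 <o mu2\<close> and the regularity of
    \<open>mu2\<close> combine: a union of fewer than \<open>mu2\<close> finite sets has size below
    \<open>mu2\<close>.\<close>
  have "|B| <o mu2"
  proof -
    have "|Field mu1| <o mu2"
      by (rule ordIso_ordLess_trans[OF card_of_Field_ordIso assms(12)]) (use mu1(1) in simp)
    then show ?thesis unfolding B_def E'_def by (rule ordLess_UN_finite[OF mu2]) (use finE g in blast)
  qed
  moreover have "(hh \<circ> f) ` B \<subseteq> univ N2" using f(2) hh by (auto simp: elem_embedding_def)
  ultimately have "\<exists>x. (\<forall>i<n. x i \<in> univ N2) \<and> msat N2 n qq x (hh \<circ> f)"
    using realizing_chain[OF Ts l li lU L mu2 C2 M p AM' qqp qqB BM _ f2] by blast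
  then obtain x where x: "\<forall>i<n. x i \<in> univ N2" "msat N2 n qq x (hh \<circ> f)" by (elim exE conjE)
  define y where "y i = inv_into (univ N1) hh (x i)" for i
  have y: "y i \<in> univ N1" "hh (y i) = x i" if "i < n" for i
  proof -
    have "x i \<in> hh ` univ N1" using x(1) that bij by (simp add: bij_betw_def)
    then show "y i \<in> univ N1" "hh (y i) = x i" by (simp_all add: y_def inv_into_into f_inv_into_f)
  qed
  have "msat N1 n qq y f \<longleftrightarrow> msat N2 n qq (hh \<circ> y) (hh \<circ> f)"
  proof (rule msat_embed[OF hh N1ne qqpf])
    fix \<phi> b u assume "(\<phi>, b) \<in> qq" "u \<in> set b"
    then have "u \<in> B" using qqB by force
    then show "f u \<in> univ N1" using f(2) by blast
  qed (rule y(1))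
  also have "\<dots> \<longleftrightarrow> msat N2 n qq x (hh \<circ> f)"
    by (rule msat_cong[OF qqpf]) (simp_all add: y)
  finally have ym: "msat N1 n qq y f" using x(2) by simp
  have wo: "wo_rel mu1" using Wo by (simp add: wo_rel_def)
  \<comment> \<open>Being finite, the realization \<open>y\<close> lies in some \<open>M1 i\<close>
    already, and there \<open>q' i\<close> was to be avoided.\<close>
  have "\<exists>i\<in>Field mu1. \<forall>v<n. y v \<in> univ (M1 i)"
  proof (cases "n = 0")
    case True
    have "Field mu1 \<noteq> {}" using mu1(1) by (auto simp: cinfinite_def)
    then show ?thesis using True by auto
  next
    case False
    have "\<forall>v\<in>{..<n}. \<exists>i. i \<in> Field mu1 \<and> y v \<in> univ (M1 i)"
      using y(1) unfolding limit_chainD(8)[OF C1] by blast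
    from bchoice[OF this] obtain ix where ix: "\<forall>v\<in>{..<n}. ix v \<in> Field mu1 \<and> y v \<in> univ (M1 (ix v))" by (rule exE)
    have "\<exists>m\<in>ix ` {..<n}. \<forall>i\<in>ix ` {..<n}. (i, m) \<in> mu1"
      by (rule finite_max_in[OF wo]) (use False ix in auto)
    then obtain m where m: "m \<in> ix ` {..<n}" "\<forall>i\<in>ix ` {..<n}. (i, m) \<in> mu1" by (rule bexE)
    have "y v \<in> univ (M1 m)" if "v < n" for v
    proof -
      have "(ix v, m) \<in> mu1" using m(2) that by blast
      from limit_chain_mono[OF C1 this] show ?thesis using ix that by blast
    qed
    moreover have "m \<in> Field mu1" using m(1) ix by auto
    ultimately show ?thesis by blast
  qed
  then obtain i where i: "i \<in> Field mu1" "\<forall>v<n. y v \<in> univ (M1 i)" by (rule bexE)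
  have "map y [0..<n] \<in> tuples (M1 i) n" using i(2) by (auto simp: tuples_def)
  moreover have "msat N1 n (q' i) (\<lambda>v. map y [0..<n] ! v) f = msat N1 n (q' i) y f"
    by (rule msat_cong[OF q'M[OF i(1)]]) simp_all
  moreover have "msat N1 n (q' i) y f" using ym i(1) unfolding msat_def qq_def by blast
  ultimately show False using om i(1) by blast
qed

end
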